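(* Let $M$ be a smooth manifold. The derivation $d_T$ commutes with the Schouten bracket: for all multivector fields $X,Y$ on $M$, $$[d_TX,d_TY]=d_T[X,Y].$$
   Context: Everything is smooth. $\tau_M:TM\to M$ is the projection, $\Phi^r(\tau_M)$ the space of $r$-vector fields on $M$, $\Phi(\tau_M)=\bigoplus_r\Phi^r(\tau_M)$ the exterior algebra of multivector fields. Coordinates $(x^i)$ on $M$ induce $(x^i,\dot x^j)$ on $TM$. Lifts: for a function $f$ on $M$ put $v_Tf=f\circ\tau_M$ and $d_Tf(v)=\langle df,v\rangle$. For a vector field $Y=Y^i\partial_{x^i}$ on $M$, the vertical lift is $Y^v=Y^i\partial_{\dot x^i}$ (generator of $v\mapsto v+tY(\tau_Mv)$) and the complete lift is $Y^c=Y^i\partial_{x^i}+\frac{\partial Y^i}{\partial x^k}\dot x^k\partial_{\dot x^i}$ (generator of $T\varphi^t$, $\varphi^t$ the flow of $Y$). $v_T:\Phi(\tau_M)\to\Phi(\tau_{TM})$ is the unique graded algebra homomorphism extending $v_T$ on functions and $Y\mapsto Y^v$. $d_T:\Phi(\tau_M)\to\Phi(\tau_{TM})$ is the unique linear map with the given value on functions, $d_TY=Y^c$ for vector fields, and $d_T(X\wedge Z)=d_TX\wedge v_TZ+v_TX\wedge d_TZ$. In coordinates, for $X=X^{i_1\dots i_r}\partial_{x^{i_1}}\wedge\dots\wedge\partial_{x^{i_r}}$, $$d_TX=\tfrac{\partial X^{i_1\dots i_r}}{\partial x^k}\dot x^k\,\partial_{\dot x^{i_1}}\wedge\dots\wedge\partial_{\dot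 x^{i_r}}+\sum_mX^{i_1\dots i_r}\,\partial_{\dot x^{i_1}}\wedge\dots\wedge\partial_{x^{i_m}}\wedge\dots\wedge\partial_{\dot x^{i_r}}.$$ The Schouten bracket is the graded Lie bracket on multivector fields ($\Phi^r$ having degree $r-1$) extending the Lie bracket of vector fields and $[X,f]=X(f)$, with $[X,Y\wedge Z]=[X,Y]\wedge Z+(-1)^{s(r-1)}Y\wedge[X,Z]$ for $X\in\Phi^r$, $Y\in\Phi^s$. *)

theory Defs
  imports "HOL-Analysis.Analysis"
begin

section \<open>Smooth functions on open subsets of Euclidean space\<close>

text \<open>
  The model space of dimension n is the library's \<^const>\<open>Euclidean_space\<close>, whose points are the
  functions x with x i = 0 for i \<ge> n; the coordinates are numbered 0, ..., n - 1.
\<close>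

definition pderiv_coord :: "nat \<Rightarrow> ((nat \<Rightarrow> real) \<Rightarrow> real) \<Rightarrow> (nat \<Rightarrow> real) \<Rightarrow> real" where
  "pderiv_coord i f x = deriv (\<lambda>t. f (x(i := t))) (x i)"

primrec Ck_on :: "nat \<Rightarrow> nat \<Rightarrow> (nat \<Rightarrow> real) set \<Rightarrow> ((nat \<Rightarrow> real) \<Rightarrow> real) \<Rightarrow> bool" where
  "Ck_on 0 n U f \<longleftrightarrow> continuous_map (subtopology (Euclidean_space n) U) euclideanreal f"
| "Ck_on (Suc k) n U f \<longleftrightarrow>
     continuous_map (subtopology (Euclidean_space n) U) euclideanreal f \<and>
     (\<forall>i<n. (\<forall>x\<in>U. (\<lambda>t. f (x(i := t))) field_differentiable at (x i)) \<and>
             Ck_on k n U (pderiv_coord i f))"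

definition smooth_on :: "nat \<Rightarrow> (nat \<Rightarrow> real) set \<Rightarrow> ((nat \<Rightarrow> real) \<Rightarrow> real) \<Rightarrow> bool" where
  "smooth_on n U f \<longleftrightarrow> (\<forall>k. Ck_on k n U f)"


section \<open>Smooth manifolds\<close>

text \<open>
  A manifold is given by its dimension, its topological space of points, and an atlas indexed by a
  set of indices: the chart with index c has domain mdom M c and coordinate map mcoord M c.
  The tangent bundle has an atlas with the same index set.
\<close>

record ('a, 'c) manifold =
  mdim :: nat
  mtop :: "'a topology"
  mindex :: "'c set"
  mdom :: "'c \<Rightarrow> 'a set"
  mcoord :: "'c \<Rightarrow> 'a \<Rightarrow> (nat \<Rightarrow> real)"

definition mimage :: "('a, 'c) manifold \<Rightarrow> 'c \<Rightarrow> (nat \<Rightarrow> real) set" where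
  "mimage M c = mcoord M c ` mdom M c"

definition mparam :: "('a, 'c) manifold \<Rightarrow> 'c \<Rightarrow> (nat \<Rightarrow> real) \<Rightarrow> 'a" where
  "mparam M c = inv_into (mdom M c) (mcoord M c)"

definition charts_at :: "('a, 'c) manifold \<Rightarrow> 'a \<Rightarrow> 'c set" where
  "charts_at M p = {c \<in> mindex M. p \<in> mdom M c}"

definition smooth_manifold :: "('a, 'c) manifold \<Rightarrow> bool" where
  "smooth_manifold M \<longleftrightarrow>
     Hausdorff_space (mtop M) \<and> second_countable (mtop M) \<and>
     topspace (mtop M) = (\<Union>c\<in>mindex M. mdom M c) \<and>
     (\<forall>c\<in>mindex M.
        openin (mtop M) (mdom M c) \<and>
        openin (Euclidean_space (mdim M)) (mimage M c) \<and>
        homeomorphic_map (subtopology (mtop M) (mdom M c))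
          (subtopology (Euclidean_space (mdim M)) (mimage M c)) (mcoord M c)) \<and>
     (\<forall>c\<in>mindex M. \<forall>d\<in>mindex M. \<forall>i<mdim M.
        smooth_on (mdim M) (mcoord M c ` (mdom M c \<inter> mdom M d))
          (\<lambda>x. mcoord M d (mparam M c x) i))"

definition smooth_fun :: "('a, 'c) manifold \<Rightarrow> ('a \<Rightarrow> real) \<Rightarrow> bool" where
  "smooth_fun M f \<longleftrightarrow> (\<forall>c\<in>mindex M. smooth_on (mdim M) (mimage M c) (\<lambda>x. f (mparam M c x)))"

text \<open>The partial derivative at p of a function f with respect to the i-th coordinate of the chart c:\<close>

definition mpderiv :: "('a, 'c) manifold \<Rightarrow> 'c \<Rightarrow> nat \<Rightarrow> ('a \<Rightarrow> real) \<Rightarrow> 'a \<Rightarrow> real" where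
  "mpderiv M c i f p = pderiv_coord i (\<lambda>x. f (mparam M c x)) (mcoord M c p)"

definition jacobian :: "('a, 'c) manifold \<Rightarrow> 'c \<Rightarrow> 'c \<Rightarrow> 'a \<Rightarrow> nat \<Rightarrow> nat \<Rightarrow> real" where
  "jacobian M c d p j i = mpderiv M c i (\<lambda>q. mcoord M d q j) p"


section \<open>Tangent vectors and vector fields\<close>

text \<open>
  A tangent vector at p is a family of component vectors, one for each chart around p, related by
  the Jacobian matrices of the coordinate changes. Components that have no meaning (a chart not
  around p, an index beyond the dimension) are 0, so that equality of tangent vectors is
  equality of functions; the same convention is used for multivectors below.
\<close>

definition tangent_space :: "('a, 'c) manifold \<Rightarrow> 'a \<Rightarrow> ('c \<Rightarrow> nat \<Rightarrow> real) set" where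
  "tangent_space M p = {v.
     (\<forall>c\<in>charts_at M p. \<forall>d\<in>charts_at M p. \<forall>j<mdim M.
        v d j = (\<Sum>i<mdim M. jacobian M c d p j i * v c i)) \<and>
     (\<forall>c i. \<not> (c \<in> charts_at M p \<and> i < mdim M) \<longrightarrow> v c i = 0)}"

definition vector_field :: "('a, 'c) manifold \<Rightarrow> ('a \<Rightarrow> 'c \<Rightarrow> nat \<Rightarrow> real) \<Rightarrow> bool" where
  "vector_field M Y \<longleftrightarrow>
     (\<forall>p\<in>topspace (mtop M). Y p \<in> tangent_space M p) \<and>
     (\<forall>p. p \<notin> topspace (mtop M) \<longrightarrow> Y p = (\<lambda>c i. 0)) \<and>
     (\<forall>c\<in>mindex M. \<forall>i<mdim M. smooth_on (mdim M) (mimage M c) (\<lambda>x. Y (mparam M c x) c i))"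

text \<open>The pairing of df with a tangent vector v at p; it does not depend on the chart used.\<close>

definition diff_pairing :: "('a, 'c) manifold \<Rightarrow> ('a \<Rightarrow> real) \<Rightarrow> 'a \<Rightarrow> ('c \<Rightarrow> nat \<Rightarrow> real) \<Rightarrow> real" where
  "diff_pairing M f p v =
     (let c = (SOME c. c \<in> charts_at M p) in \<Sum>i<mdim M. mpderiv M c i f p * v c i)"

definition vf_apply :: "('a, 'c) manifold \<Rightarrow> ('a \<Rightarrow> 'c \<Rightarrow> nat \<Rightarrow> real) \<Rightarrow> ('a \<Rightarrow> real) \<Rightarrow> 'a \<Rightarrow> real" where
  "vf_apply M Y f p = diff_pairing M f p (Y p)"

definition lie_bracket :: "('a, 'c) manifold \<Rightarrow> ('a \<Rightarrow> 'c \<Rightarrow> nat \<Rightarrow> real) \<Rightarrow>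
    ('a \<Rightarrow> 'c \<Rightarrow> nat \<Rightarrow> real) \<Rightarrow> 'a \<Rightarrow> 'c \<Rightarrow> nat \<Rightarrow> real" where
  "lie_bracket M Y Z p c j =
     (if c \<in> charts_at M p \<and> j < mdim M
      then \<Sum>i<mdim M. Y p c i * mpderiv M c i (\<lambda>q. Z q c j) p
                     - Z p c i * mpderiv M c i (\<lambda>q. Y q c j) p
      else 0)"


section \<open>The exterior algebra of a coordinate space\<close>

text \<open>
  An element of the exterior algebra is given by its coefficients: a I is the coefficient of
  the basis element that is the wedge product of the basis vectors with indices in I, taken in
  increasing order. The sign in the product counts the transpositions needed to sort.
\<close>

type_synonym ext = "nat set \<Rightarrow> real"

definition shuffle_sign :: "nat set \<Rightarrow> nat set \<Rightarrow> real" where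
  "shuffle_sign I J = (-1) ^ card {(i, j). i \<in> I \<and> j \<in> J \<and> j < i}"

definition wedge :: "ext \<Rightarrow> ext \<Rightarrow> ext" where
  "wedge a b K = (\<Sum>I\<in>Pow K. shuffle_sign I (K - I) * a I * b (K - I))"

definition ext_unit :: ext where
  "ext_unit I = (if I = {} then 1 else 0)"

definition ext_vec :: "(nat \<Rightarrow> real) \<Rightarrow> ext" where
  "ext_vec v I = (if is_singleton I then v (the_elem I) else 0)"

text \<open>
  The algebra homomorphism induced by an n by n matrix A (row index first): it maps the basis
  element of I to the wedge product, in increasing order, of the columns of A with indices in I.
\<close>

definition ext_map :: "nat \<Rightarrow> (nat \<Rightarrow> nat \<Rightarrow> real) \<Rightarrow> ext \<Rightarrow> ext" where
  "ext_map n A a K =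
     (\<Sum>I\<in>Pow {..<n}. a I *
        foldr (\<lambda>i. wedge (ext_vec (\<lambda>j. if j < n then A j i else 0))) (sorted_list_of_set I) ext_unit K)"


section \<open>Multivector fields\<close>

definition ext_tangent_space :: "('a, 'c) manifold \<Rightarrow> 'a \<Rightarrow> ('c \<Rightarrow> ext) set" where
  "ext_tangent_space M p = {a.
     (\<forall>c\<in>charts_at M p. \<forall>d\<in>charts_at M p. a d = ext_map (mdim M) (jacobian M c d p) (a c)) \<and>
     (\<forall>c I. \<not> (c \<in> charts_at M p \<and> I \<subseteq> {..<mdim M}) \<longrightarrow> a c I = 0)}"

type_synonym ('a, 'c) mvf = "'a \<Rightarrow> 'c \<Rightarrow> ext"

definition mvfields :: "('a, 'c) manifold \<Rightarrow> ('a, 'c) mvf set" where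
  "mvfields M = {X.
     (\<forall>p\<in>topspace (mtop M). X p \<in> ext_tangent_space M p) \<and>
     (\<forall>p. p \<notin> topspace (mtop M) \<longrightarrow> X p = (\<lambda>c I. 0)) \<and>
     (\<forall>c\<in>mindex M. \<forall>I. I \<subseteq> {..<mdim M} \<longrightarrow>
        smooth_on (mdim M) (mimage M c) (\<lambda>x. X (mparam M c x) c I))}"

text \<open>The degree is an integer, as the bracket of two functions has degree -1 (and hence is 0).\<close>

definition mvfields_deg :: "('a, 'c) manifold \<Rightarrow> int \<Rightarrow> ('a, 'c) mvf set" where
  "mvfields_deg M r = {X \<in> mvfields M. \<forall>p c I. X p c I \<noteq> 0 \<longrightarrow> int (card I) = r}"

definition mv_add :: "('a, 'c) mvf \<Rightarrow> ('a, 'c) mvf \<Rightarrow> ('a, 'c) mvf" where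
  "mv_add X Y = (\<lambda>p c I. X p c I + Y p c I)"

definition mv_scale :: "real \<Rightarrow> ('a, 'c) mvf \<Rightarrow> ('a, 'c) mvf" where
  "mv_scale t X = (\<lambda>p c I. t * X p c I)"

definition mv_wedge :: "('a, 'c) mvf \<Rightarrow> ('a, 'c) mvf \<Rightarrow> ('a, 'c) mvf" where
  "mv_wedge X Y = (\<lambda>p c. wedge (X p c) (Y p c))"

text \<open>Functions and vector fields as multivector fields of degree 0 and 1:\<close>

definition mv_fun :: "('a, 'c) manifold \<Rightarrow> ('a \<Rightarrow> real) \<Rightarrow> ('a, 'c) mvf" where
  "mv_fun M f = (\<lambda>p c I. if c \<in> charts_at M p \<and> I = {} then f p else 0)"

definition mv_vec :: "('a \<Rightarrow> 'c \<Rightarrow> nat \<Rightarrow> real) \<Rightarrow> ('a, 'c) mvf" where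
  "mv_vec Y = (\<lambda>p c. ext_vec (Y p c))"

definition mv_linear ::
  "('a, 'c) manifold \<Rightarrow> ('b, 'd) manifold \<Rightarrow> (('a, 'c) mvf \<Rightarrow> ('b, 'd) mvf) \<Rightarrow> bool" where
  "mv_linear M N L \<longleftrightarrow>
     (\<forall>X\<in>mvfields M. L X \<in> mvfields N) \<and>
     (\<forall>X\<in>mvfields M. \<forall>Y\<in>mvfields M. L (mv_add X Y) = mv_add (L X) (L Y)) \<and>
     (\<forall>t. \<forall>X\<in>mvfields M. L (mv_scale t X) = mv_scale t (L X))"


section \<open>The Schouten bracket\<close>

text \<open>The following properties determine the bracket B on the multivector fields of M:\<close>

definition is_schouten_bracket ::
  "('a, 'c) manifold \<Rightarrow> (('a, 'c) mvf \<Rightarrow> ('a, 'c) mvf \<Rightarrow> ('a, 'c) mvf) \<Rightarrow> bool" where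
  "is_schouten_bracket M B \<longleftrightarrow>
     \<comment> \<open>bilinear, and a graded Lie bracket when r-vector fields are given the degree r - 1\<close>
     (\<forall>X\<in>mvfields M. mv_linear M M (B X) \<and> mv_linear M M (\<lambda>Z. B Z X)) \<and>
     (\<forall>r s. \<forall>X\<in>mvfields_deg M r. \<forall>Y\<in>mvfields_deg M s. B X Y \<in> mvfields_deg M (r + s - 1)) \<and>
     (\<forall>r s. \<forall>X\<in>mvfields_deg M r. \<forall>Y\<in>mvfields_deg M s.
        B X Y = mv_scale (- ((-1) powi ((r - 1) * (s - 1)))) (B Y X)) \<and>
     (\<forall>r s. \<forall>X\<in>mvfields_deg M r. \<forall>Y\<in>mvfields_deg M s. \<forall>Z\<in>mvfields M.
        B X (B Y Z) =
          mv_add (B (B X Y) Z) (mv_scale ((-1) powi ((r - 1) * (s - 1))) (B Y (B X Z)))) \<and>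
     \<comment> \<open>extending the Lie bracket of vector fields and their action on functions\<close>
     (\<forall>Y Z. vector_field M Y \<longrightarrow> vector_field M Z \<longrightarrow>
        B (mv_vec Y) (mv_vec Z) = mv_vec (lie_bracket M Y Z)) \<and>
     (\<forall>Y f. vector_field M Y \<longrightarrow> smooth_fun M f \<longrightarrow>
        B (mv_vec Y) (mv_fun M f) = mv_fun M (vf_apply M Y f)) \<and>
     \<comment> \<open>the graded Leibniz rule\<close>
     (\<forall>r s. \<forall>X\<in>mvfields_deg M r. \<forall>Y\<in>mvfields_deg M s. \<forall>Z\<in>mvfields M.
        B X (mv_wedge Y Z) =
          mv_add (mv_wedge (B X Y) Z) (mv_scale ((-1) powi (s * (r - 1))) (mv_wedge Y (B X Z))))"


section \<open>The tangent bundle and the lifts\<close>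

text \<open>
  Points of the tangent bundle are pairs (p, v) with v tangent at p. The chart induced by c has
  the coordinates of p as coordinates 0, ..., n - 1 and the components of v as coordinates
  n, ..., 2 n - 1.
\<close>

definition tb_points :: "('a, 'c) manifold \<Rightarrow> ('a \<times> ('c \<Rightarrow> nat \<Rightarrow> real)) set" where
  "tb_points M = {(p, v). p \<in> topspace (mtop M) \<and> v \<in> tangent_space M p}"

definition tb_dom :: "('a, 'c) manifold \<Rightarrow> 'c \<Rightarrow> ('a \<times> ('c \<Rightarrow> nat \<Rightarrow> real)) set" where
  "tb_dom M c = {(p, v) \<in> tb_points M. p \<in> mdom M c}"

definition tb_coord ::
  "('a, 'c) manifold \<Rightarrow> 'c \<Rightarrow> 'a \<times> ('c \<Rightarrow> nat \<Rightarrow> real) \<Rightarrow> (nat \<Rightarrow> real)" where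
  "tb_coord M c = (\<lambda>(p, v) k.
     if k < mdim M then mcoord M c p k
     else if k < 2 * mdim M then v c (k - mdim M) else 0)"

definition tangent_bundle ::
  "('a, 'c) manifold \<Rightarrow> ('a \<times> ('c \<Rightarrow> nat \<Rightarrow> real), 'c) manifold" where
  "tangent_bundle M =
     \<lparr> mdim = 2 * mdim M,
       mtop = topology_generated_by
         {{q \<in> tb_dom M c. tb_coord M c q \<in> W} |c W.
            c \<in> mindex M \<and> openin (Euclidean_space (2 * mdim M)) W},
       mindex = mindex M,
       mdom = tb_dom M,
       mcoord = tb_coord M \<rparr>"

definition fun_vlift :: "('a \<Rightarrow> real) \<Rightarrow> 'a \<times> ('c \<Rightarrow> nat \<Rightarrow> real) \<Rightarrow> real" where
  "fun_vlift f = (\<lambda>(p, v). f p)"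

definition fun_clift ::
  "('a, 'c) manifold \<Rightarrow> ('a \<Rightarrow> real) \<Rightarrow> 'a \<times> ('c \<Rightarrow> nat \<Rightarrow> real) \<Rightarrow> real" where
  "fun_clift M f = (\<lambda>(p, v). diff_pairing M f p v)"

definition vertical_lift :: "('a, 'c) manifold \<Rightarrow> ('a \<Rightarrow> 'c \<Rightarrow> nat \<Rightarrow> real) \<Rightarrow>
    'a \<times> ('c \<Rightarrow> nat \<Rightarrow> real) \<Rightarrow> 'c \<Rightarrow> nat \<Rightarrow> real" where
  "vertical_lift M Y = (\<lambda>(p, v) c k.
     if c \<in> charts_at (tangent_bundle M) (p, v) \<and> mdim M \<le> k \<and> k < 2 * mdim M
     then Y p c (k - mdim M) else 0)"

definition complete_lift :: "('a, 'c) manifold \<Rightarrow> ('a \<Rightarrow> 'c \<Rightarrow> nat \<Rightarrow> real) \<Rightarrow>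
    'a \<times> ('c \<Rightarrow> nat \<Rightarrow> real) \<Rightarrow> 'c \<Rightarrow> nat \<Rightarrow> real" where
  "complete_lift M Y = (\<lambda>(p, v) c k.
     if c \<notin> charts_at (tangent_bundle M) (p, v) then 0
     else if k < mdim M then Y p c k
     else if k < 2 * mdim M
     then \<Sum>j<mdim M. mpderiv M c j (\<lambda>q. Y q c (k - mdim M)) p * v c j
     else 0)"

text \<open>The following two predicates characterize the derivation, together with the algebra
  homomorphism along which it is a derivation, by the properties that determine them.\<close>

definition is_vT :: "('a, 'c) manifold \<Rightarrow>
    (('a, 'c) mvf \<Rightarrow> ('a \<times> ('c \<Rightarrow> nat \<Rightarrow> real), 'c) mvf) \<Rightarrow> bool" where
  "is_vT M vT \<longleftrightarrow>
     mv_linear M (tangent_bundle M) vT \<and>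
     (\<forall>r. \<forall>X\<in>mvfields_deg M r. vT X \<in> mvfields_deg (tangent_bundle M) r) \<and>
     (\<forall>X\<in>mvfields M. \<forall>Z\<in>mvfields M. vT (mv_wedge X Z) = mv_wedge (vT X) (vT Z)) \<and>
     (\<forall>f. smooth_fun M f \<longrightarrow> vT (mv_fun M f) = mv_fun (tangent_bundle M) (fun_vlift f)) \<and>
     (\<forall>Y. vector_field M Y \<longrightarrow> vT (mv_vec Y) = mv_vec (vertical_lift M Y))"

definition is_dT :: "('a, 'c) manifold \<Rightarrow>
    (('a, 'c) mvf \<Rightarrow> ('a \<times> ('c \<Rightarrow> nat \<Rightarrow> real), 'c) mvf) \<Rightarrow>
    (('a, 'c) mvf \<Rightarrow> ('a \<times> ('c \<Rightarrow> nat \<Rightarrow> real), 'c) mvf) \<Rightarrow> bool" where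
  "is_dT M vT dT \<longleftrightarrow>
     mv_linear M (tangent_bundle M) dT \<and>
     (\<forall>f. smooth_fun M f \<longrightarrow> dT (mv_fun M f) = mv_fun (tangent_bundle M) (fun_clift M f)) \<and>
     (\<forall>Y. vector_field M Y \<longrightarrow> dT (mv_vec Y) = mv_vec (complete_lift M Y)) \<and>
     (\<forall>X\<in>mvfields M. \<forall>Z\<in>mvfields M.
        dT (mv_wedge X Z) = mv_add (mv_wedge (dT X) (vT Z)) (mv_wedge (vT X) (dT Z)))"

end

theory Submission
  imports Defs
begin

text \<open>
  The identity is proved together with its companions [d_T X, v_T Y] = [v_T X, d_T Y] = v_T [X, Y]
  and [v_T X, v_T Y] = 0: for fixed X the four of them are stable under exterior products in Y by
  the Leibniz rules, and they are symmetric in X and Y. For a vector field and a function they are a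
  computation in coordinates. For two vector fields they follow from the Jacobi identity, as a
  vector field on TM that annihilates all functions v_T f and d_T f vanishes. A general multivector
  field coincides near each point with a sum of products of globally defined functions and vector
  fields, and multiplication by cutoff functions shows that all operations are local; on TM the
  cutoff functions v_T k suffice. Smoothness of the lifts comes for free, as v_T and d_T take values
  in the multivector fields on TM; therefore only the openness of the chart images of TM is needed,
  not that TM is a smooth manifold.
\<close>

section \<open>Functions of class Ck on open subsets of Euclidean space\<close>

text \<open>The lifts are known only through their values on globally defined functions and vector
  fields and through product rules, so an identity can be propagated only along sums of products of
  such fields. The identity for \<open>dT\<close> alone does not survive products: the lift of Y
  \<and> Z involves both lifts of Y and of Z, so \<open>[dT X, vT Z]\<close> appears; symmetry in X
  and Y then brings in \<open>[vT X, dT Y]\<close>, whose expansion over a product involves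
  \<open>[vT X, vT Y]\<close>. The system closes with these four. The grading is a second obstacle.
  Antisymmetry and the Leibniz rule are stated for homogeneous arguments, and while
  \<open>vT\<close> preserves degrees by assumption, for \<open>dT\<close> this has to be derived,
  on products first and by locality afterwards. The two kinds of lifted functions separate vector
  fields on TM because, for the coordinates x^i of a chart, they are exactly the induced coordinates
  of TM. Both sides of the identity are compared at one point at a time, so a bump function in a
  single chart is enough to make the local expansion of a field global.\<close>

lemma Euclidean_space_top_of_set:
  "Euclidean_space n = top_of_set (topspace (Euclidean_space n))"
  by (simp add: Euclidean_space_def euclidean_product_topology)

lemma continuous_map_Euclidean_space_on:
  assumes "U \<subseteq> topspace (Euclidean_space n)"
  shows "continuous_map (subtopology (Euclidean_space n) U) euclideanreal f \<longleftrightarrow> continuous_on U f"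
  using assms by (subst Euclidean_space_top_of_set) (simp add: subtopology_subtopology Int_absorb1)

lemma openin_Euclidean_space_subset:
  "openin (Euclidean_space n) U \<Longrightarrow> x \<in> U \<Longrightarrow> i \<ge> n \<Longrightarrow> x i = 0"
  using openin_subset[of "Euclidean_space n" U] by (auto simp: topspace_Euclidean_space)

abbreviation in_box :: "nat \<Rightarrow> real \<Rightarrow> (nat \<Rightarrow> real) \<Rightarrow> (nat \<Rightarrow> real) \<Rightarrow> bool" where
  "in_box n d x y \<equiv> (\<forall>i<n. \<bar>y i - x i\<bar> < d) \<and> (\<forall>i\<ge>n. y i = 0)"

text \<open>Stands for taking the minimum of finitely many radii; the second hypothesis says that
  smaller radii serve as well.\<close>

lemma common_delta:
  fixes P :: "nat \<Rightarrow> real \<Rightarrow> bool"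
  assumes "\<And>i. i < n \<Longrightarrow> \<exists>d>0. P i d" and "\<And>i d e. P i d \<Longrightarrow> 0 < e \<Longrightarrow> e \<le> d \<Longrightarrow> P i e"
  shows "\<exists>d>0. \<forall>i<n. P i d"
  using assms(1)
proof (induction n)
  case 0
  show ?case by (rule exI[of _ 1]) simp
next
  case (Suc n)
  then obtain d where d: "d > 0" "\<forall>i<n. P i d" by (meson less_Suc_eq)
  obtain e where e: "e > 0" "P n e" using Suc.prems by blast
  show ?case
    by (rule exI[of _ "min d e"])
      (use d e assms(2) in \<open>auto simp: less_Suc_eq min_def; metis\<close>)
qed

text \<open>A basic open set of the product topology may also constrain coordinates
  \<open>i \<ge> n\<close>; there \<open>x\<close> and \<open>y\<close> are both 0, so radii for the
  first \<open>n\<close> coordinates are enough.\<close>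

lemma openin_Euclidean_space_box:
  assumes "openin (Euclidean_space n) U" "x \<in> U"
  shows "\<exists>d>0. \<forall>y. in_box n d x y \<longrightarrow> y \<in> U"
proof -
  obtain T where T: "openin (powertop_real UNIV) T" "U = T \<inter> {x. \<forall>i\<ge>n. x i = 0}"
    using assms(1) unfolding Euclidean_space_def openin_subtopology by blast
  obtain X where X: "x \<in> Pi\<^sub>E UNIV X" "\<And>i. open (X i)" "Pi\<^sub>E UNIV X \<subseteq> T"
    using product_topology_open_contains_basis[OF T(1), of x] assms T by auto
  have "\<exists>d>0. \<forall>i<n. \<forall>t. \<bar>t - x i\<bar> < d \<longrightarrow> t \<in> X i"
  proof (rule common_delta)
    fix i assume "i < n"
    have "x i \<in> X i" using X(1) by auto
    then show "\<exists>d>0. \<forall>t. \<bar>t - x i\<bar> < d \<longrightarrow> t \<in> X i"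
      using X(2)[of i] unfolding open_dist dist_real_def by blast
  qed auto
  then obtain d where d: "d > 0" "\<And>i t. i < n \<Longrightarrow> \<bar>t - x i\<bar> < d \<Longrightarrow> t \<in> X i" by blast
  have x0: "x i = 0" if "i \<ge> n" for i using assms that T by auto
  have xX: "x i \<in> X i" for i using X(1) by auto
  have "y \<in> T" if y: "\<forall>i<n. \<bar>y i - x i\<bar> < d" "\<forall>i\<ge>n. y i = 0" for y
  proof -
    have "y i \<in> X i" for i
    proof (cases "i < n")
      case True
      then show ?thesis using y(1) d(2) by blast
    next
      case False
      then show ?thesis using y(2) x0[of i] xX[of i] by simp
    qed
    then have "y \<in> Pi\<^sub>E UNIV X" by auto
    then show ?thesis using X(3) by blast
  qed
  then show ?thesis using d(1) T(2) by blast
qed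

lemma openin_Euclidean_space_boxI:
  assumes "U \<subseteq> topspace (Euclidean_space n)"
    and "\<And>x. x \<in> U \<Longrightarrow> \<exists>d>0. \<forall>y. in_box n d x y \<longrightarrow> y \<in> U"
  shows "openin (Euclidean_space n) U"
proof (subst openin_subopen, intro ballI)
  fix x assume x: "x \<in> U"
  obtain d where d: "d > 0" "\<forall>y. in_box n d x y \<longrightarrow> y \<in> U"
    using assms(2)[OF x] by (elim exE conjE)
  let ?T = "(\<Inter>i<n. {y::nat\<Rightarrow>real. \<bar>y i - x i\<bar> < d}) \<inter> {x. \<forall>i\<ge>n. x i = 0}"
  have "open (\<Inter>i<n. {y::nat\<Rightarrow>real. \<bar>y i - x i\<bar> < d})"
    by (intro open_INT ballI open_Collect_less continuous_intros) auto
  then have "openin (Euclidean_space n) ?T"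
    unfolding Euclidean_space_def openin_subtopology euclidean_product_topology by auto
  moreover have "x \<in> ?T" using x d assms(1) by (auto simp: topspace_Euclidean_space)
  moreover have "?T \<subseteq> U" using d(2) by auto
  ultimately show "\<exists>T. openin (Euclidean_space n) T \<and> x \<in> T \<and> T \<subseteq> U" by blast
qed

lemma eventually_line:
  assumes "openin (Euclidean_space n) U" "x \<in> U" "i < n"
  shows "eventually (\<lambda>t. x(i := t) \<in> U) (nhds (x i))"
proof -
  obtain d where d: "d > 0" "\<forall>y. in_box n d x y \<longrightarrow> y \<in> U"
    using openin_Euclidean_space_box[OF assms(1,2)] by (elim exE conjE)
  have "x(i := t) \<in> U" if "dist t (x i) < d" for t
    by (rule d(2)[rule_format]) (use that d(1) assms openin_Euclidean_space_subset[OF assms(1,2)] in \<open>auto simp: dist_real_def\<close>)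
  then show ?thesis unfolding eventually_nhds_metric using d(1) by blast
qed

section \<open>Partial derivatives and closure properties of the classes Ck\<close>

lemma pderiv_coord_cong:
  assumes "openin (Euclidean_space n) U" "x \<in> U" "i < n" "\<And>y. y \<in> U \<Longrightarrow> f y = g y"
  shows "pderiv_coord i f x = pderiv_coord i g x"
  unfolding pderiv_coord_def
  by (rule deriv_cong_ev) (use eventually_line[OF assms(1-3)] assms(4) in \<open>auto elim: eventually_mono\<close>)

lemma pderiv_coord_eqI:
  "((\<lambda>t. f (x(i := t))) has_real_derivative D) (at (x i)) \<Longrightarrow> pderiv_coord i f x = D"
  unfolding pderiv_coord_def by (rule DERIV_imp_deriv)

lemma Ck_on_0: "openin (Euclidean_space n) U \<Longrightarrow> Ck_on 0 n U f \<longleftrightarrow> continuous_on U f"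
  using continuous_map_Euclidean_space_on openin_subset by (metis Ck_on.simps(1))

lemma Ck_on_Suc:
  assumes "openin (Euclidean_space n) U"
  shows "Ck_on (Suc k) n U f \<longleftrightarrow> continuous_on U f \<and>
     (\<forall>i<n. (\<forall>x\<in>U. ((\<lambda>t. f (x(i := t))) has_real_derivative pderiv_coord i f x) (at (x i))) \<and>
             Ck_on k n U (pderiv_coord i f))"
  using continuous_map_Euclidean_space_on[OF openin_subset[OF assms]]
  by (simp add: pderiv_coord_def DERIV_deriv_iff_field_differentiable)

lemma Ck_on_SucD:
  assumes "openin (Euclidean_space n) U" "Ck_on (Suc k) n U f"
  shows "continuous_on U f"
    and "\<And>i x. i < n \<Longrightarrow> x \<in> U \<Longrightarrow> ((\<lambda>t. f (x(i := t))) has_real_derivative pderiv_coord i f x) (at (x i))"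
    and "\<And>i. i < n \<Longrightarrow> Ck_on k n U (pderiv_coord i f)"
  using assms(2) unfolding Ck_on_Suc[OF assms(1)] by blast+

lemma Ck_on_continuous_on: "openin (Euclidean_space n) U \<Longrightarrow> Ck_on k n U f \<Longrightarrow> continuous_on U f"
  by (cases k) (auto simp: Ck_on_0 Ck_on_Suc simp del: Ck_on.simps)

text \<open>Functions are total while regularity concerns \<open>U\<close> only. As \<open>U\<close>
  is open, a partial derivative at a point of \<open>U\<close> sees only values in \<open>U\<close>,
  and this carries the agreement through the induction.\<close>

lemma Ck_on_cong:
  assumes "openin (Euclidean_space n) U"
  shows "(\<And>y. y \<in> U \<Longrightarrow> f y = g y) \<Longrightarrow> Ck_on k n U f \<Longrightarrow> Ck_on k n U g"
proof (induction k arbitrary: f g)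
  case 0
  then show ?case using assms by (metis Ck_on_0 continuous_on_cong)
next
  case (Suc k)
  have "((\<lambda>t. g (x(i := t))) has_real_derivative pderiv_coord i g x) (at (x i))" if "i < n" "x \<in> U" for x i
  proof -
    have "((\<lambda>t. f (x(i := t))) has_real_derivative pderiv_coord i g x) (at (x i))"
      using Ck_on_SucD(2)[OF assms Suc.prems(2) that] pderiv_coord_cong[OF assms that(2,1), of f g] Suc.prems(1)
      by metis
    moreover have ev: "eventually (\<lambda>t. f (x(i := t)) = g (x(i := t))) (nhds (x i))"
      using eventually_line[OF assms that(2,1)] by (rule eventually_mono) (rule Suc.prems(1))
    ultimately show ?thesis
      using DERIV_cong_ev[OF refl ev refl] by blast
  qed
  moreover have "Ck_on k n U (pderiv_coord i g)" if "i < n" for i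
    by (rule Suc.IH[of "pderiv_coord i f"])
       (use Ck_on_SucD(3)[OF assms Suc.prems(2) that] pderiv_coord_cong[OF assms _ that, of _ f g] Suc.prems(1) in auto)
  moreover have "continuous_on U g"
    using Ck_on_SucD(1)[OF assms Suc.prems(2)] Suc.prems(1) by (simp cong: continuous_on_cong)
  ultimately show ?case using assms by (simp add: Ck_on_Suc del: Ck_on.simps)
qed

text \<open>Lets the partial derivatives be given by a formula valid on \<open>U\<close>, so that
  the closure proofs below work with the ordinary rules of differentiation.\<close>

lemma Ck_on_SucI:
  assumes "openin (Euclidean_space n) U" "continuous_on U f"
    and D: "\<And>i x. i < n \<Longrightarrow> x \<in> U \<Longrightarrow> ((\<lambda>t. f (x(i := t))) has_real_derivative g i x) (at (x i))"
    and "\<And>i. i < n \<Longrightarrow> Ck_on k n U (g i)"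
  shows "Ck_on (Suc k) n U f"
proof -
  have "pderiv_coord i f x = g i x" if "i < n" "x \<in> U" for i x
    using D[OF that] by (rule pderiv_coord_eqI)
  then show ?thesis
    using assms Ck_on_cong[OF assms(1), of "g _" "pderiv_coord _ f" k]
    by (auto simp: Ck_on_Suc simp del: Ck_on.simps)
qed

lemma Ck_on_mono: "openin (Euclidean_space n) U \<Longrightarrow> Ck_on (Suc k) n U f \<Longrightarrow> Ck_on k n U f"
proof (induction k arbitrary: f)
  case (Suc k)
  then show ?case by (simp add: Ck_on_Suc del: Ck_on.simps)
qed (simp add: Ck_on_0 Ck_on_Suc del: Ck_on.simps)

lemma Ck_on_subset:
  assumes "openin (Euclidean_space n) U" "openin (Euclidean_space n) V" "V \<subseteq> U"
  shows "Ck_on k n U f \<Longrightarrow> Ck_on k n V f"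
proof (induction k arbitrary: f)
  case 0
  then show ?case using assms by (metis Ck_on_0 continuous_on_subset)
next
  case (Suc k)
  then show ?case using assms by (auto simp add: Ck_on_Suc simp del: Ck_on.simps intro: continuous_on_subset)
qed

lemma continuous_on_Euclidean_local:
  assumes "openin (Euclidean_space n) U"
    and "\<And>x. x \<in> U \<Longrightarrow> \<exists>V. openin (Euclidean_space n) V \<and> x \<in> V \<and> V \<subseteq> U \<and> continuous_on V f"
  shows "continuous_on U f"
  unfolding continuous_on_eq_continuous_within
proof
  fix x assume x: "x \<in> U"
  obtain V where V: "openin (Euclidean_space n) V" "x \<in> V" "V \<subseteq> U" "continuous_on V f"
    using assms(2)[OF x] by blast
  obtain T where T: "open T" "V = topspace (Euclidean_space n) \<inter> T"
    using V(1) by (subst (asm) Euclidean_space_top_of_set) (auto simp: openin_open)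
  have "at x within V = at x within U"
    using at_within_nhd[of x T V U] T V openin_subset[OF assms(1)] by auto
  then show "continuous (at x within U) f"
    using V(2,4) by (metis continuous_on_eq_continuous_within)
qed

text \<open>Used to glue a function from pieces on an open cover, as in extension by zero.\<close>

lemma Ck_on_local:
  assumes "openin (Euclidean_space n) U"
  shows "(\<And>x. x \<in> U \<Longrightarrow> \<exists>V. openin (Euclidean_space n) V \<and> x \<in> V \<and> V \<subseteq> U \<and> Ck_on k n V f) \<Longrightarrow> Ck_on k n U f"
proof (induction k arbitrary: f)
  case 0
  then have "\<exists>V. openin (Euclidean_space n) V \<and> x \<in> V \<and> V \<subseteq> U \<and> continuous_on V f" if "x \<in> U" for x
    using that Ck_on_0 by meson
  then have "continuous_on U f"
    by (rule continuous_on_Euclidean_local[OF assms])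
  then show ?case using assms by (simp add: Ck_on_0 del: Ck_on.simps)
next
  case (Suc k)
  have V: "\<exists>V. openin (Euclidean_space n) V \<and> x \<in> V \<and> V \<subseteq> U \<and> continuous_on V f \<and>
     (\<forall>i<n. Ck_on k n V (pderiv_coord i f) \<and>
      ((\<lambda>t. f (x(i := t))) has_real_derivative pderiv_coord i f x) (at (x i)))" if x: "x \<in> U" for x
  proof -
    obtain V where V: "openin (Euclidean_space n) V" "x \<in> V" "V \<subseteq> U" "Ck_on (Suc k) n V f"
      using Suc.prems[OF x] by blast
    show ?thesis using V Ck_on_SucD[OF V(1,4)] by blast
  qed
  have "Ck_on k n U (pderiv_coord i f)" if "i < n" for i
    by (rule Suc.IH) (use V that in blast)
  moreover have "((\<lambda>t. f (x(i := t))) has_real_derivative pderiv_coord i f x) (at (x i))" if "i < n" "x \<in> U" for i x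
    using V that by blast
  moreover have "continuous_on U f"
    by (intro continuous_on_Euclidean_local[OF assms]) (use V in blast)
  ultimately show ?case using assms by (simp add: Ck_on_Suc del: Ck_on.simps)
qed

declare Ck_on.simps [simp del]

lemma Ck_on_const: "openin (Euclidean_space n) U \<Longrightarrow> Ck_on k n U (\<lambda>x. a)"
proof (induction k arbitrary: a)
  case (Suc k)
  show ?case by (rule Ck_on_SucI[where g = "\<lambda>i x. 0"]) (use Suc in auto)
qed (simp add: Ck_on_0)

lemma Ck_on_coord: "openin (Euclidean_space n) U \<Longrightarrow> Ck_on k n U (\<lambda>x. x j)"
proof (cases k)
  case (Suc k')
  assume U: "openin (Euclidean_space n) U"
  have "Ck_on (Suc k') n U (\<lambda>x. x j)"
  proof (rule Ck_on_SucI[OF U, where g = "\<lambda>i x. if i = j then 1 else 0"])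
    show "continuous_on U (\<lambda>x. x j)"
      by (rule continuous_on_subset[OF continuous_on_product_coordinates]) simp
    show "((\<lambda>t. (x(i := t)) j) has_real_derivative (if i = j then 1 else 0)) (at (x i))" for i and x :: "nat \<Rightarrow> real"
      by (cases "i = j") (auto intro!: derivative_eq_intros)
    show "Ck_on k' n U (\<lambda>x. if i = j then 1 else 0)" for i
      by (rule Ck_on_const[OF U])
  qed
  then show ?thesis using Suc by simp
qed (auto simp add: Ck_on_0 intro: continuous_on_subset[OF continuous_on_product_coordinates])

lemma Ck_on_add:
  assumes "openin (Euclidean_space n) U"
  shows "Ck_on k n U f \<Longrightarrow> Ck_on k n U g \<Longrightarrow> Ck_on k n U (\<lambda>x. f x + g x)"
proof (induction k arbitrary: f g)
  case 0
  then show ?case using assms by (simp add: Ck_on_0 continuous_on_add)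
next
  case (Suc k)
  note f = Ck_on_SucD[OF assms Suc.prems(1)] and g = Ck_on_SucD[OF assms Suc.prems(2)]
  show ?case
    by (rule Ck_on_SucI[OF assms, where g = "\<lambda>i x. pderiv_coord i f x + pderiv_coord i g x"])
      (use f g Suc.IH in \<open>auto intro!: continuous_on_add DERIV_add\<close>)
qed

lemma Ck_on_mult:
  assumes "openin (Euclidean_space n) U"
  shows "Ck_on k n U f \<Longrightarrow> Ck_on k n U g \<Longrightarrow> Ck_on k n U (\<lambda>x. f x * g x)"
proof (induction k arbitrary: f g)
  case 0
  then show ?case using assms by (simp add: Ck_on_0 continuous_on_mult)
next
  case (Suc k)
  note f = Ck_on_SucD[OF assms Suc.prems(1)] and g = Ck_on_SucD[OF assms Suc.prems(2)]
  have D: "((\<lambda>t. f (x(i := t)) * g (x(i := t))) has_real_derivative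
      (pderiv_coord i f x * g x + pderiv_coord i g x * f x)) (at (x i))" if "i < n" "x \<in> U" for i x
    using DERIV_mult[OF f(2)[OF that] g(2)[OF that]] by (simp only: fun_upd_triv)
  show ?case
  proof (rule Ck_on_SucI[OF assms _ D])
    show "continuous_on U (\<lambda>x. f x * g x)" using f(1) g(1) by (rule continuous_on_mult)
    show "Ck_on k n U (\<lambda>x. pderiv_coord i f x * g x + pderiv_coord i g x * f x)" if "i < n" for i
      using f(3)[OF that] g(3)[OF that] Suc.prems Ck_on_mono[OF assms]
      by (intro Ck_on_add[OF assms] Suc.IH) auto
  qed
qed

lemma Ck_on_sum:
  assumes "openin (Euclidean_space n) U"
  shows "(\<And>j. j \<in> J \<Longrightarrow> Ck_on k n U (f j)) \<Longrightarrow> Ck_on k n U (\<lambda>x. \<Sum>j\<in>J. f j x)"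
  by (induction J rule: infinite_finite_induct) (auto intro!: Ck_on_add[OF assms] Ck_on_const[OF assms])

section \<open>Total differential, chain rule and composites\<close>

lemma openin_Euclidean_space_near:
  fixes g :: "(nat \<Rightarrow> real) \<Rightarrow> real"
  assumes U: "openin (Euclidean_space n) U" and g: "continuous_on U g" and "x \<in> U" "0 < e"
  shows "\<exists>d>0. \<forall>y. in_box n d x y \<longrightarrow> y \<in> U \<and> \<bar>g y - g x\<bar> < e"
proof -
  have "openin (top_of_set U) (U \<inter> g -` ball (g x) e)"
    using g by (simp add: continuous_openin_preimage_gen)
  then have "openin (Euclidean_space n) (U \<inter> g -` ball (g x) e)"
    using U by (metis Euclidean_space_top_of_set openin_trans)
  moreover have "x \<in> U \<inter> g -` ball (g x) e" using assms by auto
  ultimately show ?thesis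
    using openin_Euclidean_space_box[of n "U \<inter> g -` ball (g x) e" x]
    by (auto simp: dist_real_def abs_minus_commute)
qed

text \<open>The way from \<open>x\<close> to \<open>y\<close> changes one coordinate at a time, and
  the mean value inequality is applied on each segment. Continuity of the partial derivatives at
  \<open>x\<close> bounds each error by \<open>e\<close> times the length of the segment.\<close>

lemma C1_total_differential:
  fixes f :: "(nat \<Rightarrow> real) \<Rightarrow> real"
  assumes U: "openin (Euclidean_space n) U"
    and D: "\<And>i x. i < n \<Longrightarrow> x \<in> U \<Longrightarrow> ((\<lambda>t. f (x(i := t))) has_real_derivative f' i x) (at (x i))"
    and cont: "\<And>i. i < n \<Longrightarrow> continuous_on U (f' i)"
    and x: "x \<in> U" and e: "0 < e"
  shows "\<exists>d>0. \<forall>y. in_box n d x y \<longrightarrow>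
     \<bar>f y - f x - (\<Sum>j<n. f' j x * (y j - x j))\<bar> \<le> e * (\<Sum>j<n. \<bar>y j - x j\<bar>)"
proof -
  let ?near = "\<lambda>j d. \<forall>y. in_box n d x y \<longrightarrow> y \<in> U \<and> \<bar>f' j y - f' j x\<bar> < e"
  have "\<exists>d>0. \<forall>j<n. ?near j d"
  proof (rule common_delta)
    show "\<exists>d>0. ?near i d" if "i < n" for i
      by (rule openin_Euclidean_space_near[OF U cont[OF that] x e])
    show "?near i b" if d: "?near i d" and "b \<le> d" for i d b
    proof (intro allI impI, elim conjE)
      fix y assume y: "\<forall>i<n. \<bar>y i - x i\<bar> < b" "\<forall>i\<ge>n. y i = 0"
      show "y \<in> U \<and> \<bar>f' i y - f' i x\<bar> < e"
        by (rule d[rule_format]) (use y \<open>b \<le> d\<close> in fastforce)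
    qed
  qed
  then obtain d where d: "d > 0"
    "\<forall>j<n. \<forall>y. in_box n d x y \<longrightarrow> y \<in> U \<and> \<bar>f' j y - f' j x\<bar> < e"
    by (elim exE conjE)
  have "\<bar>f y - f x - (\<Sum>j<n. f' j x * (y j - x j))\<bar> \<le> e * (\<Sum>j<n. \<bar>y j - x j\<bar>)"
    if y: "\<forall>i<n. \<bar>y i - x i\<bar> < d" "\<forall>i\<ge>n. y i = 0" for y
  proof -
    \<comment> \<open>Intermediate points: the first \<open>k\<close> coordinates are already those
      of \<open>y\<close>, the others still those of \<open>x\<close>. They stay in the box around
      \<open>x\<close>, hence in \<open>U\<close>.\<close>
    define z where "z k = (\<lambda>j. if j < k then y j else x j)" for k
    have x0: "x i = 0" if "i \<ge> n" for i using openin_Euclidean_space_subset[OF U x that] .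
    have z0: "z 0 = x" and zn: "z n = y" using x0 y(2) by (auto simp: z_def fun_eq_iff)
    have step: "\<bar>f (z (Suc k)) - f (z k) - f' k x * (y k - x k)\<bar> \<le> e * \<bar>y k - x k\<bar>" if k: "k < n" for k
    proof -
      have seg: "\<bar>t - x k\<bar> < d" if "t \<in> closed_segment (x k) (y k)" for t
      proof -
        have "\<bar>t - x k\<bar> \<le> \<bar>y k - x k\<bar>"
          using that by (auto simp: closed_segment_eq_real_ivl split: if_splits)
        then show ?thesis using y(1) k by fastforce
      qed
      have zt: "(z k)(k := t) \<in> U \<and> \<bar>f' k ((z k)(k := t)) - f' k x\<bar> < e" if "t \<in> closed_segment (x k) (y k)" for t
        by (rule d(2)[rule_format, OF k]) (use seg[OF that] y d(1) x0 k in \<open>auto simp: z_def\<close>)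
      \<comment> \<open>Subtracting the linear function of slope \<open>f' k x\<close> leaves a
        derivative of absolute value below \<open>e\<close>, which is what the mean value inequality
        needs.\<close>
      have der: "((\<lambda>t. f ((z k)(k := t)) - f' k x * t) has_field_derivative (f' k ((z k)(k := t)) - f' k x))
          (at t within closed_segment (x k) (y k))" if t: "t \<in> closed_segment (x k) (y k)" for t
        using DERIV_subset[OF D[OF k conjunct1[OF zt[OF t]]], simplified, of "closed_segment (x k) (y k)"]
        by (auto intro!: derivative_eq_intros)
      have "norm ((f ((z k)(k := y k)) - f' k x * y k) - (f ((z k)(k := x k)) - f' k x * x k)) \<le> e * norm (y k - x k)"
        by (rule field_differentiable_bound[OF convex_closed_segment der])
          (use zt in \<open>auto intro: less_imp_le\<close>)
      moreover have "(z k)(k := y k) = z (Suc k)" "(z k)(k := x k) = z k" by (auto simp: z_def fun_eq_iff)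
      ultimately show ?thesis by (simp add: algebra_simps)
    qed
    have "f y - f x = (\<Sum>k<n. f (z (Suc k)) - f (z k))"
      using sum_lessThan_telescope[of "\<lambda>k. f (z k)" n] by (simp add: z0 zn)
    then have "\<bar>f y - f x - (\<Sum>j<n. f' j x * (y j - x j))\<bar>
        = \<bar>\<Sum>k<n. f (z (Suc k)) - f (z k) - f' k x * (y k - x k)\<bar>"
      by (simp add: sum_subtractf)
    also have "\<dots> \<le> (\<Sum>k<n. e * \<bar>y k - x k\<bar>)"
      by (rule order_trans[OF sum_abs]) (use step in \<open>auto intro!: sum_mono\<close>)
    finally show ?thesis by (simp add: sum_distrib_left)
  qed
  then show ?thesis using d(1) by blast
qed

text \<open>After division by \<open>t - t0\<close> the error of the total differential is at most a
  small constant times the sum of the absolute difference quotients of \<open>c\<close>, and that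
  sum stays bounded.\<close>

lemma C1_chain_rule:
  fixes f :: "(nat \<Rightarrow> real) \<Rightarrow> real" and c :: "real \<Rightarrow> nat \<Rightarrow> real"
  assumes U: "openin (Euclidean_space n) U"
    and D: "\<And>i x. i < n \<Longrightarrow> x \<in> U \<Longrightarrow> ((\<lambda>t. f (x(i := t))) has_real_derivative f' i x) (at (x i))"
    and cont: "\<And>i. i < n \<Longrightarrow> continuous_on U (f' i)"
    and cU: "c t0 \<in> U" and c0: "eventually (\<lambda>t. \<forall>i\<ge>n. c t i = 0) (at t0)"
    and c': "\<And>j. j < n \<Longrightarrow> ((\<lambda>t. c t j) has_real_derivative c' j) (at t0)"
  shows "((\<lambda>t. f (c t)) has_real_derivative (\<Sum>j<n. f' j (c t0) * c' j)) (at t0)"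
proof -
  define q where "q t j = (c t j - c t0 j) / (t - t0)" for t j
  have q: "((\<lambda>t. q t j) \<longlongrightarrow> c' j) (at t0)" if "j < n" for j
    using c'[OF that] unfolding q_def has_field_derivative_iff .
  define R where "R t = (f (c t) - f (c t0)) / (t - t0) - (\<Sum>j<n. f' j (c t0) * q t j)" for t
  have "(R \<longlongrightarrow> 0) (at t0)"
  proof (rule tendstoI)
    fix e :: real assume e: "e > 0"
    \<comment> \<open>\<open>L\<close> exceeds the limit of the sum of the absolute difference
      quotients; the summand 1 makes this strict and \<open>L\<close> positive, so the tolerance
      \<open>e / L\<close> leads to an error below \<open>e\<close>.\<close>
    define L where "L = (\<Sum>j<n. \<bar>c' j\<bar>) + 1"
    have L: "L > 0" unfolding L_def by (simp add: add_nonneg_pos sum_nonneg)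
    obtain d where d: "d > 0" "\<forall>y. in_box n d (c t0) y \<longrightarrow>
     \<bar>f y - f (c t0) - (\<Sum>j<n. f' j (c t0) * (y j - c t0 j))\<bar> \<le> e / L * (\<Sum>j<n. \<bar>y j - c t0 j\<bar>)"
      using C1_total_differential[OF U D cont cU, of "e / L"] e L by (auto elim!: exE conjE)
    have "((\<lambda>t. \<Sum>j<n. \<bar>q t j\<bar>) \<longlongrightarrow> (\<Sum>j<n. \<bar>c' j\<bar>)) (at t0)"
      by (intro tendsto_intros q) auto
    then have "eventually (\<lambda>t. (\<Sum>j<n. \<bar>q t j\<bar>) < L) (at t0)"
      by (rule order_tendstoD) (simp add: L_def)
    moreover have "eventually (\<lambda>t. \<forall>j<n. \<bar>c t j - c t0 j\<bar> < d) (at t0)"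
    proof -
      have "eventually (\<lambda>t. \<forall>j\<in>{..<n}. \<bar>c t j - c t0 j\<bar> < d) (at t0)"
      proof (rule eventually_ball_finite)
        show "\<forall>j\<in>{..<n}. eventually (\<lambda>t. \<bar>c t j - c t0 j\<bar> < d) (at t0)"
        proof
          fix j assume "j \<in> {..<n}"
          then have "((\<lambda>t. c t j) \<longlongrightarrow> c t0 j) (at t0)"
            using c' DERIV_isCont isCont_def by blast
          then show "eventually (\<lambda>t. \<bar>c t j - c t0 j\<bar> < d) (at t0)"
            using d(1) tendstoD[of "\<lambda>t. c t j" "c t0 j" "at t0" d] by (simp add: dist_real_def)
        qed
      qed simp
      then show ?thesis by (rule eventually_mono) auto
    qed
    moreover have "eventually (\<lambda>t. t \<noteq> t0) (at t0)" by (simp add: eventually_at_filter)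
    ultimately show "eventually (\<lambda>t. dist (R t) 0 < e) (at t0)"
      using c0
    proof eventually_elim
      case (elim t)
      have "R t = (f (c t) - f (c t0) - (\<Sum>j<n. f' j (c t0) * (c t j - c t0 j))) / (t - t0)"
        by (simp add: R_def q_def diff_divide_distrib[of _ "sum _ _"] sum_divide_distrib)
      then have "\<bar>R t\<bar> = \<bar>f (c t) - f (c t0) - (\<Sum>j<n. f' j (c t0) * (c t j - c t0 j))\<bar> / \<bar>t - t0\<bar>"
        by simp
      also have "\<dots> \<le> (e / L * (\<Sum>j<n. \<bar>c t j - c t0 j\<bar>)) / \<bar>t - t0\<bar>"
        by (rule divide_right_mono) (use d(2)[rule_format, of "c t"] elim in auto)
      also have "\<dots> = e / L * (\<Sum>j<n. \<bar>q t j\<bar>)"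
      proof -
        have "(\<Sum>j<n. \<bar>q t j\<bar>) = (\<Sum>j<n. \<bar>c t j - c t0 j\<bar>) / \<bar>t - t0\<bar>"
          by (simp add: q_def sum_divide_distrib)
        then show ?thesis by simp
      qed
      also have "\<dots> < e / L * L"
        by (rule mult_strict_left_mono) (use elim e L in auto)
      finally show ?case using L by simp
    qed
  qed
  moreover have "((\<lambda>t. \<Sum>j<n. f' j (c t0) * q t j) \<longlongrightarrow> (\<Sum>j<n. f' j (c t0) * c' j)) (at t0)"
    by (intro tendsto_intros q) auto
  ultimately have "((\<lambda>t. R t + (\<Sum>j<n. f' j (c t0) * q t j)) \<longlongrightarrow> 0 + (\<Sum>j<n. f' j (c t0) * c' j)) (at t0)"
    by (rule tendsto_add)
  then show ?thesis by (simp add: R_def has_field_derivative_iff)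
qed

text \<open>The chain rule along a coordinate line through \<open>x\<close>. It is stated for a
  finite class and not for smooth maps because the induction for composites has only finite
  differentiability at hand.\<close>

lemma DERIV_coord_compose:
  assumes U: "openin (Euclidean_space n) U" and V: "openin (Euclidean_space m) V"
    and gV: "\<And>x. x \<in> U \<Longrightarrow> g x \<in> V"
    and g: "\<And>j. j < m \<Longrightarrow> Ck_on (Suc k) n U (\<lambda>x. g x j)" and f: "Ck_on (Suc k) m V f"
    and x: "x \<in> U" "i < n"
  shows "((\<lambda>t. f (g (x(i := t)))) has_real_derivative
    (\<Sum>j<m. pderiv_coord j f (g x) * pderiv_coord i (\<lambda>x. g x j) x)) (at (x i))"
proof -
  note f' = Ck_on_SucD[OF V f] and g' = Ck_on_SucD[OF U g]
  have "((\<lambda>t. f (g (x(i := t)))) has_real_derivative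
      (\<Sum>j<m. pderiv_coord j f (g (x(i := x i))) * pderiv_coord i (\<lambda>x. g x j) x)) (at (x i))"
  proof (rule C1_chain_rule[OF V f'(2)])
    show "continuous_on V (pderiv_coord j f)" if "j < m" for j
      using f'(3)[OF that] Ck_on_continuous_on[OF V] by blast
    show "g (x(i := x i)) \<in> V" using gV x by simp
    have "eventually (\<lambda>t. x(i := t) \<in> U) (at (x i))"
      using eventually_line[OF U x] by (rule eventually_nhds_conv_at[THEN iffD1, THEN conjunct1])
    then show "eventually (\<lambda>t. \<forall>j\<ge>m. g (x(i := t)) j = 0) (at (x i))"
      by (rule eventually_mono) (use gV openin_Euclidean_space_subset[OF V] in auto)
    show "((\<lambda>t. g (x(i := t)) j) has_real_derivative pderiv_coord i (\<lambda>x. g x j) x) (at (x i))" if "j < m" for j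
      using g'(2)[OF that] x by blast
  qed
  then show ?thesis by simp
qed

text \<open>By the chain rule the partial derivatives of the composite are sums of products of
  \<open>pderiv_coord j f\<close> composed with \<open>g\<close>, covered by the induction
  hypothesis, and partial derivatives of \<open>g\<close>.\<close>

lemma Ck_on_compose:
  assumes U: "openin (Euclidean_space n) U" and V: "openin (Euclidean_space m) V"
    and gV: "\<And>x. x \<in> U \<Longrightarrow> g x \<in> V"
  shows "(\<And>j. j < m \<Longrightarrow> Ck_on k n U (\<lambda>x. g x j)) \<Longrightarrow> Ck_on k m V f \<Longrightarrow> Ck_on k n U (\<lambda>x. f (g x))"
proof (induction k arbitrary: f)
  have cont: "continuous_on U (\<lambda>x. f (g x))"
    if "Ck_on k m V f" "\<And>j. j < m \<Longrightarrow> Ck_on k n U (\<lambda>x. g x j)" for k f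
  proof -
    \<comment> \<open>Continuity into the space of functions concerns all coordinates, also those
      with \<open>j \<ge> m\<close>, where \<open>g\<close> vanishes because \<open>V\<close> lies
      in the model space.\<close>
    have "continuous_on U (\<lambda>x. g x j)" for j
    proof (cases "j < m")
      case True
      then show ?thesis using that(2) Ck_on_continuous_on[OF U] by blast
    next
      case False
      then have "continuous_on U (\<lambda>x. g x j) = continuous_on U (\<lambda>x. 0::real)"
        by (intro continuous_on_cong) (use gV openin_Euclidean_space_subset[OF V] in auto)
      then show ?thesis by simp
    qed
    then have "continuous_on U g" by (rule continuous_on_coordinatewise_then_product)
    moreover have "continuous_on V f" using that Ck_on_continuous_on[OF V] by blast
    ultimately show ?thesis using gV continuous_on_compose2[of V f U g] by blast
  qed
  {
    case 0
    then show ?case using cont[of 0 f] by (simp add: Ck_on_0[OF U])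
  next
    case (Suc k)
    note f = Ck_on_SucD[OF V Suc.prems(2)] and g = Ck_on_SucD[OF U Suc.prems(1)]
    note D = DERIV_coord_compose[where f = f and g = g, OF U V gV Suc.prems(1) Suc.prems(2)]
    show ?case
    proof (rule Ck_on_SucI[OF U cont[OF Suc.prems(2,1)] D[rotated]])
      show "Ck_on k n U (\<lambda>x. \<Sum>j<m. pderiv_coord j f (g x) * pderiv_coord i (\<lambda>x. g x j) x)" if "i < n" for i
      proof (intro Ck_on_sum[OF U] Ck_on_mult[OF U])
        fix j assume "j \<in> {..<m}"
        then show "Ck_on k n U (pderiv_coord i (\<lambda>x. g x j))"
          using g(3) that by blast
        have "Ck_on k m V (pderiv_coord j f)" using f(3) \<open>j \<in> {..<m}\<close> by blast
        with Ck_on_mono[OF U Suc.prems(1)] show "Ck_on k n U (\<lambda>x. pderiv_coord j f (g x))"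
          by (rule Suc.IH)
      qed
    qed
  }
qed

lemma pderiv_coord_compose:
  assumes "openin (Euclidean_space n) U" "openin (Euclidean_space m) V" "\<And>x. x \<in> U \<Longrightarrow> g x \<in> V"
    and "\<And>j. j < m \<Longrightarrow> smooth_on n U (\<lambda>x. g x j)" "smooth_on m V f" and "x \<in> U" "i < n"
  shows "pderiv_coord i (\<lambda>x. f (g x)) x = (\<Sum>j<m. pderiv_coord j f (g x) * pderiv_coord i (\<lambda>x. g x j) x)"
proof (rule pderiv_coord_eqI)
  have g: "Ck_on (Suc 0) n U (\<lambda>x. g x j)" if "j < m" for j
    using assms(4)[OF that] by (simp add: smooth_on_def)
  have f: "Ck_on (Suc 0) m V f" using assms(5) by (simp add: smooth_on_def)
  show "((\<lambda>t. f (g (x(i := t)))) has_real_derivative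
      (\<Sum>j<m. pderiv_coord j f (g x) * pderiv_coord i (\<lambda>x. g x j) x)) (at (x i))"
    using DERIV_coord_compose[where f = f and g = g, OF assms(1-3) g f assms(6,7)] .
qed

lemma smooth_onD:
  assumes "openin (Euclidean_space n) U" "smooth_on n U f"
  shows "continuous_on U f"
    and "\<And>i x. i < n \<Longrightarrow> x \<in> U \<Longrightarrow> ((\<lambda>t. f (x(i := t))) has_real_derivative pderiv_coord i f x) (at (x i))"
    and "\<And>i. i < n \<Longrightarrow> smooth_on n U (pderiv_coord i f)"
proof -
  have "Ck_on (Suc k) n U f" for k using assms by (simp add: smooth_on_def)
  note * = Ck_on_SucD[OF assms(1) this]
  show "continuous_on U f"
    and "\<And>i x. i < n \<Longrightarrow> x \<in> U \<Longrightarrow> ((\<lambda>t. f (x(i := t))) has_real_derivative pderiv_coord i f x) (at (x i))"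
    and "\<And>i. i < n \<Longrightarrow> smooth_on n U (pderiv_coord i f)"
    using * unfolding smooth_on_def by blast+
qed

lemma smooth_on_cong:
  "openin (Euclidean_space n) U \<Longrightarrow> (\<And>y. y \<in> U \<Longrightarrow> f y = g y) \<Longrightarrow> smooth_on n U f \<Longrightarrow> smooth_on n U g"
  unfolding smooth_on_def using Ck_on_cong by blast

lemma smooth_on_subset:
  "openin (Euclidean_space n) U \<Longrightarrow> openin (Euclidean_space n) V \<Longrightarrow> V \<subseteq> U \<Longrightarrow> smooth_on n U f \<Longrightarrow> smooth_on n V f"
  unfolding smooth_on_def using Ck_on_subset by blast

lemma smooth_on_local:
  assumes "openin (Euclidean_space n) U"
    and "\<And>x. x \<in> U \<Longrightarrow> \<exists>V. openin (Euclidean_space n) V \<and> x \<in> V \<and> V \<subseteq> U \<and> smooth_on n V f"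
  shows "smooth_on n U f"
  unfolding smooth_on_def
proof
  fix k
  have "\<exists>V. openin (Euclidean_space n) V \<and> x \<in> V \<and> V \<subseteq> U \<and> Ck_on k n V f" if "x \<in> U" for x
    using assms(2)[OF that] by (auto simp: smooth_on_def)
  then show "Ck_on k n U f" by (rule Ck_on_local[OF assms(1)])
qed

lemma smooth_on_const: "openin (Euclidean_space n) U \<Longrightarrow> smooth_on n U (\<lambda>x. a)"
  by (simp add: smooth_on_def Ck_on_const)

lemma smooth_on_coord: "openin (Euclidean_space n) U \<Longrightarrow> smooth_on n U (\<lambda>x. x j)"
  by (simp add: smooth_on_def Ck_on_coord)

lemma smooth_on_add:
  "openin (Euclidean_space n) U \<Longrightarrow> smooth_on n U f \<Longrightarrow> smooth_on n U g \<Longrightarrow> smooth_on n U (\<lambda>x. f x + g x)"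
  by (simp add: smooth_on_def Ck_on_add)

lemma smooth_on_mult:
  "openin (Euclidean_space n) U \<Longrightarrow> smooth_on n U f \<Longrightarrow> smooth_on n U g \<Longrightarrow> smooth_on n U (\<lambda>x. f x * g x)"
  by (simp add: smooth_on_def Ck_on_mult)

lemma smooth_on_sum:
  "openin (Euclidean_space n) U \<Longrightarrow> (\<And>j. j \<in> J \<Longrightarrow> smooth_on n U (f j)) \<Longrightarrow> smooth_on n U (\<lambda>x. \<Sum>j\<in>J. f j x)"
  by (simp add: smooth_on_def Ck_on_sum)

lemma smooth_on_compose:
  assumes "openin (Euclidean_space n) U" "openin (Euclidean_space m) V" "\<And>x. x \<in> U \<Longrightarrow> g x \<in> V"
    "\<And>j. j < m \<Longrightarrow> smooth_on n U (\<lambda>x. g x j)" "smooth_on m V f"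
  shows "smooth_on n U (\<lambda>x. f (g x))"
  using Ck_on_compose[of n U m V g _ f] assms unfolding smooth_on_def by blast

section \<open>Symmetry of second partial derivatives\<close>

lemma MVT_at:
  fixes f :: "real \<Rightarrow> real"
  assumes "h > 0" "\<And>t. a \<le> t \<Longrightarrow> t \<le> a + h \<Longrightarrow> (f has_real_derivative f' t) (at t)"
  shows "\<exists>t. a < t \<and> t < a + h \<and> f (a + h) - f a = h * f' t"
  using MVT2[of a "a + h" f f'] assms by auto

text \<open>The mean value theorem is used twice: in direction \<open>i\<close> for the difference
  \<open>\<phi>\<close> of two slices, then in direction \<open>j\<close> for the partial derivative
  so obtained.\<close>

lemma second_difference_MVT:
  fixes x :: "nat \<Rightarrow> real"
  assumes U: "openin (Euclidean_space n) U" and f: "smooth_on n U f"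
    and ij: "i < n" "j < n" "i \<noteq> j" and h: "h > 0"
    and box: "\<And>s t. \<lbrakk>x i \<le> s; s \<le> x i + h; x j \<le> t; t \<le> x j + h\<rbrakk> \<Longrightarrow> x(i := s, j := t) \<in> U"
  shows "\<exists>s t. x i < s \<and> s < x i + h \<and> x j < t \<and> t < x j + h \<and>
     f (x(i := x i + h, j := x j + h)) - f (x(i := x i, j := x j + h)) - f (x(i := x i + h, j := x j)) + f x
     = h * h * pderiv_coord j (pderiv_coord i f) (x(i := s, j := t))"
proof -
  note D = smooth_onD(2)[OF U f] and D2 = smooth_onD(2)[OF U smooth_onD(3)[OF U f]]
  define \<phi> where "\<phi> s = f (x(i := s, j := x j + h)) - f (x(i := s, j := x j))" for s
  have "\<exists>s. x i < s \<and> s < x i + h \<and> \<phi> (x i + h) - \<phi> (x i) =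
      h * (pderiv_coord i f (x(i := s, j := x j + h)) - pderiv_coord i f (x(i := s, j := x j)))"
  proof (rule MVT_at[OF h])
    fix s assume s: "x i \<le> s" "s \<le> x i + h"
    have *: "((\<lambda>s. f (x(i := s, j := t))) has_real_derivative pderiv_coord i f (x(i := s, j := t))) (at s)"
      if "x j \<le> t" "t \<le> x j + h" for t
      using D[OF ij(1) box[OF s that]] ij(3) by (simp add: fun_upd_twist)
    show "(\<phi> has_real_derivative pderiv_coord i f (x(i := s, j := x j + h)) - pderiv_coord i f (x(i := s, j := x j))) (at s)"
      unfolding \<phi>_def using h by (intro DERIV_diff *) auto
  qed
  then obtain s where s: "x i < s" "s < x i + h" "\<phi> (x i + h) - \<phi> (x i) =
      h * (pderiv_coord i f (x(i := s, j := x j + h)) - pderiv_coord i f (x(i := s, j := x j)))" by blast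
  have "\<exists>t. x j < t \<and> t < x j + h \<and> pderiv_coord i f (x(i := s, j := x j + h)) - pderiv_coord i f (x(i := s, j := x j))
     = h * pderiv_coord j (pderiv_coord i f) (x(i := s, j := t))"
  proof (rule MVT_at[OF h])
    fix t assume t: "x j \<le> t" "t \<le> x j + h"
    show "((\<lambda>t. pderiv_coord i f (x(i := s, j := t))) has_real_derivative
        pderiv_coord j (pderiv_coord i f) (x(i := s, j := t))) (at t)"
      using D2[OF ij(1,2) box[OF _ _ t]] s by simp
  qed
  then obtain t where t: "x j < t" "t < x j + h" "pderiv_coord i f (x(i := s, j := x j + h)) - pderiv_coord i f (x(i := s, j := x j))
     = h * pderiv_coord j (pderiv_coord i f) (x(i := s, j := t))" by blast
  have "x(i := x i, j := x j) = x" by simp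
  then have "f (x(i := x i + h, j := x j + h)) - f (x(i := x i, j := x j + h)) - f (x(i := x i + h, j := x j)) + f x = 
    \<phi> (x i + h) - \<phi> (x i)"
    by (simp add: \<phi>_def)
  also have "\<dots> = h * h * pderiv_coord j (pderiv_coord i f) (x(i := s, j := t))"
    using s t by simp
  finally show ?thesis using s t by blast
qed

text \<open>Schwarz's theorem. The second difference over a small square does not depend on the
  order of the directions, so the two mixed derivatives share a value at two points of the square;
  by continuity they differ by less than any \<open>e\<close> at the corner
  \<open>x\<close>.\<close>

lemma pderiv_coord_commute:
  assumes U: "openin (Euclidean_space n) U" and f: "smooth_on n U f" and x: "x \<in> U" and ij: "i < n" "j < n"
  shows "pderiv_coord i (pderiv_coord j f) x = pderiv_coord j (pderiv_coord i f) x"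
proof (cases "i = j")
  case False
  let ?A = "pderiv_coord i (pderiv_coord j f)" and ?B = "pderiv_coord j (pderiv_coord i f)"
  have cA: "continuous_on U ?A" and cB: "continuous_on U ?B"
    using smooth_onD(1)[OF U smooth_onD(3)[OF U smooth_onD(3)[OF U f]]] ij by auto
  have "\<bar>?A x - ?B x\<bar> < e" if e: "e > 0" for e
  proof -
    obtain d1 where d1: "d1 > 0" "\<forall>y. in_box n d1 x y \<longrightarrow> y \<in> U \<and> \<bar>?A y - ?A x\<bar> < e/2"
      using openin_Euclidean_space_near[OF U cA x, of "e/2"] e by (auto elim!: exE conjE)
    obtain d2 where d2: "d2 > 0" "\<forall>y. in_box n d2 x y \<longrightarrow> y \<in> U \<and> \<bar>?B y - ?B x\<bar> < e/2"
      using openin_Euclidean_space_near[OF U cB x, of "e/2"] e by (auto elim!: exE conjE)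
    \<comment> \<open>Half of the smaller radius, so that the closed square of side \<open>h\<close>
      lies in both open boxes.\<close>
    define h where "h = min d1 d2 / 2"
    have h: "h > 0" "h < d1" "h < d2" using d1 d2 by (auto simp: h_def min_def)
    have A: "x(i := s, j := t) \<in> U \<and> \<bar>?A (x(i := s, j := t)) - ?A x\<bar> < e/2"
      if "x i \<le> s" "s \<le> x i + h" "x j \<le> t" "t \<le> x j + h" for s t
      by (rule d1(2)[rule_format]) (use that h ij openin_Euclidean_space_subset[OF U x] in auto)
    have B: "\<bar>?B (x(i := s, j := t)) - ?B x\<bar> < e/2"
      if "x i \<le> s" "s \<le> x i + h" "x j \<le> t" "t \<le> x j + h" for s t
      by (rule d2(2)[rule_format, THEN conjunct2]) (use that h ij openin_Euclidean_space_subset[OF U x] in auto)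
    obtain s t where st: "x i < s" "s < x i + h" "x j < t" "t < x j + h"
      "f (x(i := x i + h, j := x j + h)) - f (x(i := x i, j := x j + h)) - f (x(i := x i + h, j := x j)) + f x
       = h * h * ?B (x(i := s, j := t))"
      using second_difference_MVT[OF U f ij False h(1), of x] A by blast
    have A': "x(j := t, i := s) \<in> U" if "x i \<le> s" "s \<le> x i + h" "x j \<le> t" "t \<le> x j + h" for s t
      using A[OF that] False by (simp add: fun_upd_twist)
    obtain s' t' where st': "x i < s'" "s' < x i + h" "x j < t'" "t' < x j + h"
      "f (x(j := x j + h, i := x i + h)) - f (x(j := x j, i := x i + h)) - f (x(j := x j + h, i := x i)) + f x
       = h * h * ?A (x(j := t', i := s'))"
      using second_difference_MVT[OF U f ij(2,1) False[symmetric] h(1), of x] A' by blast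
    \<comment> \<open>The two updates commute, which identifies the second differences taken in
      either order.\<close>
    have tw: "x(j := b, i := a) = x(i := a, j := b)" for a b using False by (simp add: fun_upd_twist)
    have "h * h * ?A (x(i := s', j := t')) = h * h * ?B (x(i := s, j := t))"
      using st(5) st'(5) unfolding tw by linarith
    then have "?A (x(i := s', j := t')) = ?B (x(i := s, j := t))" using h by simp
    moreover have "\<bar>?A (x(i := s', j := t')) - ?A x\<bar> < e/2" using A[of s' t'] st' by simp
    moreover have "\<bar>?B (x(i := s, j := t)) - ?B x\<bar> < e/2" using B[of s t] st by simp
    ultimately show ?thesis by (simp add: abs_if split: if_splits)
  qed
  then have "\<not> \<bar>?A x - ?B x\<bar> > 0" by blast
  then show ?thesis by simp
qed simp

section \<open>Bump functions\<close>

text \<open>The flat function \<open>exp (- (1 / t))\<close> with a polynomial in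
  \<open>1 / t\<close> as additional factor. The enlarged family is closed under differentiation, so
  that smoothness becomes an induction over all \<open>P\<close>.\<close>

definition flat_exp :: "real poly \<Rightarrow> real \<Rightarrow> real" where
  "flat_exp P t = (if t > 0 then poly P (1 / t) * exp (- (1 / t)) else 0)"

text \<open>The power of \<open>u\<close> is kept general because
  \<open>poly (pCons a P) u = a + u * poly P u\<close> moves a factor \<open>u\<close> from the
  polynomial into the power.\<close>

lemma tendsto_poly_div_exp:
  fixes P :: "real poly"
  shows "((\<lambda>u. poly P u * u ^ k / exp u) \<longlongrightarrow> 0) at_top"
proof (induction P arbitrary: k)
  case (pCons a P)
  have "((\<lambda>u. a * (u ^ k / exp u) + poly P u * u ^ Suc k / exp u) \<longlongrightarrow> a * 0 + 0) at_top"
    by (intro tendsto_intros tendsto_power_div_exp_0 pCons.IH)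
  moreover have "(\<lambda>u. a * (u ^ k / exp u) + poly P u * u ^ Suc k / exp u) = (\<lambda>u. poly (pCons a P) u * u ^ k / exp u)"
    by (auto simp: fun_eq_iff algebra_simps add_divide_distrib)
  ultimately show ?case by simp
qed simp

text \<open>For \<open>t > 0\<close> and \<open>u = 1 / t\<close>, the derivative of P(u) exp(-u)
  with respect to \<open>t\<close> is u^2 (P(u) - P'(u)) exp(-u), whence the polynomial on the
  right. At 0 the difference quotients from both sides tend to 0.\<close>

lemma flat_exp_deriv:
  "(flat_exp P has_real_derivative flat_exp (monom 1 2 * (P - pderiv P)) t) (at t)"
proof -
  consider "t > 0" | "t < 0" | "t = 0" by linarith
  then show ?thesis
  proof cases
    case 1
    have D: "((\<lambda>t. poly P (1 / t) * exp (- (1 / t))) has_real_derivative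
       flat_exp (monom 1 2 * (P - pderiv P)) t) (at t)"
      using 1 by (auto intro!: derivative_eq_intros DERIV_chain2[OF poly_DERIV]
        simp: flat_exp_def poly_monom power2_eq_square field_simps)
    have "eventually (\<lambda>s. s > 0) (nhds t)" 
      using eventually_nhds_in_open[of "{0<..}" t] 1 by (auto elim: eventually_mono)
    then have ev: "eventually (\<lambda>s. poly P (1 / s) * exp (- (1 / s)) = flat_exp P s) (nhds t)"
      by (rule eventually_mono) (simp add: flat_exp_def)
    show ?thesis using D DERIV_cong_ev[OF refl ev refl] by blast
  next
    case 2
    have ev: "eventually (\<lambda>s. 0 = flat_exp P s) (nhds t)"
      using eventually_nhds_in_open[of "{..<0}" t] 2 by (auto simp: flat_exp_def elim: eventually_mono)
    have "((\<lambda>s. 0) has_real_derivative flat_exp (monom 1 2 * (P - pderiv P)) t) (at t)"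
      using 2 by (simp add: flat_exp_def)
    then show ?thesis using DERIV_cong_ev[OF refl ev refl] by blast
  next
    case 3
    have "((\<lambda>s. flat_exp P s / s) \<longlongrightarrow> 0) (at_left 0)"
      by (rule tendsto_eventually) (auto simp: flat_exp_def eventually_at_filter)
    moreover have "((\<lambda>s. flat_exp P s / s) \<longlongrightarrow> 0) (at_right 0)"
    proof -
      \<comment> \<open>With u = 1/s the difference quotient is P(u) u / exp(u); the exponent 1
        stems from the division by \<open>s\<close>.\<close>
      have "((\<lambda>s. poly P (inverse s) * inverse s ^ 1 / exp (inverse s)) \<longlongrightarrow> 0) (at_right 0)"
        by (rule filterlim_compose[OF tendsto_poly_div_exp filterlim_inverse_at_top_right])
      moreover have "eventually (\<lambda>s. poly P (inverse s) * inverse s ^ 1 / exp (inverse s) = flat_exp P s / s) (at_right 0)"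
        by (auto simp: flat_exp_def eventually_at_filter exp_minus field_simps)
      ultimately show ?thesis by (rule Lim_transform_eventually)
    qed
    ultimately have "((\<lambda>s. flat_exp P s / s) \<longlongrightarrow> 0) (at 0)"
      by (rule filterlim_split_at_real)
    then show ?thesis using 3 by (simp add: has_field_derivative_iff flat_exp_def)
  qed
qed

lemma smooth_on_flat_exp:
  assumes U: "openin (Euclidean_space n) U" and g: "smooth_on n U g"
  shows "smooth_on n U (\<lambda>x. flat_exp P (g x))"
proof -
  have "Ck_on k n U (\<lambda>x. flat_exp P (g x))" for k
  proof (induction k arbitrary: P)
    case 0
    have "continuous_on UNIV (flat_exp P)"
      by (rule continuous_at_imp_continuous_on) (use DERIV_isCont[OF flat_exp_deriv] in blast)
    then show ?case using smooth_onD(1)[OF U g] continuous_on_compose2[of UNIV "flat_exp P" U g]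
      by (simp add: Ck_on_0[OF U])
  next
    case (Suc k)
    let ?Q = "monom 1 2 * (P - pderiv P)"
    show ?case
    proof (rule Ck_on_SucI[OF U, where g = "\<lambda>i x. flat_exp ?Q (g x) * pderiv_coord i g x"])
      show "continuous_on U (\<lambda>x. flat_exp P (g x))" using Suc.IH Ck_on_continuous_on[OF U] by blast
      show "((\<lambda>t. flat_exp P (g (x(i := t)))) has_real_derivative flat_exp ?Q (g x) * pderiv_coord i g x) (at (x i))"
        if "i < n" "x \<in> U" for i x
        using DERIV_chain2[OF flat_exp_deriv smooth_onD(2)[OF U g that], of P] by (simp only: fun_upd_triv)
      show "Ck_on k n U (\<lambda>x. flat_exp ?Q (g x) * pderiv_coord i g x)" if "i < n" for i
        using Suc.IH smooth_onD(3)[OF U g that] by (auto simp: smooth_on_def intro!: Ck_on_mult[OF U])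
    qed
  qed
  then show ?thesis by (simp add: smooth_on_def)
qed

lemma Euclidean_bump:
  fixes a :: "nat \<Rightarrow> real"
  assumes a: "a \<in> topspace (Euclidean_space n)" and d: "d > 0"
  shows "\<exists>\<eta> W. smooth_on n (topspace (Euclidean_space n)) \<eta> \<and> openin (Euclidean_space n) W \<and> a \<in> W \<and>
    (\<forall>y\<in>W. \<eta> y = 1) \<and> (\<forall>y. (\<exists>i<n. \<bar>y i - a i\<bar> \<ge> d) \<longrightarrow> \<eta> y = 0)"
proof -
  let ?E = "topspace (Euclidean_space n)" and ?\<psi> = "flat_exp 1"
  have E: "openin (Euclidean_space n) ?E" by simp
  define s where "s y = (\<Sum>i<n. (y i - a i) * (y i - a i))" for y :: "nat \<Rightarrow> real"
  \<comment> \<open>The value of the inner function at points where \<open>s\<close> equals d^2, and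
    by monotonicity a lower bound for it wherever some coordinate is off by at least
    \<open>d\<close>.\<close>
  define w where "w = ?\<psi> (d\<^sup>2 / 2)"
  have w: "w > 0" using d by (simp add: w_def flat_exp_def)
  (* Close to a the inner value vanishes, and away from a it is at least w, so no quotient of
     varying functions is needed. *)
  define \<eta> where "\<eta> y = ?\<psi> (w + (-1) * ?\<psi> (s y + (- (d\<^sup>2 / 2)))) * inverse (?\<psi> w)" for y
  have s: "smooth_on n ?E s"
    unfolding s_def diff_conv_add_uminus
    by (intro smooth_on_sum[OF E] smooth_on_mult[OF E] smooth_on_add[OF E] smooth_on_coord[OF E] smooth_on_const[OF E])
  have \<eta>: "smooth_on n ?E \<eta>"
    unfolding \<eta>_def
    by (intro smooth_on_flat_exp[OF E] smooth_on_mult[OF E] smooth_on_add[OF E] smooth_on_const[OF E] s)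
  define W where "W = ?E \<inter> s -` {..<d\<^sup>2 / 2}"
  have "openin (top_of_set ?E) W"
    unfolding W_def using smooth_onD(1)[OF E s] by (simp add: continuous_openin_preimage_gen)
  then have W: "openin (Euclidean_space n) W"
    using Euclidean_space_top_of_set[of n] by simp
  have aW: "a \<in> W" using a d by (simp add: W_def s_def)
  have one: "\<eta> y = 1" if "y \<in> W" for y
    using that w by (simp add: \<eta>_def W_def flat_exp_def)
  have zero: "\<eta> y = 0" if "i < n" "\<bar>y i - a i\<bar> \<ge> d" for i y
  proof -
    have "d\<^sup>2 \<le> (y i - a i) * (y i - a i)"
      using power_mono[OF that(2), of 2] d by (simp add: power2_eq_square)
    also have "\<dots> \<le> s y"
      unfolding s_def by (rule member_le_sum) (use that in auto)
    finally have le: "d\<^sup>2 / 2 \<le> s y - d\<^sup>2 / 2" by simp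
    have "?\<psi> v \<le> ?\<psi> u" if "0 < v" "v \<le> u" for u v
      using that by (simp add: flat_exp_def frac_le)
    then have "w \<le> ?\<psi> (s y - d\<^sup>2 / 2)"
      using le d unfolding w_def by simp
    then show ?thesis by (simp add: \<eta>_def flat_exp_def)
  qed
  show ?thesis using \<eta> W aW one zero by blast
qed

section \<open>The exterior algebra\<close>

definition inversions :: "nat set \<Rightarrow> nat set \<Rightarrow> nat" where
  "inversions I J = card {(i, j). i \<in> I \<and> j \<in> J \<and> j < i}"

lemma shuffle_sign_inversions: "shuffle_sign I J = (-1) ^ inversions I J"
  by (simp add: shuffle_sign_def inversions_def)

lemma finite_inversions:
  assumes "finite I" "finite J" shows "finite {(i, j). i \<in> I \<and> j \<in> J \<and> j < (i::nat)}"
  by (rule finite_subset[of _ "I \<times> J"]) (use assms in auto)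

lemma inversions_Un_left:
  assumes "finite I" "finite I'" "finite J" "I \<inter> I' = {}"
  shows "inversions (I \<union> I') J = inversions I J + inversions I' J"
proof -
  have "{(i, j). i \<in> I \<union> I' \<and> j \<in> J \<and> j < i} = {(i, j). i \<in> I \<and> j \<in> J \<and> j < i} \<union> {(i, j). i \<in> I' \<and> j \<in> J \<and> j < i}"
    by auto
  then show ?thesis
    unfolding inversions_def using assms finite_inversions by (subst card_Un_disjoint[symmetric]) auto
qed

lemma inversions_Un_right:
  assumes "finite I" "finite J" "finite J'" "J \<inter> J' = {}"
  shows "inversions I (J \<union> J') = inversions I J + inversions I J'"
proof -
  have "{(i, j). i \<in> I \<and> j \<in> J \<union> J' \<and> j < i} = {(i, j). i \<in> I \<and> j \<in> J \<and> j < i} \<union> {(i, j). i \<in> I \<and> j \<in> J' \<and> j < i}"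
    by auto
  then show ?thesis
    unfolding inversions_def using assms finite_inversions by (subst card_Un_disjoint[symmetric]) auto
qed

text \<open>Either product counts the inversions of the three pairs \<open>(I, J)\<close>,
  \<open>(I, K)\<close> and \<open>(J, K)\<close>.\<close>

lemma shuffle_sign_cocycle:
  assumes "finite I" "finite J" "finite K" "I \<inter> J = {}" "I \<inter> K = {}" "J \<inter> K = {}"
  shows "shuffle_sign I J * shuffle_sign (I \<union> J) K = shuffle_sign J K * shuffle_sign I (J \<union> K)"
  using assms
  by (simp add: shuffle_sign_inversions inversions_Un_left inversions_Un_right power_add)

lemma wedge_infinite: "infinite K \<Longrightarrow> wedge a b K = 0"
  by (simp add: wedge_def)

text \<open>Both sides run over the partitions of \<open>K\<close> into three blocks, indexed on the
  left by chains I \<subseteq> L \<subseteq> K and on the right by successive choices of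
  \<open>I\<close> and \<open>J\<close>; the cocycle identity compares the signs.\<close>

lemma wedge_assoc: "wedge (wedge a b) c = wedge a (wedge b c)"
proof
  fix K
  show "wedge (wedge a b) c K = wedge a (wedge b c) K"
  proof (cases "finite K")
    case True
    let ?l = "\<lambda>(L, I). shuffle_sign L (K - L) * shuffle_sign I (L - I) * a I * b (L - I) * c (K - L)"
    let ?r = "\<lambda>(I, J). shuffle_sign I (K - I) * shuffle_sign J (K - I - J) * a I * b J * c (K - I - J)"
    have "wedge (wedge a b) c K = (\<Sum>x\<in>(SIGMA L:Pow K. Pow L). ?l x)"
      unfolding wedge_def using True
      by (subst sum.Sigma[symmetric])
        (auto simp: sum_distrib_left sum_distrib_right mult_ac intro!: sum.cong dest: finite_subset)
    also have "\<dots> = (\<Sum>x\<in>(SIGMA I:Pow K. Pow (K - I)). ?r x)"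
    proof (rule sum.reindex_bij_witness[where i = "\<lambda>(I, J). (I \<union> J, I)" and j = "\<lambda>(L, I). (I, L - I)"])
      fix x assume "x \<in> (SIGMA L:Pow K. Pow L)"
      then obtain L I where x: "x = (L, I)" "L \<subseteq> K" "I \<subseteq> L" by auto
      have fin: "finite L" "finite I" using x True by (auto intro: finite_subset)
      have eq: "I \<union> (L - I) = L" "(L - I) \<union> (K - L) = K - I" "K - I - (L - I) = K - L" using x by auto
      have sign: "shuffle_sign I (L - I) * shuffle_sign L (K - L) = shuffle_sign (L - I) (K - L) * shuffle_sign I (K - I)"
        using shuffle_sign_cocycle[of I "L - I" "K - L"] fin True x unfolding eq by blast
      have "?r (case x of (L, I) \<Rightarrow> (I, L - I)) =
          (shuffle_sign (L - I) (K - L) * shuffle_sign I (K - I)) * (a I * b (L - I) * c (K - L))"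
        by (simp add: x(1) eq(3) mult_ac)
      also have "\<dots> = ?l x"
        unfolding sign[symmetric] by (simp add: x(1) mult_ac)
      finally show "?r (case x of (L, I) \<Rightarrow> (I, L - I)) = ?l x" .
    qed auto
    also have "\<dots> = wedge a (wedge b c) K"
      unfolding wedge_def using True
      by (subst sum.Sigma[symmetric])
        (auto simp: sum_distrib_left sum_distrib_right mult_ac intro!: sum.cong)
    finally show ?thesis .
  qed (simp add: wedge_infinite)
qed

lemma wedge_add_left: "wedge (\<lambda>I. a I + b I) c = (\<lambda>I. wedge a c I + wedge b c I)"
  by (simp add: wedge_def fun_eq_iff algebra_simps sum.distrib)

lemma wedge_add_right: "wedge a (\<lambda>I. b I + c I) = (\<lambda>I. wedge a b I + wedge a c I)"
  by (simp add: wedge_def fun_eq_iff algebra_simps sum.distrib)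

lemma wedge_scale_left: "wedge (\<lambda>I. t * a I) b = (\<lambda>I. t * wedge a b I)"
  by (simp add: wedge_def fun_eq_iff sum_distrib_left mult_ac)

lemma wedge_scale_right: "wedge a (\<lambda>I. t * b I) = (\<lambda>I. t * wedge a b I)"
  by (simp add: wedge_def fun_eq_iff sum_distrib_left mult_ac)

lemma wedge_zero_left [simp]: "wedge (\<lambda>I. 0) b = (\<lambda>I. 0)"
  by (simp add: wedge_def fun_eq_iff)

lemma wedge_zero_right [simp]: "wedge a (\<lambda>I. 0) = (\<lambda>I. 0)"
  by (simp add: wedge_def fun_eq_iff)

lemma wedge_sum_left: "wedge (\<lambda>I. \<Sum>s\<in>S. a s I) b = (\<lambda>I. \<Sum>s\<in>S. wedge (a s) b I)"
  by (induction S rule: infinite_finite_induct) (simp_all add: wedge_add_left)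

lemma wedge_sum_right: "wedge a (\<lambda>I. \<Sum>s\<in>S. b s I) = (\<lambda>I. \<Sum>s\<in>S. wedge a (b s) I)"
  by (induction S rule: infinite_finite_induct) (simp_all add: wedge_add_right)

lemma wedge_scalar:
  assumes "\<And>I. I \<noteq> {} \<Longrightarrow> a I = 0" "finite K"
  shows "wedge a b K = a {} * b K"
proof -
  have "wedge a b K = (\<Sum>I\<in>{{}}. shuffle_sign I (K - I) * a I * b (K - I))"
    unfolding wedge_def by (rule sum.mono_neutral_right) (use assms in auto)
  then show ?thesis by (simp add: shuffle_sign_def)
qed

lemma wedge_vec:
  assumes "finite K"
  shows "wedge (ext_vec v) b K = (\<Sum>i\<in>K. shuffle_sign {i} (K - {i}) * v i * b (K - {i}))"
proof -
  have "wedge (ext_vec v) b K = (\<Sum>I\<in>(\<lambda>i. {i}) ` K. shuffle_sign I (K - I) * ext_vec v I * b (K - I))"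
    unfolding wedge_def by (rule sum.mono_neutral_right)
      (use assms in \<open>auto simp: ext_vec_def is_singleton_def\<close>)
  also have "\<dots> = (\<Sum>i\<in>K. shuffle_sign {i} (K - {i}) * ext_vec v {i} * b (K - {i}))"
    by (subst sum.reindex) (auto simp: inj_on_def)
  finally show ?thesis by (simp add: ext_vec_def)
qed

lemma inversions_finite_pair:
  assumes "i \<noteq> j"
  shows "inversions {i} {j} + inversions {j} {i} = Suc 0"
proof -
  have "{(a, b). a \<in> {i} \<and> b \<in> {j} \<and> b < a} = (if j < i then {(i, j)} else {})"
     "{(a, b). a \<in> {j} \<and> b \<in> {i} \<and> b < a} = (if i < j then {(j, i)} else {})" by auto
  then show ?thesis using assms unfolding inversions_def by auto
qed

text \<open>Removing \<open>i\<close> before \<open>j\<close> or after it changes the sign by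
  exactly one inversion, the one between \<open>i\<close> and \<open>j\<close>. The third factor
  \<open>b\<close> makes the rule applicable at the front of longer products.\<close>

lemma wedge_vec_vec_anticommute:
  "wedge (ext_vec u) (wedge (ext_vec w) b) K = - wedge (ext_vec w) (wedge (ext_vec u) b) K"
proof (cases "finite K")
  case True
  let ?s = "\<lambda>i j. shuffle_sign {i} (K - {i}) * shuffle_sign {j} (K - {i} - {j})"
  have expand: "wedge (ext_vec u) (wedge (ext_vec w) b) K =
    (\<Sum>(i, j)\<in>(SIGMA i:K. K - {i}). ?s i j * u i * w j * b (K - {i} - {j}))" for u w
    using True by (subst sum.Sigma[symmetric])
      (auto simp: wedge_vec sum_distrib_left mult_ac intro!: sum.cong)
  have sign: "?s i j = - ?s j i" if "i \<in> K" "j \<in> K" "i \<noteq> j" for i j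
  proof -
    let ?R = "K - {i} - {j}"
    have K: "K - {i} = {j} \<union> ?R" "K - {j} = {i} \<union> ?R" "K - {j} - {i} = ?R" using that by auto
    have "inversions {i} (K - {i}) = inversions {i} {j} + inversions {i} ?R"
         "inversions {j} (K - {j}) = inversions {j} {i} + inversions {j} ?R"
      using True by (subst K, subst inversions_Un_right; simp)+
    then show ?thesis
      using inversions_finite_pair[OF that(3)] unfolding shuffle_sign_inversions K(3)
      by (auto simp: power_add add_is_1)
  qed
  have "wedge (ext_vec u) (wedge (ext_vec w) b) K =
      (\<Sum>(j, i)\<in>(SIGMA i:K. K - {i}). ?s i j * u i * w j * b (K - {i} - {j}))"
    unfolding expand
    by (rule sum.reindex_bij_witness[where i = prod.swap and j = prod.swap]) auto
  also have "\<dots> = (\<Sum>(j, i)\<in>(SIGMA i:K. K - {i}). - (?s j i * w j * u i * b (K - {j} - {i})))"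
  proof (rule sum.cong[OF refl])
    fix x assume "x \<in> (SIGMA i:K. K - {i})"
    then obtain j i where x: "x = (j, i)" "j \<in> K" "i \<in> K" "i \<noteq> j" by auto
    have "K - {i} - {j} = K - {j} - {i}" by auto
    then show "(case x of (j, i) \<Rightarrow> ?s i j * u i * w j * b (K - {i} - {j})) =
        (case x of (j, i) \<Rightarrow> - (?s j i * w j * u i * b (K - {j} - {i})))"
      unfolding x(1) prod.case sign[OF x(3,2,4)] by simp
  qed
  also have "\<dots> = - wedge (ext_vec w) (wedge (ext_vec u) b) K"
    unfolding expand by (simp add: sum_negf case_prod_unfold)
  finally show ?thesis .
qed (simp add: wedge_infinite)

lemma wedge_vec_vec_self: "wedge (ext_vec u) (wedge (ext_vec u) b) = (\<lambda>K. 0)"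
  using wedge_vec_vec_anticommute[of u u b] by (auto simp: fun_eq_iff)

lemma wedge_unit: "finite K \<Longrightarrow> wedge ext_unit b K = b K"
  by (subst wedge_scalar) (auto simp: ext_unit_def)

text \<open>Finiteness is part of the condition because \<open>card\<close> is 0 on infinite
  sets.\<close>

definition ext_degree :: "ext \<Rightarrow> nat \<Rightarrow> bool" where
  "ext_degree a r \<longleftrightarrow> (\<forall>I. a I \<noteq> 0 \<longrightarrow> finite I \<and> card I = r)"

lemma ext_degree_wedge:
  assumes "ext_degree a r" "ext_degree b s"
  shows "ext_degree (wedge a b) (r + s)"
  unfolding ext_degree_def
proof (intro allI impI)
  fix K assume K: "wedge a b K \<noteq> 0"
  then have fin: "finite K" using wedge_infinite by blast
  obtain I where I: "I \<subseteq> K" "a I \<noteq> 0" "b (K - I) \<noteq> 0"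
    using K unfolding wedge_def by (metis (no_types, lifting) PowD mult_eq_0_iff sum.neutral)
  then have "card I = r" "card (K - I) = s" using assms by (auto simp: ext_degree_def)
  moreover have "card K = card I + card (K - I)"
    using fin I by (metis card_Diff_subset card_mono finite_subset le_add_diff_inverse)
  ultimately show "finite K \<and> card K = r + s" using fin by simp
qed

lemma ext_degree_vec: "ext_degree (ext_vec v) 1"
  by (auto simp: ext_degree_def ext_vec_def is_singleton_def)

section \<open>The homomorphism induced by a matrix\<close>

definition ext_col :: "nat \<Rightarrow> (nat \<Rightarrow> nat \<Rightarrow> real) \<Rightarrow> nat \<Rightarrow> ext" where
  "ext_col n A i = ext_vec (\<lambda>j. if j < n then A j i else 0)"

definition ext_cols :: "nat \<Rightarrow> (nat \<Rightarrow> nat \<Rightarrow> real) \<Rightarrow> nat set \<Rightarrow> ext" where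
  "ext_cols n A I = foldr (\<lambda>i. wedge (ext_col n A i)) (sorted_list_of_set I) ext_unit"

definition ext_single :: "nat set \<Rightarrow> ext" where
  "ext_single I J = (if J = I then 1 else 0)"

definition basis_vec :: "nat \<Rightarrow> nat \<Rightarrow> real" where
  "basis_vec i j = (if j = i then 1 else 0)"

definition ext_supp :: "nat \<Rightarrow> ext \<Rightarrow> bool" where
  "ext_supp n a \<longleftrightarrow> (\<forall>I. \<not> I \<subseteq> {..<n} \<longrightarrow> a I = 0)"

lemma ext_map_cols: "ext_map n A a K = (\<Sum>I\<in>Pow {..<n}. a I * ext_cols n A I K)"
  by (simp add: ext_map_def ext_cols_def ext_col_def)

lemma ext_map_sum: "ext_map n A (\<lambda>I. \<Sum>s\<in>S. t s * a s I) = (\<lambda>K. \<Sum>s\<in>S. t s * ext_map n A (a s) K)"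
proof
  fix K
  have "ext_map n A (\<lambda>I. \<Sum>s\<in>S. t s * a s I) K = (\<Sum>I\<in>Pow {..<n}. \<Sum>s\<in>S. t s * a s I * ext_cols n A I K)"
    by (simp add: ext_map_cols sum_distrib_right)
  also have "\<dots> = (\<Sum>s\<in>S. \<Sum>I\<in>Pow {..<n}. t s * a s I * ext_cols n A I K)"
    by (rule sum.swap)
  finally show "ext_map n A (\<lambda>I. \<Sum>s\<in>S. t s * a s I) K = (\<Sum>s\<in>S. t s * ext_map n A (a s) K)"
    by (simp add: ext_map_cols sum_distrib_left mult_ac)
qed

lemma ext_map_add: "ext_map n A (\<lambda>I. a I + b I) = (\<lambda>I. ext_map n A a I + ext_map n A b I)"
  by (simp add: ext_map_cols fun_eq_iff algebra_simps sum.distrib)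

lemma ext_map_scale: "ext_map n A (\<lambda>I. t * a I) = (\<lambda>I. t * ext_map n A a I)"
  by (simp add: ext_map_cols fun_eq_iff sum_distrib_left mult_ac)

lemma ext_map_zero [simp]: "ext_map n A (\<lambda>I. 0) = (\<lambda>I. 0)"
  by (simp add: ext_map_cols fun_eq_iff)

lemma ext_map_single: "I \<subseteq> {..<n} \<Longrightarrow> ext_map n A (ext_single I) = ext_cols n A I"
  by (simp add: ext_map_cols fun_eq_iff ext_single_def if_distrib[where f="\<lambda>x. x * _"] cong: if_cong)

lemma ext_single_expansion: "ext_supp n a \<Longrightarrow> a = (\<lambda>J. \<Sum>I\<in>Pow {..<n}. a I * ext_single I J)"
  by (auto simp: fun_eq_iff ext_single_def ext_supp_def if_distrib[where f="\<lambda>x. _ * x"] cong: if_cong)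

lemma ext_cols_degree: "finite I \<Longrightarrow> ext_degree (ext_cols n A I) (card I)"
proof -
  have "ext_degree (foldr (\<lambda>i. wedge (ext_col n A i)) xs ext_unit) (length xs)" for xs
  proof (induction xs)
    case Nil
    show ?case by (simp add: ext_degree_def ext_unit_def)
  next
    case (Cons i xs)
    then show ?case
      using ext_degree_wedge[OF ext_degree_vec Cons.IH] by (simp add: ext_col_def)
  qed
  from this[of "sorted_list_of_set I"] show ?thesis by (simp add: ext_cols_def)
qed

text \<open>The fold over the sorted list multiplies by the least index from the left. This is why
  index sets are built below by inserting ever smaller elements.\<close>

lemma ext_cols_insert_min:
  assumes "finite I" "\<forall>j\<in>I. i < j"
  shows "ext_cols n A (insert i I) = wedge (ext_col n A i) (ext_cols n A I)"
proof -
  have "sorted_list_of_set (insert i I) = insort i (sorted_list_of_set I)"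
    using assms by (intro sorted_list_of_set_insert_remove[THEN trans]) auto
  also have "\<dots> = i # sorted_list_of_set I"
    using assms by (intro insort_is_Cons) (auto intro: less_imp_le)
  finally show ?thesis by (simp add: ext_cols_def)
qed

lemma wedge_basis_vec_single:
  assumes "finite I"
  shows "wedge (ext_vec (basis_vec i)) (ext_single I) =
    (\<lambda>K. (if i \<in> I then 0 else shuffle_sign {i} I) * ext_single (insert i I) K)"
proof
  fix K
  show "wedge (ext_vec (basis_vec i)) (ext_single I) K =
    (if i \<in> I then 0 else shuffle_sign {i} I) * ext_single (insert i I) K"
  proof (cases "finite K")
    case True
    have "wedge (ext_vec (basis_vec i)) (ext_single I) K =
       (\<Sum>k\<in>K. if k = i then shuffle_sign {i} (K - {i}) * ext_single I (K - {i}) else 0)"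
      unfolding wedge_vec[OF True] by (rule sum.cong) (auto simp: basis_vec_def)
    also have "\<dots> = (if i \<in> K then shuffle_sign {i} (K - {i}) * ext_single I (K - {i}) else 0)"
      using True by simp
    also have "\<dots> = (if i \<in> I then 0 else shuffle_sign {i} I) * ext_single (insert i I) K"
      by (auto simp: ext_single_def)
    finally show ?thesis .
  next
    case False
    then show ?thesis using assms by (auto simp: wedge_infinite ext_single_def)
  qed
qed

lemma wedge_basis_vec_single_min:
  assumes "finite I" "\<forall>j\<in>I. i < j"
  shows "wedge (ext_vec (basis_vec i)) (ext_single I) = ext_single (insert i I)"
proof -
  have "{(a, b). a \<in> {i} \<and> b \<in> I \<and> b < a} = {}" using assms by auto
  then have "shuffle_sign {i} I = 1" unfolding shuffle_sign_def by (metis card.empty power_0)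
  moreover have "i \<notin> I" using assms by auto
  ultimately show ?thesis by (simp add: wedge_basis_vec_single[OF assms(1)])
qed

text \<open>The core of multiplicativity. An index below the minimum of the set is simply put in
  front; an index equal to the minimum \<open>b\<close> gives 0 on both sides; a larger one is moved
  past column \<open>b\<close> at the cost of a sign and then treated by the induction
  hypothesis.\<close>

lemma wedge_col_cols:
  assumes "finite I"
  shows "I \<subseteq> {..<n} \<Longrightarrow> i < n \<Longrightarrow>
    wedge (ext_col n A i) (ext_cols n A I) = ext_map n A (wedge (ext_vec (basis_vec i)) (ext_single I))"
  using assms
proof (induction I arbitrary: i rule: finite_linorder_min_induct)
  have min: "wedge (ext_col n A i) (ext_cols n A I) = ext_map n A (wedge (ext_vec (basis_vec i)) (ext_single I))"
    if "finite I" "I \<subseteq> {..<n}" "i < n" "\<forall>j\<in>I. i < j" for I i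
    using that by (simp add: wedge_basis_vec_single_min ext_cols_insert_min ext_map_single)
  {
    case empty
    then show ?case using min by simp
  next
    case (insert b I)
    have I: "I \<subseteq> {..<n}" "b < n" using insert.prems by auto
    consider "i < b" | "i = b" | "b < i" by linarith
    then show ?case
    proof cases
      case 1
      then show ?thesis using insert min[of "insert b I" i] by force
    next
      case 2
      have "wedge (ext_vec (basis_vec i)) (ext_single (insert b I)) = (\<lambda>K. 0)"
        using insert.hyps by (simp add: wedge_basis_vec_single 2)
      then show ?thesis
        using insert.hyps by (simp add: 2 ext_cols_insert_min ext_col_def wedge_vec_vec_self)
    next
      case 3
      \<comment> \<open>The factor in e_i \<and> e_I = \<open>?t\<close> e_(I \<union> {i}), with
        value 0 if \<open>i\<close> already occurs in \<open>I\<close>.\<close>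
      let ?t = "if i \<in> I then 0 else shuffle_sign {i} I"
      have neg: "f = (\<lambda>K. (-1) * g K)" if "\<And>K. f K = - g K" for f g :: ext
        using that by auto
      have "wedge (ext_col n A i) (ext_cols n A (insert b I)) =
          wedge (ext_col n A i) (wedge (ext_col n A b) (ext_cols n A I))"
        using insert.hyps by (simp add: ext_cols_insert_min)
      also have "\<dots> = (\<lambda>K. (-1) * wedge (ext_col n A b) (wedge (ext_col n A i) (ext_cols n A I)) K)"
        by (rule neg) (simp only: ext_col_def wedge_vec_vec_anticommute[of "\<lambda>j. if j < n then A j i else 0"])
      also have "\<dots> = (\<lambda>K. (-1) * wedge (ext_col n A b) (ext_map n A (\<lambda>K. ?t * ext_single (insert i I) K)) K)"
        using insert.IH[OF I(1) insert.prems(2)] wedge_basis_vec_single[OF insert.hyps(1)] by simp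
      also have "\<dots> = (\<lambda>K. (-1) * (?t * wedge (ext_col n A b) (ext_cols n A (insert i I)) K))"
        using I insert.prems(2) by (simp add: ext_map_scale ext_map_single wedge_scale_right)
      also have "\<dots> = (\<lambda>K. (-1) * (?t * ext_map n A (wedge (ext_vec (basis_vec b)) (ext_single (insert i I))) K))"
        using min[of "insert i I" b] insert 3 by simp
      also have "\<dots> = ext_map n A (\<lambda>K. (-1) * wedge (ext_vec (basis_vec b)) (\<lambda>K. ?t * ext_single (insert i I) K) K)"
        by (simp only: ext_map_scale wedge_scale_right)
      also have "(\<lambda>K. ?t * ext_single (insert i I) K) = wedge (ext_vec (basis_vec i)) (ext_single I)"
        using wedge_basis_vec_single[OF insert.hyps(1)] by simp
      also have "(\<lambda>K. (-1) * wedge (ext_vec (basis_vec b)) (wedge (ext_vec (basis_vec i)) (ext_single I)) K) =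
          wedge (ext_vec (basis_vec i)) (wedge (ext_vec (basis_vec b)) (ext_single I))"
        by (rule neg[symmetric]) (rule wedge_vec_vec_anticommute)
      also have "wedge (ext_vec (basis_vec b)) (ext_single I) = ext_single (insert b I)"
        using insert.hyps by (simp add: wedge_basis_vec_single_min)
      finally show ?thesis .
    qed
  }
qed

lemma ext_supp_wedge:
  assumes "ext_supp n a" "ext_supp n b"
  shows "ext_supp n (wedge a b)"
  unfolding ext_supp_def wedge_def
proof (intro allI impI sum.neutral ballI)
  fix K I assume "\<not> K \<subseteq> {..<n}" "I \<in> Pow K"
  then have "\<not> I \<subseteq> {..<n} \<or> \<not> K - I \<subseteq> {..<n}" by auto
  then show "shuffle_sign I (K - I) * a I * b (K - I) = 0"
    using assms unfolding ext_supp_def by (metis mult_zero_left mult_zero_right)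
qed

lemma ext_supp_finite: "ext_supp n a \<Longrightarrow> infinite K \<Longrightarrow> a K = 0"
  unfolding ext_supp_def using finite_subset[of K "{..<n}"] by auto

lemma ext_supp_single: "I \<subseteq> {..<n} \<Longrightarrow> ext_supp n (ext_single I)"
  by (auto simp: ext_supp_def ext_single_def)

lemma ext_map_infinite: "infinite K \<Longrightarrow> ext_map n A a K = 0"
proof -
  assume K: "infinite K"
  have "ext_cols n A I K = 0" if "I \<subseteq> {..<n}" for I
    using ext_cols_degree[of I n A] K finite_subset[OF that] by (auto simp: ext_degree_def)
  then show ?thesis by (simp add: ext_map_cols)
qed

lemma ext_map_wedge_basis_vec:
  assumes "ext_supp n b" "i < n"
  shows "ext_map n A (wedge (ext_vec (basis_vec i)) b) = wedge (ext_col n A i) (ext_map n A b)"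
proof -
  let ?e = "ext_vec (basis_vec i)"
  have "wedge ?e b = wedge ?e (\<lambda>J. \<Sum>I\<in>Pow {..<n}. b I * ext_single I J)"
    using ext_single_expansion[OF assms(1)] by simp
  also have "\<dots> = (\<lambda>K. \<Sum>I\<in>Pow {..<n}. b I * wedge ?e (ext_single I) K)"
    by (simp only: wedge_sum_right wedge_scale_right)
  finally have "ext_map n A (wedge ?e b) = (\<lambda>K. \<Sum>I\<in>Pow {..<n}. b I * ext_map n A (wedge ?e (ext_single I)) K)"
    by (simp only: ext_map_sum)
  also have "\<dots> = (\<lambda>K. \<Sum>I\<in>Pow {..<n}. b I * wedge (ext_col n A i) (ext_cols n A I) K)"
    by (intro ext sum.cong refl) (use wedge_col_cols[OF _ _ assms(2)] in \<open>simp add: finite_subset[OF _ finite_lessThan]\<close>)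
  also have "\<dots> = wedge (ext_col n A i) (\<lambda>K. \<Sum>I\<in>Pow {..<n}. b I * ext_cols n A I K)"
    by (simp only: wedge_sum_right wedge_scale_right)
  also have "(\<lambda>K. \<Sum>I\<in>Pow {..<n}. b I * ext_cols n A I K) = ext_map n A b"
    by (simp add: ext_map_cols fun_eq_iff)
  finally show ?thesis .
qed

text \<open>By linearity \<open>a\<close> may be a basis element, whose vectors are peeled off from
  the smallest index on. As a consequence, products of multivector fields transform correctly
  between charts.\<close>

lemma ext_map_wedge:
  assumes a: "ext_supp n a" and b: "ext_supp n b"
  shows "ext_map n A (wedge a b) = wedge (ext_map n A a) (ext_map n A b)"
proof -
  have unit: "wedge ext_unit c = c" if "\<And>K. infinite K \<Longrightarrow> c K = 0" for c
    using that by (metis ext wedge_infinite wedge_unit)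
  have single: "ext_map n A (wedge (ext_single I) b) = wedge (ext_cols n A I) (ext_map n A b)"
    if "finite I" "I \<subseteq> {..<n}" for I
    using that
  proof (induction I rule: finite_linorder_min_induct)
    case empty
    have "ext_single {} = ext_unit" "ext_cols n A {} = ext_unit"
      by (auto simp: ext_single_def ext_unit_def ext_cols_def)
    then show ?case
      using unit[of b] unit[of "ext_map n A b"] ext_supp_finite[OF b] ext_map_infinite by metis
  next
    case (insert i I)
    have "ext_map n A (wedge (ext_single (insert i I)) b) =
        ext_map n A (wedge (ext_vec (basis_vec i)) (wedge (ext_single I) b))"
      using insert.hyps by (simp only: wedge_basis_vec_single_min[symmetric] wedge_assoc)
    also have "\<dots> = wedge (ext_col n A i) (ext_map n A (wedge (ext_single I) b))"
      by (rule ext_map_wedge_basis_vec) (use insert.prems in \<open>auto intro: ext_supp_wedge ext_supp_single b\<close>)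
    also have "\<dots> = wedge (ext_cols n A (insert i I)) (ext_map n A b)"
      using insert by (simp add: ext_cols_insert_min wedge_assoc)
    finally show ?case .
  qed
  have "wedge a b = wedge (\<lambda>J. \<Sum>I\<in>Pow {..<n}. a I * ext_single I J) b"
    using ext_single_expansion[OF a] by simp
  also have "\<dots> = (\<lambda>K. \<Sum>I\<in>Pow {..<n}. a I * wedge (ext_single I) b K)"
    by (simp only: wedge_sum_left wedge_scale_left)
  finally have "ext_map n A (wedge a b) = (\<lambda>K. \<Sum>I\<in>Pow {..<n}. a I * ext_map n A (wedge (ext_single I) b) K)"
    by (simp only: ext_map_sum)
  also have "\<dots> = (\<lambda>K. \<Sum>I\<in>Pow {..<n}. a I * wedge (ext_cols n A I) (ext_map n A b) K)"
    by (intro ext sum.cong refl) (use single in \<open>simp add: finite_subset[OF _ finite_lessThan]\<close>)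
  also have "\<dots> = wedge (\<lambda>K. \<Sum>I\<in>Pow {..<n}. a I * ext_cols n A I K) (ext_map n A b)"
    by (simp only: wedge_sum_left wedge_scale_left)
  also have "(\<lambda>K. \<Sum>I\<in>Pow {..<n}. a I * ext_cols n A I K) = ext_map n A a"
    by (simp add: ext_map_cols fun_eq_iff)
  finally show ?thesis .
qed

lemma ext_vec_singleton [simp]: "ext_vec v {i} = v i"
  by (simp add: ext_vec_def)

lemma ext_vec_not_singleton: "\<not> is_singleton I \<Longrightarrow> ext_vec v I = 0"
  by (simp add: ext_vec_def)

lemma ext_supp_vec:
  assumes "\<And>i. i \<ge> n \<Longrightarrow> v i = 0"
  shows "ext_supp n (ext_vec v)"
  unfolding ext_supp_def
proof (intro allI impI)
  fix I assume I: "\<not> I \<subseteq> {..<n}"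
  show "ext_vec v I = 0"
  proof (cases "is_singleton I")
    case True
    then obtain i where "I = {i}" by (auto simp: is_singleton_def)
    then show ?thesis using I assms[of i] by simp
  qed (simp add: ext_vec_not_singleton)
qed

lemma ext_map_vec:
  assumes "\<And>i. i \<ge> n \<Longrightarrow> v i = 0"
  shows "ext_map n A (ext_vec v) = ext_vec (\<lambda>j. if j < n then \<Sum>i<n. A j i * v i else 0)"
proof -
  have "ext_vec v = (\<lambda>J. \<Sum>i<n. v i * ext_single {i} J)"
  proof
    fix J
    show "ext_vec v J = (\<Sum>i<n. v i * ext_single {i} J)"
      using assms by (cases "is_singleton J")
        (auto simp: ext_vec_not_singleton ext_single_def is_singleton_def not_less
          if_distrib[where f="\<lambda>x. _ * x"] cong: if_cong)
  qed
  then have "ext_map n A (ext_vec v) = (\<lambda>K. \<Sum>i<n. v i * ext_cols n A {i} K)"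
    by (simp only: ext_map_sum) (auto simp: ext_map_single fun_eq_iff intro!: sum.cong)
  also have "\<dots> = (\<lambda>K. \<Sum>i<n. v i * ext_col n A i K)"
  proof -
    have "ext_cols n A {i} K = ext_col n A i K" for i K
    proof (cases "finite K")
      case True
      have "wedge (ext_col n A i) ext_unit K = (\<Sum>k\<in>K. shuffle_sign {k} (K - {k}) * (if k < n then A k i else 0) * ext_unit (K - {k}))"
        using wedge_vec[OF True] by (simp add: ext_col_def)
      also have "\<dots> = ext_col n A i K"
      proof (cases "is_singleton K")
        case True
        then obtain j where "K = {j}" by (auto simp: is_singleton_def)
        then show ?thesis by (simp add: ext_unit_def ext_col_def shuffle_sign_def)
      next
        case False
        then have "K - {k} \<noteq> {}" if "k \<in> K" for k
          using that by (auto simp: is_singleton_def)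
        then have "(\<Sum>k\<in>K. shuffle_sign {k} (K - {k}) * (if k < n then A k i else 0) * ext_unit (K - {k})) = 0"
          by (intro sum.neutral) (auto simp: ext_unit_def)
        then show ?thesis using False by (simp add: ext_col_def ext_vec_not_singleton)
      qed
      finally show ?thesis by (simp add: ext_cols_def)
    next
      case False
      then show ?thesis
        by (auto simp: ext_cols_def wedge_infinite ext_col_def ext_vec_def is_singleton_def)
    qed
    then show ?thesis by simp
  qed
  also have "\<dots> = ext_vec (\<lambda>j. if j < n then \<Sum>i<n. A j i * v i else 0)"
    by (auto simp: fun_eq_iff ext_col_def ext_vec_def mult_ac)
  finally show ?thesis .
qed

definition ext_hom :: "nat \<Rightarrow> ext \<Rightarrow> ext" where
  "ext_hom r a I = (if card I = r then a I else 0)"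

text \<open>The image of a basis element keeps its degree, so the homogeneous components of a
  multivector field are compatible with changes of chart.\<close>

lemma ext_map_hom: "ext_map n A (ext_hom r a) = ext_hom r (ext_map n A a)"
proof
  fix K
  have "ext_hom r a I * ext_cols n A I K = (if card K = r then a I * ext_cols n A I K else 0)"
    if "I \<subseteq> {..<n}" for I
    using ext_cols_degree[of I n A] finite_subset[OF that] by (auto simp: ext_degree_def ext_hom_def)
  then show "ext_map n A (ext_hom r a) K = ext_hom r (ext_map n A a) K"
    by (auto simp: ext_map_cols ext_hom_def)
qed

section \<open>Charts\<close>

lemma tangent_spaceD:
  "v \<in> tangent_space M p \<Longrightarrow> c \<in> charts_at M p \<Longrightarrow> d \<in> charts_at M p \<Longrightarrow> j < mdim M \<Longrightarrow>
    v d j = (\<Sum>i<mdim M. jacobian M c d p j i * v c i)"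
  "v \<in> tangent_space M p \<Longrightarrow> \<not> (c \<in> charts_at M p \<and> i < mdim M) \<Longrightarrow> v c i = 0"
  unfolding tangent_space_def by blast+

locale smooth_mfd =
  fixes M :: "('a, 'c) manifold" and n :: nat
  assumes smooth_manifold: "smooth_manifold M"
  defines "n \<equiv> mdim M"
begin

lemma topspace_eq: "topspace (mtop M) = (\<Union>c\<in>mindex M. mdom M c)"
  using smooth_manifold by (simp add: smooth_manifold_def)

lemma mdom_open: "c \<in> mindex M \<Longrightarrow> openin (mtop M) (mdom M c)"
  and mimage_open: "c \<in> mindex M \<Longrightarrow> openin (Euclidean_space n) (mimage M c)"
  and chart_homeomorphic: "c \<in> mindex M \<Longrightarrow> homeomorphic_map (subtopology (mtop M) (mdom M c))
          (subtopology (Euclidean_space n) (mimage M c)) (mcoord M c)"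
  and transition_smooth: "c \<in> mindex M \<Longrightarrow> d \<in> mindex M \<Longrightarrow> i < n \<Longrightarrow>
        smooth_on n (mcoord M c ` (mdom M c \<inter> mdom M d)) (\<lambda>x. mcoord M d (mparam M c x) i)"
  using smooth_manifold by (auto simp: smooth_manifold_def n_def)

lemma mdom_topspace: "c \<in> mindex M \<Longrightarrow> mdom M c \<subseteq> topspace (mtop M)"
  using mdom_open openin_subset by blast

lemma mparam_mcoord: "c \<in> mindex M \<Longrightarrow> p \<in> mdom M c \<Longrightarrow> mparam M c (mcoord M c p) = p"
proof -
  assume c: "c \<in> mindex M" and p: "p \<in> mdom M c"
  have "inj_on (mcoord M c) (mdom M c)"
    using homeomorphic_imp_injective_map[OF chart_homeomorphic[OF c]] mdom_topspace[OF c]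
    by (simp add: Int_absorb1)
  then show ?thesis using p by (simp add: mparam_def)
qed

lemma open_mcoord_image:
  assumes c: "c \<in> mindex M" and "openin (mtop M) Q" "Q \<subseteq> mdom M c"
  shows "openin (Euclidean_space n) (mcoord M c ` Q)"
proof -
  have "openin (subtopology (mtop M) (mdom M c)) Q"
    using assms by (simp add: openin_open_subtopology mdom_open)
  then have "openin (subtopology (Euclidean_space n) (mimage M c)) (mcoord M c ` Q)"
    using homeomorphic_imp_open_map[OF chart_homeomorphic[OF c]] by (simp add: open_map_def)
  then show ?thesis using mimage_open[OF c] by (simp add: openin_open_subtopology)
qed

lemma open_mcoord_preimage:
  assumes c: "c \<in> mindex M" and W: "openin (Euclidean_space n) W"
  shows "openin (mtop M) {p \<in> mdom M c. mcoord M c p \<in> W}"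
proof -
  have "continuous_map (subtopology (mtop M) (mdom M c)) (subtopology (Euclidean_space n) (mimage M c)) (mcoord M c)"
    using homeomorphic_imp_continuous_map[OF chart_homeomorphic[OF c]] .
  then have "continuous_map (subtopology (mtop M) (mdom M c)) (Euclidean_space n) (mcoord M c)"
    by (simp add: continuous_map_in_subtopology)
  then have "openin (subtopology (mtop M) (mdom M c))
      {p \<in> topspace (subtopology (mtop M) (mdom M c)). mcoord M c p \<in> W}"
    using W by (rule openin_continuous_map_preimage)
  moreover have "topspace (subtopology (mtop M) (mdom M c)) = mdom M c"
    using mdom_topspace[OF c] by auto
  ultimately have "openin (subtopology (mtop M) (mdom M c)) {p \<in> mdom M c. mcoord M c p \<in> W}"
    by (simp only:)
  then show ?thesis using openin_open_subtopology[OF mdom_open[OF c]] by blast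
qed

end

lemma mcoord_mparam: "x \<in> mimage M c \<Longrightarrow> mcoord M c (mparam M c x) = x"
  and mparam_in_mdom: "x \<in> mimage M c \<Longrightarrow> mparam M c x \<in> mdom M c"
  by (auto simp: mimage_def mparam_def f_inv_into_f inv_into_into)

context smooth_mfd
begin

lemma mparam_in_mdom_image:
  "c \<in> mindex M \<Longrightarrow> Q \<subseteq> mdom M c \<Longrightarrow> x \<in> mcoord M c ` Q \<Longrightarrow> mparam M c x \<in> Q"
  using mparam_mcoord by auto

text \<open>The chain rule for a change of coordinates. Smoothness is asked on a neighbourhood
  \<open>Q\<close> of \<open>p\<close> only, because the rule is also applied to the coordinates of
  a third chart, which are smooth only on its domain.\<close>

lemma mpderiv_change:
  assumes c: "c \<in> charts_at M p" and d: "d \<in> charts_at M p" and i: "i < n"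
    and Q: "openin (mtop M) Q" "p \<in> Q" "Q \<subseteq> mdom M c"
    and f: "smooth_on n (mcoord M c ` Q) (\<lambda>x. f (mparam M c x))"
  shows "mpderiv M d i f p = (\<Sum>j<n. mpderiv M c j f p * jacobian M d c p j i)"
proof -
  have cd: "c \<in> mindex M" "d \<in> mindex M" "p \<in> mdom M c" "p \<in> mdom M d"
    using c d by (auto simp: charts_at_def)
  let ?U = "mcoord M d ` (Q \<inter> mdom M d)" and ?V = "mcoord M c ` Q"
  let ?g = "\<lambda>x. mcoord M c (mparam M d x)"
  have U: "openin (Euclidean_space n) ?U"
    by (rule open_mcoord_image) (use cd Q mdom_open in auto)
  have V: "openin (Euclidean_space n) ?V"
    by (rule open_mcoord_image) (use cd Q in auto)
  have pU: "mcoord M d p \<in> ?U" using Q cd by auto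
  have inQ: "mparam M d x \<in> Q" if "x \<in> ?U" for x
    using mparam_in_mdom_image[OF cd(2) _ that] by auto
  have W: "openin (Euclidean_space n) (mcoord M d ` (mdom M d \<inter> mdom M c))"
    by (rule open_mcoord_image) (use cd mdom_open in auto)
  have "mpderiv M d i f p = pderiv_coord i (\<lambda>x. f (mparam M c (?g x))) (mcoord M d p)"
    unfolding mpderiv_def
  proof (rule pderiv_coord_cong[OF U pU i])
    fix x assume "x \<in> ?U"
    then have "mparam M c (?g x) = mparam M d x"
      by (intro mparam_mcoord[OF cd(1)]) (use inQ Q in blast)
    then show "f (mparam M d x) = f (mparam M c (?g x))" by simp
  qed
  also have "\<dots> = (\<Sum>j<n. pderiv_coord j (\<lambda>x. f (mparam M c x)) (?g (mcoord M d p)) *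
      pderiv_coord i (\<lambda>x. ?g x j) (mcoord M d p))"
  proof (rule pderiv_coord_compose[OF U V _ _ f pU i])
    show "?g x \<in> ?V" if "x \<in> ?U" for x using inQ[OF that] by auto
    show "smooth_on n ?U (\<lambda>x. ?g x j)" if "j < n" for j
      by (rule smooth_on_subset[OF W U _ transition_smooth[OF cd(2,1) that]]) (use Q in auto)
  qed
  finally show ?thesis
    using mparam_mcoord[OF cd(2,4)] by (simp add: mpderiv_def jacobian_def)
qed

lemma smooth_fun_restrict:
  "smooth_fun M f \<Longrightarrow> c \<in> mindex M \<Longrightarrow> smooth_on n (mcoord M c ` mdom M c) (\<lambda>x. f (mparam M c x))"
  by (simp add: smooth_fun_def mimage_def n_def)

lemma jacobian_cocycle:
  assumes "c \<in> charts_at M p" "d \<in> charts_at M p" "e \<in> charts_at M p" "i < n" "j < n"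
  shows "jacobian M c e p j i = (\<Sum>l<n. jacobian M d e p j l * jacobian M c d p l i)"
  unfolding jacobian_def[of M _ e]
  by (rule mpderiv_change[of _ _ _ _ "mdom M d \<inter> mdom M e"])
    (use assms mdom_open transition_smooth in \<open>auto simp: charts_at_def\<close>)

lemma jacobian_self:
  assumes "c \<in> charts_at M p" "i < n"
  shows "jacobian M c c p j i = (if i = j then 1 else 0)"
proof -
  have c: "c \<in> mindex M" "p \<in> mdom M c" using assms by (auto simp: charts_at_def)
  have "jacobian M c c p j i = pderiv_coord i (\<lambda>x. x j) (mcoord M c p)"
    unfolding jacobian_def mpderiv_def
    by (rule pderiv_coord_cong[OF mimage_open[OF c(1)] _ assms(2)]) (use c in \<open>auto simp: mcoord_mparam\<close>, simp add: mimage_def)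
  also have "\<dots> = (if i = j then 1 else 0)"
    by (rule pderiv_coord_eqI) (auto intro!: derivative_eq_intros)
  finally show ?thesis .
qed

text \<open>Frees the pairing from the chart picked by \<open>SOME\<close>: partial derivatives of
  \<open>f\<close> and components of \<open>v\<close> transform by the same Jacobian matrix in
  opposite directions.\<close>

lemma diff_pairing_chart:
  assumes c: "c \<in> charts_at M p" and v: "v \<in> tangent_space M p" and f: "smooth_fun M f"
  shows "diff_pairing M f p v = (\<Sum>i<n. mpderiv M c i f p * v c i)"
proof -
  define d where "d = (SOME d. d \<in> charts_at M p)"
  have d: "d \<in> charts_at M p" unfolding d_def using c by (rule someI)
  have cc: "c \<in> mindex M" "p \<in> mdom M c" using c by (auto simp: charts_at_def)
  have "(\<Sum>i<n. mpderiv M d i f p * v d i) = (\<Sum>i<n. \<Sum>j<n. mpderiv M c j f p * jacobian M d c p j i * v d i)"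
    by (rule sum.cong[OF refl])
      (use mpderiv_change[OF c d _ mdom_open[OF cc(1)] cc(2) subset_refl smooth_fun_restrict[OF f cc(1)]]
        in \<open>simp add: sum_distrib_right\<close>)
  also have "\<dots> = (\<Sum>j<n. \<Sum>i<n. mpderiv M c j f p * jacobian M d c p j i * v d i)"
    by (rule sum.swap)
  also have "\<dots> = (\<Sum>j<n. mpderiv M c j f p * v c j)"
  proof (rule sum.cong[OF refl])
    fix j assume "j \<in> {..<n}"
    then have "v c j = (\<Sum>i<n. jacobian M d c p j i * v d i)"
      using tangent_spaceD(1)[OF v d c] unfolding n_def by blast
    then show "(\<Sum>i<n. mpderiv M c j f p * jacobian M d c p j i * v d i) = mpderiv M c j f p * v c j"
      by (simp add: sum_distrib_left mult_ac)
  qed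
  finally show ?thesis by (simp add: diff_pairing_def d_def n_def)
qed

text \<open>The components in \<open>c\<close> are propagated to the other charts by Jacobians, and
  the cocycle rule makes the family consistent. This yields surjectivity of the charts of the
  tangent bundle onto their expected images.\<close>

lemma tangent_vector_exists:
  assumes c: "c \<in> charts_at M p"
  shows "\<exists>v\<in>tangent_space M p. \<forall>i<n. v c i = w i"
proof
  define v where "v d j = (if d \<in> charts_at M p \<and> j < n then \<Sum>i<n. jacobian M c d p j i * w i else 0)" for d j
  show "v \<in> tangent_space M p"
    unfolding tangent_space_def n_def[symmetric]
  proof (intro CollectI conjI ballI allI impI)
    fix d e j assume de: "d \<in> charts_at M p" "e \<in> charts_at M p" "j < n"
    have "v e j = (\<Sum>i<n. \<Sum>l<n. jacobian M d e p j l * jacobian M c d p l i * w i)"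
      unfolding v_def using de jacobian_cocycle[OF c de(1,2) _ de(3)] by (simp add: sum_distrib_right)
    also have "\<dots> = (\<Sum>l<n. \<Sum>i<n. jacobian M d e p j l * jacobian M c d p l i * w i)"
      by (rule sum.swap)
    also have "\<dots> = (\<Sum>l<n. jacobian M d e p j l * v d l)"
      unfolding v_def using de by (simp add: sum_distrib_left mult_ac)
    finally show "v e j = (\<Sum>l<n. jacobian M d e p j l * v d l)" .
  qed (auto simp: v_def)
  show "\<forall>i<n. v c i = w i"
    using c by (auto simp: v_def jacobian_self if_distrib[where f="\<lambda>x. x * _"] cong: if_cong)
qed

section \<open>Extension by zero and bump functions on the manifold\<close>

lemma smooth_change_chart:
  assumes cd: "c \<in> mindex M" "d \<in> mindex M"
    and Q: "openin (mtop M) Q" "Q \<subseteq> mdom M c" "Q \<subseteq> mdom M d"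
    and f: "smooth_on n (mcoord M c ` Q) (\<lambda>x. f (mparam M c x))"
  shows "smooth_on n (mcoord M d ` Q) (\<lambda>x. f (mparam M d x))"
proof -
  let ?g = "\<lambda>x. mcoord M c (mparam M d x)"
  have U: "openin (Euclidean_space n) (mcoord M d ` Q)" and V: "openin (Euclidean_space n) (mcoord M c ` Q)"
    using open_mcoord_image cd Q by auto
  have W: "openin (Euclidean_space n) (mcoord M d ` (mdom M d \<inter> mdom M c))"
    by (rule open_mcoord_image) (use cd mdom_open in auto)
  have inQ: "mparam M d x \<in> Q" if "x \<in> mcoord M d ` Q" for x
    using mparam_in_mdom_image[OF cd(2) Q(3) that] .
  have "smooth_on n (mcoord M d ` Q) (\<lambda>x. f (mparam M c (?g x)))"
  proof (rule smooth_on_compose[OF U V _ _ f])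
    show "?g x \<in> mcoord M c ` Q" if "x \<in> mcoord M d ` Q" for x using inQ[OF that] by auto
    show "smooth_on n (mcoord M d ` Q) (\<lambda>x. ?g x j)" if "j < n" for j
      by (rule smooth_on_subset[OF W U _ transition_smooth[OF cd(2,1) that]]) (use Q in auto)
  qed
  then show ?thesis
  proof (rule smooth_on_cong[OF U, rotated])
    fix x assume "x \<in> mcoord M d ` Q"
    then have "mparam M c (?g x) = mparam M d x"
      by (intro mparam_mcoord[OF cd(1)]) (use inQ Q in blast)
    then show "f (mparam M c (?g x)) = f (mparam M d x)" by simp
  qed
qed

text \<open>The domain of \<open>d\<close> is covered by its overlap with \<open>c\<close>, where
  smoothness is assumed, and by the complement of \<open>K\<close>, where \<open>F\<close> is 0. The
  second set is open because \<open>K\<close> is closed, and the two form a cover because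
  \<open>K\<close> lies in the domain of \<open>c\<close>.\<close>

lemma smooth_extension_by_zero:
  assumes cd: "c \<in> mindex M" "d \<in> mindex M"
    and K: "closedin (mtop M) K" "K \<subseteq> mdom M c" and F0: "\<And>p. p \<notin> K \<Longrightarrow> F p = 0"
    and F: "smooth_on n (mcoord M c ` (mdom M c \<inter> mdom M d)) (\<lambda>x. F (mparam M c x))"
  shows "smooth_on n (mimage M d) (\<lambda>x. F (mparam M d x))"
proof (rule smooth_on_local[OF mimage_open[OF cd(2)]])
  fix x assume x: "x \<in> mimage M d"
  have p: "mparam M d x \<in> mdom M d" "x = mcoord M d (mparam M d x)"
    using x by (auto simp: mcoord_mparam mparam_in_mdom)
  have cdQ: "openin (mtop M) (mdom M c \<inter> mdom M d)" using cd mdom_open by auto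
  have KQ: "openin (mtop M) (mdom M d - K)" using mdom_open[OF cd(2)] K(1) by blast
  show "\<exists>V. openin (Euclidean_space n) V \<and> x \<in> V \<and> V \<subseteq> mimage M d \<and> smooth_on n V (\<lambda>x. F (mparam M d x))"
  proof (cases "mparam M d x \<in> mdom M c")
    case True
    let ?V = "mcoord M d ` (mdom M c \<inter> mdom M d)"
    have "smooth_on n ?V (\<lambda>x. F (mparam M d x))"
      by (rule smooth_change_chart[OF cd cdQ _ _ F]) auto
    moreover have "x \<in> ?V" using p True by auto
    ultimately show ?thesis using open_mcoord_image[OF cd(2) cdQ] by (intro exI[of _ ?V]) (auto simp: mimage_def)
  next
    case False
    let ?V = "mcoord M d ` (mdom M d - K)"
    have V: "openin (Euclidean_space n) ?V" using open_mcoord_image[OF cd(2) KQ] by auto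
    have "smooth_on n ?V (\<lambda>x. F (mparam M d x))"
      by (rule smooth_on_cong[OF V _ smooth_on_const[OF V, of 0]])
        (use F0 mparam_in_mdom_image[OF cd(2), of "mdom M d - K"] in auto)
    moreover have "x \<in> ?V" using p False K by auto
    ultimately show ?thesis using V by (intro exI[of _ ?V]) (auto simp: mimage_def)
  qed
qed

text \<open>A Euclidean bump function transported by the chart. It vanishes outside the preimage of
  a compact cube, and the Hausdorff property makes that preimage closed in the manifold, as
  extension by zero requires.\<close>

lemma bump_function:
  assumes c: "c \<in> charts_at M p" and U: "openin (mtop M) U" "p \<in> U"
  shows "\<exists>h V K. smooth_on n (mimage M c) (\<lambda>x. h (mparam M c x)) \<and>
    openin (mtop M) V \<and> p \<in> V \<and> V \<subseteq> mdom M c \<and> (\<forall>q\<in>V. h q = 1) \<and>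
    closedin (mtop M) K \<and> K \<subseteq> mdom M c \<inter> U \<and> (\<forall>q. q \<notin> K \<longrightarrow> h q = 0)"
proof -
  have cc: "c \<in> mindex M" "p \<in> mdom M c" using c by (auto simp: charts_at_def)
  let ?E = "topspace (Euclidean_space n)" and ?a = "mcoord M c p"
  let ?D = "mcoord M c ` (mdom M c \<inter> U)"
  have D: "openin (Euclidean_space n) ?D"
    by (rule open_mcoord_image) (use cc U mdom_open in auto)
  have aD: "?a \<in> ?D" using cc U by auto
  obtain r where r: "r > 0" "\<forall>y. in_box n r ?a y \<longrightarrow> y \<in> ?D"
    using openin_Euclidean_space_box[OF D aD] by (elim exE conjE)
  have aE: "?a \<in> ?E" using aD openin_subset[OF D] by auto
  obtain \<eta> W where \<eta>: "smooth_on n ?E \<eta>" and W: "openin (Euclidean_space n) W" "?a \<in> W"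
    and \<eta>1: "\<forall>y\<in>W. \<eta> y = 1" and "\<forall>y. (\<exists>i<n. \<bar>y i - ?a i\<bar> \<ge> r / 2) \<longrightarrow> \<eta> y = 0"
    using Euclidean_bump[OF aE half_gt_zero[OF r(1)]] by (elim exE conjE) (rule that)
  then have \<eta>0: "\<eta> y = 0" if "i < n" "\<bar>y i - ?a i\<bar> \<ge> r / 2" for y i using that by blast
  \<comment> \<open>A closed cube of half the radius, inside the open cube contained in
    \<open>?D\<close>. With the factors \<open>{0}\<close> from \<open>n\<close> on it is a product
    over all coordinates, hence compact by Tychonoff's theorem.\<close>
  define B where "B = (\<Pi>\<^sub>E i\<in>UNIV. if i < n then {?a i - r / 2..?a i + r / 2} else {0::real})"
  have B: "y \<in> B \<longleftrightarrow> (\<forall>i<n. \<bar>y i - ?a i\<bar> \<le> r / 2) \<and> (\<forall>i\<ge>n. y i = 0)" for y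
  proof -
    have "y i \<in> {?a i - r / 2..?a i + r / 2} \<longleftrightarrow> \<bar>y i - ?a i\<bar> \<le> r / 2" for i
      unfolding abs_le_iff atLeastAtMost_iff by linarith
    then have "y \<in> B \<longleftrightarrow> (\<forall>i. if i < n then \<bar>y i - ?a i\<bar> \<le> r / 2 else y i = 0)"
      unfolding B_def PiE_UNIV_domain Pi_iff by (simp cong: if_cong)
    then show ?thesis by (metis linorder_not_less)
  qed
  have BD: "B \<subseteq> ?D"
  proof
    fix y assume y: "y \<in> B"
    show "y \<in> ?D" by (rule r(2)[rule_format]) (use y B r(1) in fastforce)
  qed
  have "compactin (powertop_real UNIV) B"
    unfolding B_def by (subst compactin_PiE) auto
  then have "compactin (Euclidean_space n) B"
    unfolding Euclidean_space_def by (subst compactin_subtopology) (use B in auto)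
  then have cB: "compactin (subtopology (Euclidean_space n) (mimage M c)) B"
    using BD by (subst compactin_subtopology) (auto simp: mimage_def)
  obtain g where g: "homeomorphic_maps (subtopology (mtop M) (mdom M c))
          (subtopology (Euclidean_space n) (mimage M c)) (mcoord M c) g"
    using chart_homeomorphic[OF cc(1)] homeomorphic_map_maps by blast
  define K where "K = g ` B"
  have "compactin (subtopology (mtop M) (mdom M c)) K"
    unfolding K_def using g cB by (auto simp: homeomorphic_maps_def intro: image_compactin)
  then have "compactin (mtop M) K" by (simp add: compactin_subtopology)
  moreover have "Hausdorff_space (mtop M)" using smooth_manifold by (simp add: smooth_manifold_def)
  ultimately have Kc: "closedin (mtop M) K" using compactin_imp_closedin by blast
  have gc: "g (mcoord M c q) = q" if "q \<in> mdom M c" for q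
    using g that mdom_topspace[OF cc(1)] by (auto simp: homeomorphic_maps_def)
  have KU: "K \<subseteq> mdom M c \<inter> U"
    using BD gc by (auto simp: K_def)
  define h where "h q = (if q \<in> mdom M c then \<eta> (mcoord M c q) else 0)" for q
  define V where "V = {q \<in> mdom M c. mcoord M c q \<in> W}"
  have h0: "h q = 0" if "q \<notin> K" for q
  proof (cases "q \<in> mdom M c")
    case True
    then have "mcoord M c q \<notin> B" using that gc by (metis K_def imageI)
    moreover have "mcoord M c q i = 0" if "i \<ge> n" for i
      using openin_Euclidean_space_subset[OF mimage_open[OF cc(1)] _ that, of "mcoord M c q"] True by (auto simp: mimage_def)
    ultimately obtain i where "i < n" "\<bar>mcoord M c q i - ?a i\<bar> > r / 2" using B by force
    then show ?thesis using \<eta>0[of i "mcoord M c q"] by (simp add: h_def)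
  qed (simp add: h_def)
  have "smooth_on n (mimage M c) \<eta>"
    by (rule smooth_on_subset[OF _ mimage_open[OF cc(1)] _ \<eta>]) (use openin_subset[OF mimage_open[OF cc(1)]] in auto)
  then have "smooth_on n (mimage M c) (\<lambda>x. h (mparam M c x))"
    by (rule smooth_on_cong[OF mimage_open[OF cc(1)], rotated]) (auto simp: h_def mcoord_mparam mparam_in_mdom)
  moreover have "openin (mtop M) V" unfolding V_def by (rule open_mcoord_preimage[OF cc(1) W(1)])
  moreover have "p \<in> V" "V \<subseteq> mdom M c" "\<forall>q\<in>V. h q = 1" using cc W \<eta>1 by (auto simp: V_def h_def)
  ultimately show ?thesis using h0 Kc KU by blast
qed

end

section \<open>Multivector fields\<close>

lemma ext_tangentD:
  assumes "a \<in> ext_tangent_space M p"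
  shows "c \<in> charts_at M p \<Longrightarrow> d \<in> charts_at M p \<Longrightarrow> a d = ext_map (mdim M) (jacobian M c d p) (a c)"
    and "ext_supp (mdim M) (a c)"
    and "c \<notin> charts_at M p \<Longrightarrow> a c = (\<lambda>I. 0)"
  using assms unfolding ext_tangent_space_def ext_supp_def by blast+

lemma ext_tangentI:
  assumes "\<And>c d. c \<in> charts_at M p \<Longrightarrow> d \<in> charts_at M p \<Longrightarrow> a d = ext_map (mdim M) (jacobian M c d p) (a c)"
    and "\<And>c. ext_supp (mdim M) (a c)"
    and "\<And>c. c \<notin> charts_at M p \<Longrightarrow> a c = (\<lambda>I. 0)"
  shows "a \<in> ext_tangent_space M p"
proof -
  have "a c I = 0" if "\<not> (c \<in> charts_at M p \<and> I \<subseteq> {..<mdim M})" for c I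
    using that assms(2)[of c] assms(3)[of c] by (cases "c \<in> charts_at M p") (auto simp: ext_supp_def)
  then show ?thesis unfolding ext_tangent_space_def using assms(1) by blast
qed

lemma mvfieldsD:
  assumes "X \<in> mvfields M"
  shows "p \<in> topspace (mtop M) \<Longrightarrow> X p \<in> ext_tangent_space M p"
    and "p \<notin> topspace (mtop M) \<Longrightarrow> X p = (\<lambda>c I. 0)"
    and "c \<in> mindex M \<Longrightarrow> I \<subseteq> {..<mdim M} \<Longrightarrow> smooth_on (mdim M) (mimage M c) (\<lambda>x. X (mparam M c x) c I)"
  using assms unfolding mvfields_def by blast+

lemma mvfields_supp: "X \<in> mvfields M \<Longrightarrow> ext_supp (mdim M) (X p c)"
  by (cases "p \<in> topspace (mtop M)") (simp add: ext_tangentD(2)[OF mvfieldsD(1)], simp add: mvfieldsD(2) ext_supp_def)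

lemma mvfields_outside: "X \<in> mvfields M \<Longrightarrow> c \<notin> charts_at M p \<Longrightarrow> X p c = (\<lambda>I. 0)"
  by (cases "p \<in> topspace (mtop M)") (auto dest: mvfieldsD(1,2) ext_tangentD(3))

text \<open>The transformation rule recovers all components from those in one chart, so two fields
  may be compared in whichever chart is convenient.\<close>

lemma mvfields_eqI:
  assumes "X \<in> mvfields M" "Y \<in> mvfields M" "c \<in> charts_at M p" "X p c = Y p c"
  shows "X p = Y p"
proof (cases "p \<in> topspace (mtop M)")
  case True
  show ?thesis
  proof
    fix d show "X p d = Y p d"
    proof (cases "d \<in> charts_at M p")
      case d: True
      show ?thesis
        using ext_tangentD(1)[OF mvfieldsD(1)[OF assms(1) True] assms(3) d]
          ext_tangentD(1)[OF mvfieldsD(1)[OF assms(2) True] assms(3) d] assms(4) by simp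
    qed (simp add: mvfields_outside[OF assms(1)] mvfields_outside[OF assms(2)])
  qed
qed (simp add: mvfieldsD(2)[OF assms(1)] mvfieldsD(2)[OF assms(2)])

text \<open>Isolated as a condition so that the closure rules below serve the manifold and its
  tangent bundle alike.\<close>

definition open_charts :: "('a, 'c) manifold \<Rightarrow> bool" where
  "open_charts M \<longleftrightarrow> (\<forall>c\<in>mindex M. openin (Euclidean_space (mdim M)) (mimage M c))"

definition mv_zero :: "('a, 'c) mvf" where
  "mv_zero = (\<lambda>p c I. 0)"

definition mv_hom :: "nat \<Rightarrow> ('a, 'c) mvf \<Rightarrow> ('a, 'c) mvf" where
  "mv_hom r X = (\<lambda>p c. ext_hom r (X p c))"

section \<open>Closure of multivector fields under the algebraic operations\<close>

lemma mvfieldsI: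
  assumes "\<And>p c d. p \<in> topspace (mtop M) \<Longrightarrow> c \<in> charts_at M p \<Longrightarrow> d \<in> charts_at M p \<Longrightarrow>
      X p d = ext_map (mdim M) (jacobian M c d p) (X p c)"
    and "\<And>p c. ext_supp (mdim M) (X p c)"
    and "\<And>p c. p \<notin> topspace (mtop M) \<or> c \<notin> charts_at M p \<Longrightarrow> X p c = (\<lambda>I. 0)"
    and "\<And>c I. c \<in> mindex M \<Longrightarrow> I \<subseteq> {..<mdim M} \<Longrightarrow> smooth_on (mdim M) (mimage M c) (\<lambda>x. X (mparam M c x) c I)"
  shows "X \<in> mvfields M"
proof -
  have "X p \<in> ext_tangent_space M p" if "p \<in> topspace (mtop M)" for p
    by (rule ext_tangentI[OF assms(1)[OF that] assms(2) assms(3)[OF disjI2]])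
  moreover have "X p = (\<lambda>c I. 0)" if "p \<notin> topspace (mtop M)" for p
    by (rule ext) (rule assms(3)[OF disjI1[OF that]])
  ultimately show ?thesis using assms(4) unfolding mvfields_def by blast
qed

lemma mvfields_transform:
  "X \<in> mvfields M \<Longrightarrow> p \<in> topspace (mtop M) \<Longrightarrow> c \<in> charts_at M p \<Longrightarrow> d \<in> charts_at M p \<Longrightarrow>
    X p d = ext_map (mdim M) (jacobian M c d p) (X p c)"
  by (rule ext_tangentD(1)[OF mvfieldsD(1)])

lemma mvfields_vanish:
  "X \<in> mvfields M \<Longrightarrow> p \<notin> topspace (mtop M) \<or> c \<notin> charts_at M p \<Longrightarrow> X p c = (\<lambda>I. 0)"
  by (elim disjE) (simp_all add: mvfieldsD(2) mvfields_outside)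

lemma mvfields_zero: "open_charts M \<Longrightarrow> mv_zero \<in> mvfields M"
  by (rule mvfieldsI) (auto simp: mv_zero_def open_charts_def ext_supp_def intro: smooth_on_const)

lemma mvfields_add:
  assumes M: "open_charts M" and X: "X \<in> mvfields M" and Y: "Y \<in> mvfields M"
  shows "mv_add X Y \<in> mvfields M"
proof (rule mvfieldsI)
  show "mv_add X Y p d = ext_map (mdim M) (jacobian M c d p) (mv_add X Y p c)"
    if "p \<in> topspace (mtop M)" "c \<in> charts_at M p" "d \<in> charts_at M p" for p c d
    using mvfields_transform[OF X that] mvfields_transform[OF Y that] by (simp add: mv_add_def ext_map_add)
  show "ext_supp (mdim M) (mv_add X Y p c)" for p c
    using mvfields_supp[OF X, of p c] mvfields_supp[OF Y, of p c] by (simp add: ext_supp_def mv_add_def)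
  show "mv_add X Y p c = (\<lambda>I. 0)" if "p \<notin> topspace (mtop M) \<or> c \<notin> charts_at M p" for p c
    using mvfields_vanish[OF X that] mvfields_vanish[OF Y that] by (simp add: mv_add_def)
  show "smooth_on (mdim M) (mimage M c) (\<lambda>x. mv_add X Y (mparam M c x) c I)"
    if "c \<in> mindex M" "I \<subseteq> {..<mdim M}" for c I
    using M that mvfieldsD(3)[OF X that] mvfieldsD(3)[OF Y that]
    by (auto simp: mv_add_def open_charts_def intro!: smooth_on_add)
qed

lemma mvfields_scale:
  assumes M: "open_charts M" and X: "X \<in> mvfields M"
  shows "mv_scale t X \<in> mvfields M"
proof (rule mvfieldsI)
  show "mv_scale t X p d = ext_map (mdim M) (jacobian M c d p) (mv_scale t X p c)"
    if "p \<in> topspace (mtop M)" "c \<in> charts_at M p" "d \<in> charts_at M p" for p c d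
    using mvfields_transform[OF X that] by (simp add: mv_scale_def ext_map_scale)
  show "ext_supp (mdim M) (mv_scale t X p c)" for p c
    using mvfields_supp[OF X, of p c] by (simp add: ext_supp_def mv_scale_def)
  show "mv_scale t X p c = (\<lambda>I. 0)" if "p \<notin> topspace (mtop M) \<or> c \<notin> charts_at M p" for p c
    using mvfields_vanish[OF X that] by (simp add: mv_scale_def)
  show "smooth_on (mdim M) (mimage M c) (\<lambda>x. mv_scale t X (mparam M c x) c I)"
    if "c \<in> mindex M" "I \<subseteq> {..<mdim M}" for c I
    using M that mvfieldsD(3)[OF X that]
    by (auto simp: mv_scale_def open_charts_def intro!: smooth_on_mult smooth_on_const)
qed

lemma mvfields_wedge:
  assumes M: "open_charts M" and X: "X \<in> mvfields M" and Y: "Y \<in> mvfields M"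
  shows "mv_wedge X Y \<in> mvfields M"
proof (rule mvfieldsI)
  show "mv_wedge X Y p d = ext_map (mdim M) (jacobian M c d p) (mv_wedge X Y p c)"
    if "p \<in> topspace (mtop M)" "c \<in> charts_at M p" "d \<in> charts_at M p" for p c d
    using mvfields_transform[OF X that] mvfields_transform[OF Y that]
    by (simp add: mv_wedge_def ext_map_wedge mvfields_supp[OF X] mvfields_supp[OF Y])
  show "ext_supp (mdim M) (mv_wedge X Y p c)" for p c
    by (simp add: ext_supp_wedge mv_wedge_def mvfields_supp[OF X] mvfields_supp[OF Y])
  show "mv_wedge X Y p c = (\<lambda>I. 0)" if "p \<notin> topspace (mtop M) \<or> c \<notin> charts_at M p" for p c
    using mvfields_vanish[OF X that] by (simp add: mv_wedge_def)
  show "smooth_on (mdim M) (mimage M c) (\<lambda>x. mv_wedge X Y (mparam M c x) c I)"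
    if c: "c \<in> mindex M" and I: "I \<subseteq> {..<mdim M}" for c I
  proof -
    have U: "openin (Euclidean_space (mdim M)) (mimage M c)" using M c by (simp add: open_charts_def)
    show ?thesis
      unfolding mv_wedge_def wedge_def
      by (intro smooth_on_sum[OF U] smooth_on_mult[OF U] smooth_on_const[OF U] mvfieldsD(3)[OF X c]
          mvfieldsD(3)[OF Y c]) (use I in auto)
  qed
qed

lemma mvfields_hom:
  assumes M: "open_charts M" and X: "X \<in> mvfields M"
  shows "mv_hom r X \<in> mvfields M"
proof (rule mvfieldsI)
  show "mv_hom r X p d = ext_map (mdim M) (jacobian M c d p) (mv_hom r X p c)"
    if "p \<in> topspace (mtop M)" "c \<in> charts_at M p" "d \<in> charts_at M p" for p c d
    using mvfields_transform[OF X that] by (simp add: mv_hom_def ext_map_hom)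
  show "ext_supp (mdim M) (mv_hom r X p c)" for p c
    using mvfields_supp[OF X, of p c] by (simp add: ext_supp_def mv_hom_def ext_hom_def)
  show "mv_hom r X p c = (\<lambda>I. 0)" if "p \<notin> topspace (mtop M) \<or> c \<notin> charts_at M p" for p c
    using mvfields_vanish[OF X that] by (simp add: mv_hom_def ext_hom_def fun_eq_iff)
  show "smooth_on (mdim M) (mimage M c) (\<lambda>x. mv_hom r X (mparam M c x) c I)"
    if "c \<in> mindex M" "I \<subseteq> {..<mdim M}" for c I
    using M that mvfieldsD(3)[OF X that]
    by (cases "card I = r") (auto simp: mv_hom_def ext_hom_def open_charts_def intro!: smooth_on_const)
qed

lemma mvfields_degD: "X \<in> mvfields_deg M r \<Longrightarrow> X \<in> mvfields M"
  by (simp add: mvfields_deg_def)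

lemma mvfields_deg_zero: "open_charts M \<Longrightarrow> mv_zero \<in> mvfields_deg M r"
  using mvfields_zero by (auto simp: mvfields_deg_def mv_zero_def)

lemma mvfields_deg_cardD: "X \<in> mvfields_deg M r \<Longrightarrow> X p c I \<noteq> 0 \<Longrightarrow> int (card I) = r"
  by (simp add: mvfields_deg_def)

lemma mvfields_degI:
  "X \<in> mvfields M \<Longrightarrow> (\<And>p c I. X p c I \<noteq> 0 \<Longrightarrow> int (card I) = r) \<Longrightarrow> X \<in> mvfields_deg M r"
  by (simp add: mvfields_deg_def)

lemma mvfields_deg_add:
  assumes M: "open_charts M" and X: "X \<in> mvfields_deg M r" and Y: "Y \<in> mvfields_deg M r"
  shows "mv_add X Y \<in> mvfields_deg M r"
proof (rule mvfields_degI[OF mvfields_add[OF M mvfields_degD[OF X] mvfields_degD[OF Y]]])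
  fix p c I assume "mv_add X Y p c I \<noteq> 0"
  then have "X p c I \<noteq> 0 \<or> Y p c I \<noteq> 0" by (auto simp: mv_add_def)
  then show "int (card I) = r" using mvfields_deg_cardD[OF X] mvfields_deg_cardD[OF Y] by blast
qed

lemma mvfields_deg_scale:
  assumes M: "open_charts M" and X: "X \<in> mvfields_deg M r"
  shows "mv_scale t X \<in> mvfields_deg M r"
proof (rule mvfields_degI[OF mvfields_scale[OF M mvfields_degD[OF X]]])
  fix p c I assume "mv_scale t X p c I \<noteq> 0"
  then have "X p c I \<noteq> 0" by (auto simp: mv_scale_def)
  then show "int (card I) = r" using mvfields_deg_cardD[OF X] by blast
qed

lemma mvfields_deg_wedge:
  assumes "open_charts M" and X: "X \<in> mvfields_deg M r" and Y: "Y \<in> mvfields_deg M s"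
  shows "mv_wedge X Y \<in> mvfields_deg M (r + s)"
proof -
  have "int (card K) = r + s" if K: "mv_wedge X Y p c K \<noteq> 0" for p c K
  proof -
    have fin: "finite K" using K wedge_infinite by (auto simp: mv_wedge_def)
    obtain I where "I \<in> Pow K" "shuffle_sign I (K - I) * X p c I * Y p c (K - I) \<noteq> 0"
      using K unfolding mv_wedge_def wedge_def by (rule sum.not_neutral_contains_not_neutral)
    then have I: "I \<subseteq> K" "X p c I \<noteq> 0" "Y p c (K - I) \<noteq> 0" by auto
    then have "int (card I) = r" "int (card (K - I)) = s"
      using mvfields_deg_cardD[OF X] mvfields_deg_cardD[OF Y] by blast+
    moreover have "card K = card I + card (K - I)"
      using fin I by (metis card_Diff_subset card_mono finite_subset le_add_diff_inverse)
    ultimately show ?thesis by simp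
  qed
  then show ?thesis
    by (rule mvfields_degI[OF mvfields_wedge[OF assms(1) mvfields_degD[OF X] mvfields_degD[OF Y]]])
qed

lemma mvfields_deg_negative:
  assumes "X \<in> mvfields_deg M r" "r < 0"
  shows "X = mv_zero"
proof -
  have "X p c I = 0" for p c I
    using mvfields_deg_cardD[OF assms(1), of p c I] assms(2) by fastforce
  then show ?thesis by (simp add: mv_zero_def fun_eq_iff)
qed

text \<open>A field is a finite sum of homogeneous components, as degrees are bounded by the
  dimension. This gives access to the graded bracket rules, which are stated for arguments of
  definite degree.\<close>

lemma mvfields_hom_induct [consumes 2, case_names hom add]:
  assumes M: "open_charts M" and X: "X \<in> mvfields M"
    and hom: "\<And>r X. X \<in> mvfields_deg M (int r) \<Longrightarrow> P X"
    and add: "\<And>X Y. X \<in> mvfields M \<Longrightarrow> Y \<in> mvfields M \<Longrightarrow> P X \<Longrightarrow> P Y \<Longrightarrow> P (mv_add X Y)"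
  shows "P X"
proof -
  \<comment> \<open>Partial sums of the homogeneous components, written as truncations to degrees
    below \<open>k\<close>.\<close>
  define S where "S k = (\<lambda>p c I. if card I < k then X p c I else 0)" for k
  have H: "mv_hom k X \<in> mvfields_deg M (int k)" for k
    using mvfields_hom[OF M X] by (auto simp: mvfields_deg_def mv_hom_def ext_hom_def split: if_splits)
  have "S k \<in> mvfields M \<and> P (S k)" for k
  proof (induction k)
    case 0
    have "S 0 = mv_zero" by (simp add: S_def mv_zero_def)
    then show ?case using mvfields_zero[OF M] hom[OF mvfields_deg_zero[OF M]] by simp
  next
    case (Suc k)
    have "S (Suc k) = mv_add (S k) (mv_hom k X)"
      by (auto simp: S_def mv_add_def mv_hom_def ext_hom_def fun_eq_iff less_Suc_eq)
    then show ?case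
      using Suc hom[OF H[of k]] add mvfields_add[OF M] mvfields_degD[OF H[of k]] by simp
  qed
  then have "P (S (Suc (mdim M)))" by blast
  moreover have "S (Suc (mdim M)) = X"
  proof (intro ext)
    fix p c I
    show "S (Suc (mdim M)) p c I = X p c I"
    proof (cases "I \<subseteq> {..<mdim M}")
      case True
      then have "card I \<le> mdim M" using card_mono[of "{..<mdim M}" I] by simp
      then show ?thesis by (simp add: S_def)
    next
      case False
      then show ?thesis using mvfields_supp[OF X, of p c] by (simp add: ext_supp_def S_def)
    qed
  qed
  ultimately show ?thesis by (simp only:)
qed

text \<open>For use on the tangent bundle, where a lifted function is at first known only as a
  multivector field of degree 0.\<close>

lemma smooth_fun_if_mvfields:
  assumes M: "open_charts M" and f: "mv_fun M f \<in> mvfields M"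
  shows "smooth_fun M f"
  unfolding smooth_fun_def
proof
  fix c assume c: "c \<in> mindex M"
  show "smooth_on (mdim M) (mimage M c) (\<lambda>x. f (mparam M c x))"
    by (rule smooth_on_cong[OF _ _ mvfieldsD(3)[OF f c, of "{}"]])
      (use M c in \<open>auto simp: open_charts_def mv_fun_def charts_at_def mparam_in_mdom\<close>)
qed

lemma ext_tangent_vec_iff:
  "(\<lambda>c. ext_vec (v c)) \<in> ext_tangent_space M p \<longleftrightarrow> v \<in> tangent_space M p"
proof
  assume a: "(\<lambda>c. ext_vec (v c)) \<in> ext_tangent_space M p"
  have v0: "v c i = 0" if "\<not> (c \<in> charts_at M p \<and> i < mdim M)" for c i
  proof (cases "c \<in> charts_at M p")
    case True
    then have "\<not> {i} \<subseteq> {..<mdim M}" using that by auto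
    then have "ext_vec (v c) {i} = 0" using ext_tangentD(2)[OF a, of c] unfolding ext_supp_def by blast
    then show ?thesis by simp
  next
    case False
    then show ?thesis using fun_cong[OF ext_tangentD(3)[OF a False], of "{i}"] by simp
  qed
  have "v d j = (\<Sum>i<mdim M. jacobian M c d p j i * v c i)"
    if "c \<in> charts_at M p" "d \<in> charts_at M p" "j < mdim M" for c d j
  proof -
    have "ext_vec (v d) {j} = ext_map (mdim M) (jacobian M c d p) (ext_vec (v c)) {j}"
      using ext_tangentD(1)[OF a that(1,2)] by simp
    moreover have "\<And>i. i \<ge> mdim M \<Longrightarrow> v c i = 0" using v0 by auto
    ultimately show ?thesis using that(3) by (simp add: ext_map_vec)
  qed
  then show "v \<in> tangent_space M p" unfolding tangent_space_def using v0 by blast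
next
  assume v: "v \<in> tangent_space M p"
  note v1 = tangent_spaceD(1)[OF v] and v0 = tangent_spaceD(2)[OF v]
  show "(\<lambda>c. ext_vec (v c)) \<in> ext_tangent_space M p"
  proof (rule ext_tangentI)
    fix c d assume cd: "c \<in> charts_at M p" "d \<in> charts_at M p"
    have "v d = (\<lambda>j. if j < mdim M then \<Sum>i<mdim M. jacobian M c d p j i * v c i else 0)"
      using v1[OF cd] v0[of d] by (intro ext) simp
    moreover have "\<And>i. i \<ge> mdim M \<Longrightarrow> v c i = 0" using v0 by auto
    ultimately show "ext_vec (v d) = ext_map (mdim M) (jacobian M c d p) (ext_vec (v c))"
      by (simp only: ext_map_vec)
  next
    show "ext_supp (mdim M) (ext_vec (v c))" for c by (rule ext_supp_vec) (use v0 in auto)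
    show "ext_vec (v c) = (\<lambda>I. 0)" if "c \<notin> charts_at M p" for c
      using v0[of c] that by (auto simp: ext_vec_def)
  qed
qed

lemma vector_field_iff_mvfields:
  assumes M: "open_charts M"
  shows "vector_field M Y \<longleftrightarrow> mv_vec Y \<in> mvfields M"
proof
  assume Y: "vector_field M Y"
  show "mv_vec Y \<in> mvfields M"
    unfolding mvfields_def
  proof (intro CollectI conjI ballI allI impI)
    fix p assume "p \<in> topspace (mtop M)"
    then show "mv_vec Y p \<in> ext_tangent_space M p"
      using Y by (simp add: mv_vec_def ext_tangent_vec_iff vector_field_def)
  next
    fix p assume "p \<notin> topspace (mtop M)"
    then show "mv_vec Y p = (\<lambda>c I. 0)"
      using Y by (simp add: mv_vec_def ext_vec_def vector_field_def fun_eq_iff)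
  next
    fix c I assume c: "c \<in> mindex M" and I: "I \<subseteq> {..<mdim M}"
    have U: "openin (Euclidean_space (mdim M)) (mimage M c)" using M c by (simp add: open_charts_def)
    show "smooth_on (mdim M) (mimage M c) (\<lambda>x. mv_vec Y (mparam M c x) c I)"
    proof (cases "is_singleton I")
      case True
      then obtain i where "I = {i}" by (auto simp: is_singleton_def)
      then show ?thesis using Y c I by (simp add: mv_vec_def vector_field_def)
    qed (simp add: mv_vec_def ext_vec_not_singleton smooth_on_const[OF U])
  qed
next
  assume Y: "mv_vec Y \<in> mvfields M"
  show "vector_field M Y"
    unfolding vector_field_def
  proof (intro conjI ballI allI impI)
    fix p assume "p \<in> topspace (mtop M)"
    then show "Y p \<in> tangent_space M p"
      using mvfieldsD(1)[OF Y] by (simp add: mv_vec_def ext_tangent_vec_iff)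
  next
    fix p assume "p \<notin> topspace (mtop M)"
    then have "mv_vec Y p c {i} = 0" for c i using mvfieldsD(2)[OF Y] by simp
    then show "Y p = (\<lambda>c i. 0)" by (simp add: mv_vec_def fun_eq_iff)
  next
    fix c i assume "c \<in> mindex M" "i < mdim M"
    then show "smooth_on (mdim M) (mimage M c) (\<lambda>x. Y (mparam M c x) c i)"
      using mvfieldsD(3)[OF Y, of c "{i}"] by (simp add: mv_vec_def)
  qed
qed

lemma mv_vec_deg:
  assumes "open_charts M" "vector_field M Y"
  shows "mv_vec Y \<in> mvfields_deg M 1"
  using assms vector_field_iff_mvfields
  by (auto simp: mvfields_deg_def mv_vec_def ext_vec_def is_singleton_def split: if_splits)

lemma mv_fun_deg:
  assumes "mv_fun M f \<in> mvfields M"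
  shows "mv_fun M f \<in> mvfields_deg M 0"
  using assms by (auto simp: mvfields_deg_def mv_fun_def split: if_splits)

text \<open>Membership of \<open>X\<close> settles the boundary cases: \<open>wedge\<close> is 0 on
  infinite index sets and \<open>mv_fun\<close> is 0 outside the charts around \<open>p\<close>, and
  there \<open>X\<close> is 0 as well.\<close>

lemma mv_wedge_fun:
  assumes "X \<in> mvfields M"
  shows "mv_wedge (mv_fun M f) X = (\<lambda>p c I. f p * X p c I)"
proof (intro ext)
  fix p c K
  show "mv_wedge (mv_fun M f) X p c K = f p * X p c K"
  proof (cases "finite K")
    case True
    have "mv_wedge (mv_fun M f) X p c K = mv_fun M f p c {} * X p c K"
      unfolding mv_wedge_def by (rule wedge_scalar) (use True in \<open>auto simp: mv_fun_def\<close>)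
    then show ?thesis using mvfields_outside[OF assms, of c p] by (auto simp: mv_fun_def)
  next
    case False
    then show ?thesis using ext_supp_finite[OF mvfields_supp[OF assms]] by (simp add: mv_wedge_def wedge_infinite)
  qed
qed

context smooth_mfd
begin

lemma open_charts: "open_charts M"
  using mimage_open by (simp add: open_charts_def n_def)

lemma charts_at_outside: "p \<notin> topspace (mtop M) \<Longrightarrow> charts_at M p = {}"
  using mdom_topspace by (auto simp: charts_at_def)

lemma charts_at_nonempty: "p \<in> topspace (mtop M) \<Longrightarrow> \<exists>c. c \<in> charts_at M p"
  by (auto simp: topspace_eq charts_at_def)

lemma mv_fun_mvfields:
  assumes f: "smooth_fun M f"
  shows "mv_fun M f \<in> mvfields M"
  unfolding mvfields_def
proof (intro CollectI conjI ballI allI impI)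
  fix p assume "p \<in> topspace (mtop M)"
  show "mv_fun M f p \<in> ext_tangent_space M p"
  proof (rule ext_tangentI)
    fix c d assume cd: "c \<in> charts_at M p" "d \<in> charts_at M p"
    have "mv_fun M f p c = (\<lambda>I. f p * ext_single {} I)" "mv_fun M f p d = (\<lambda>I. f p * ext_unit I)"
      using cd by (auto simp: mv_fun_def ext_single_def ext_unit_def)
    moreover have "ext_cols (mdim M) A {} = ext_unit" for A by (simp add: ext_cols_def)
    ultimately show "mv_fun M f p d = ext_map (mdim M) (jacobian M c d p) (mv_fun M f p c)"
      by (simp add: ext_map_scale ext_map_single)
  qed (auto simp: ext_supp_def mv_fun_def)
next
  fix p assume "p \<notin> topspace (mtop M)"
  then show "mv_fun M f p = (\<lambda>c I. 0)" by (simp add: mv_fun_def charts_at_outside)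
next
  fix c I assume c: "c \<in> mindex M" and I: "I \<subseteq> {..<mdim M}"
  note U = mimage_open[OF c, unfolded n_def]
  show "smooth_on (mdim M) (mimage M c) (\<lambda>x. mv_fun M f (mparam M c x) c I)"
  proof (cases "I = {}")
    case True
    show ?thesis
      by (rule smooth_on_cong[OF U, of "\<lambda>x. f (mparam M c x)"])
        (use f c True in \<open>auto simp: smooth_fun_def mv_fun_def charts_at_def mparam_in_mdom\<close>)
  qed (simp add: mv_fun_def smooth_on_const[OF U])
qed

end

section \<open>Local generation by functions and vector fields\<close>

text \<open>Finite sums of products of global vector fields with a global function as last factor:
  the fields that the product rules of the lifts can reach. The index records the degree, which the
  graded rules require.\<close>

inductive mv_gen :: "('a, 'c) manifold \<Rightarrow> nat \<Rightarrow> ('a, 'c) mvf \<Rightarrow> bool" for M where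
  mv_gen_zero: "mv_gen M r mv_zero"
| mv_gen_fun: "smooth_fun M f \<Longrightarrow> mv_gen M 0 (mv_fun M f)"
| mv_gen_vec: "vector_field M Y \<Longrightarrow> mv_gen M r X \<Longrightarrow> mv_gen M (Suc r) (mv_wedge (mv_vec Y) X)"
| mv_gen_add: "mv_gen M r X \<Longrightarrow> mv_gen M r Y \<Longrightarrow> mv_gen M r (mv_add X Y)"

context smooth_mfd
begin

lemma mv_gen_deg: "mv_gen M r X \<Longrightarrow> X \<in> mvfields_deg M (int r)"
proof (induction rule: mv_gen.induct)
  case (mv_gen_zero r)
  then show ?case by (rule mvfields_deg_zero[OF open_charts])
next
  case (mv_gen_fun f)
  then show ?case using mv_fun_deg[OF mv_fun_mvfields] by simp
next
  case (mv_gen_vec Y r X)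
  then show ?case
    using mvfields_deg_wedge[OF open_charts mv_vec_deg[OF open_charts mv_gen_vec(1)] mv_gen_vec(3)] by simp
next
  case (mv_gen_add r X Y)
  then show ?case using mvfields_deg_add[OF open_charts] by blast
qed

text \<open>The \<open>i\<close>-th coordinate field of the chart \<open>c\<close>, multiplied by
  \<open>h\<close> and set to 0 outside the chart. Its components in \<open>d\<close> form a column
  of the Jacobian matrix.\<close>

definition frame_field :: "'c \<Rightarrow> ('a \<Rightarrow> real) \<Rightarrow> nat \<Rightarrow> 'a \<Rightarrow> 'c \<Rightarrow> nat \<Rightarrow> real" where
  "frame_field c h i q d j =
     (if q \<in> mdom M c \<and> d \<in> charts_at M q \<and> j < n then h q * jacobian M c d q j i else 0)"

lemma overlap_open: "c \<in> mindex M \<Longrightarrow> d \<in> mindex M \<Longrightarrow>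
    openin (Euclidean_space n) (mcoord M c ` (mdom M c \<inter> mdom M d))"
  by (rule open_mcoord_image) (auto simp: mdom_open openin_Int)

lemma smooth_restrict_overlap:
  assumes cd: "c \<in> mindex M" "d \<in> mindex M" and f: "smooth_on n (mimage M c) f"
  shows "smooth_on n (mcoord M c ` (mdom M c \<inter> mdom M d)) f"
  by (rule smooth_on_subset[OF mimage_open[OF cd(1)] overlap_open[OF cd] _ f]) (auto simp: mimage_def)

lemma smooth_fun_extension:
  assumes c: "c \<in> mindex M" and K: "closedin (mtop M) K" "K \<subseteq> mdom M c"
    and f: "smooth_on n (mimage M c) (\<lambda>x. f (mparam M c x))" and f0: "\<And>q. q \<notin> K \<Longrightarrow> f q = 0"
  shows "smooth_fun M f"
  unfolding smooth_fun_def n_def[symmetric]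
  using smooth_extension_by_zero[OF c _ K f0 smooth_restrict_overlap[OF c _ f]] by blast

lemma frame_vector_field:
  assumes c: "c \<in> mindex M" and i: "i < n" and h: "smooth_on n (mimage M c) (\<lambda>x. h (mparam M c x))"
    and K: "closedin (mtop M) K" "K \<subseteq> mdom M c" and h0: "\<And>q. q \<notin> K \<Longrightarrow> h q = 0"
  shows "vector_field M (frame_field c h i)"
  unfolding vector_field_def n_def[symmetric]
proof (intro conjI ballI allI impI)
  fix q
  show "frame_field c h i q \<in> tangent_space M q"
    unfolding tangent_space_def n_def[symmetric]
  proof (intro CollectI conjI ballI allI impI)
    fix d e j assume de: "d \<in> charts_at M q" "e \<in> charts_at M q" "j < n"
    show "frame_field c h i q e j = (\<Sum>l<n. jacobian M d e q j l * frame_field c h i q d l)"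
    proof (cases "q \<in> mdom M c")
      case True
      then have "c \<in> charts_at M q" using c by (simp add: charts_at_def)
      then show ?thesis
        using de True jacobian_cocycle[of c q d e i j] i by (simp add: frame_field_def sum_distrib_left mult_ac)
    qed (simp add: frame_field_def)
  qed (auto simp: frame_field_def)
next
  fix q assume "q \<notin> topspace (mtop M)"
  then show "frame_field c h i q = (\<lambda>d j. 0)"
    by (simp add: frame_field_def charts_at_outside fun_eq_iff)
next
  fix d j assume d: "d \<in> mindex M" and j: "j < n"
  \<comment> \<open>The component in the chart \<open>d\<close> has a meaning over the overlap only;
    made into a function on the whole manifold, it becomes accessible to extension by zero.\<close>
  define F where "F q = (if q \<in> mdom M c \<and> q \<in> mdom M d then h q * jacobian M c d q j i else 0)" for q
  let ?V = "mcoord M c ` (mdom M c \<inter> mdom M d)"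
  note V = overlap_open[OF c d]
  have "smooth_on n ?V (\<lambda>x. h (mparam M c x) * pderiv_coord i (\<lambda>x. mcoord M d (mparam M c x) j) x)"
    by (intro smooth_on_mult[OF V] smooth_restrict_overlap[OF c d h] smooth_onD(3)[OF V transition_smooth[OF c d j] i])
  then have "smooth_on n ?V (\<lambda>x. F (mparam M c x))"
  proof (rule smooth_on_cong[OF V, rotated])
    fix x assume x: "x \<in> ?V"
    then have "mcoord M c (mparam M c x) = x" by (intro mcoord_mparam) (auto simp: mimage_def)
    moreover have "mparam M c x \<in> mdom M c \<inter> mdom M d"
      by (rule mparam_in_mdom_image[OF c _ x]) simp
    ultimately show "h (mparam M c x) * pderiv_coord i (\<lambda>x. mcoord M d (mparam M c x) j) x = F (mparam M c x)"
      by (simp add: F_def jacobian_def mpderiv_def)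
  qed
  then have "smooth_on n (mimage M d) (\<lambda>x. F (mparam M d x))"
    by (rule smooth_extension_by_zero[OF c d K, rotated]) (simp add: F_def h0)
  then show "smooth_on n (mimage M d) (\<lambda>x. frame_field c h i (mparam M d x) d j)"
    by (rule smooth_on_cong[OF mimage_open[OF d], rotated])
      (use d j in \<open>auto simp: F_def frame_field_def charts_at_def mparam_in_mdom\<close>)
qed

text \<open>On \<open>V\<close> the cut-off coordinate fields are the coordinate basis of
  \<open>c\<close>. Indices are inserted in decreasing order, so that no product with a further
  field produces a sign.\<close>

lemma mv_gen_single:
  assumes V: "\<And>q. q \<in> V \<Longrightarrow> c \<in> charts_at M q \<and> h q = 1" 
    and e: "\<And>i. i < n \<Longrightarrow> vector_field M (frame_field c h i)" and f: "smooth_fun M f"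
    and "finite I"
  shows "I \<subseteq> {..<n} \<Longrightarrow> \<exists>Z. mv_gen M (card I) Z \<and> (\<forall>q\<in>V. Z q c = (\<lambda>J. f q * ext_single I J))"
  using \<open>finite I\<close>
proof (induction I rule: finite_linorder_min_induct)
  case empty
  have "\<forall>q\<in>V. mv_fun M f q c = (\<lambda>J. f q * ext_single {} J)"
    using V by (auto simp: mv_fun_def ext_single_def)
  then show ?case using mv_gen_fun[OF f] by auto
next
  case (insert i I)
  then obtain Z where Z: "mv_gen M (card I) Z" "\<forall>q\<in>V. Z q c = (\<lambda>J. f q * ext_single I J)" by auto
  have i: "i < n" using insert.prems by simp
  have "i \<notin> I" using insert.hyps by auto
  then have gen: "mv_gen M (card (insert i I)) (mv_wedge (mv_vec (frame_field c h i)) Z)"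
    using mv_gen_vec[OF e[OF i] Z(1)] insert.hyps(1) by simp
  have "mv_wedge (mv_vec (frame_field c h i)) Z q c = (\<lambda>J. f q * ext_single (insert i I) J)" if q: "q \<in> V" for q
  proof -
    have "frame_field c h i q c = basis_vec i"
      using V[OF q] i by (auto simp: frame_field_def basis_vec_def fun_eq_iff jacobian_self charts_at_def)
    then show ?thesis
      using Z(2) q insert.hyps
      by (simp add: mv_wedge_def mv_vec_def wedge_scale_right wedge_basis_vec_single_min)
  qed
  then show ?case using gen by blast
qed

lemma bump_at:
  assumes p: "p \<in> topspace (mtop M)"
  obtains c h V K where "c \<in> charts_at M p" "smooth_on n (mimage M c) (\<lambda>x. h (mparam M c x))"
    "openin (mtop M) V" "p \<in> V" "V \<subseteq> mdom M c" "\<And>q. q \<in> V \<Longrightarrow> h q = 1"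
    "closedin (mtop M) K" "K \<subseteq> mdom M c" "\<And>q. q \<notin> K \<Longrightarrow> h q = 0"
proof -
  obtain c where c: "c \<in> charts_at M p" using charts_at_nonempty[OF p] by blast
  show ?thesis using bump_function[OF c openin_topspace p] that[OF c] by auto
qed

text \<open>Near \<open>p\<close> the field is the sum of its coefficients times products of
  coordinate fields. Multiplying both the coefficients and the coordinate fields by a bump function
  \<open>h\<close> makes them global without a change on \<open>V\<close>, where \<open>h\<close> is
  1.\<close>

lemma mvfields_deg_locally_gen:
  assumes X: "X \<in> mvfields_deg M (int m)" and p: "p \<in> topspace (mtop M)"
  shows "\<exists>Z V. mv_gen M m Z \<and> openin (mtop M) V \<and> p \<in> V \<and> (\<forall>q\<in>V. Z q = X q)"
proof -
  obtain c h V K where c: "c \<in> charts_at M p" and h: "smooth_on n (mimage M c) (\<lambda>x. h (mparam M c x))"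
    and V: "openin (mtop M) V" "p \<in> V" "V \<subseteq> mdom M c" "\<And>q. q \<in> V \<Longrightarrow> h q = 1"
    and K: "closedin (mtop M) K" "K \<subseteq> mdom M c" and h0: "\<And>q. q \<notin> K \<Longrightarrow> h q = 0"
    using bump_at[OF p] by blast
  have cc: "c \<in> mindex M" using c by (auto simp: charts_at_def)
  have Vc: "c \<in> charts_at M q \<and> h q = 1" if "q \<in> V" for q
    using that V cc by (auto simp: charts_at_def)
  note e = frame_vector_field[OF cc _ h K h0]
  have X': "X \<in> mvfields M" by (rule mvfields_degD[OF X])
  define f where "f I q = h q * X q c I" for I q
  have f: "smooth_fun M (f I)" if "I \<subseteq> {..<n}" for I
  proof (rule smooth_fun_extension[OF cc K])
    show "smooth_on n (mimage M c) (\<lambda>x. f I (mparam M c x))"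
      unfolding f_def by (rule smooth_on_mult[OF mimage_open[OF cc] h])
        (use mvfieldsD(3)[OF X' cc] that in \<open>simp add: n_def\<close>)
  qed (simp add: f_def h0)
  let ?\<I> = "{I. I \<subseteq> {..<n} \<and> card I = m}"
  have fin: "finite ?\<I>" by simp
  have "\<exists>Z. mv_gen M m Z \<and> (\<forall>q\<in>V. Z q c = (\<lambda>J. \<Sum>I\<in>\<J>. X q c I * ext_single I J))" if "\<J> \<subseteq> ?\<I>" for \<J>
    using finite_subset[OF that fin] that
  proof (induction \<J>)
    case empty
    have "\<forall>q\<in>V. mv_zero q c = (\<lambda>J. \<Sum>I\<in>{}. X q c I * ext_single I J)"
      by (simp add: mv_zero_def)
    then show ?case using mv_gen_zero by blast
  next
    case (insert I \<J>)
    then obtain Z where Z: "mv_gen M m Z" "\<forall>q\<in>V. Z q c = (\<lambda>J. \<Sum>I\<in>\<J>. X q c I * ext_single I J)" by auto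
    have I: "I \<subseteq> {..<n}" "card I = m" using insert.prems by auto
    obtain Y where Y: "mv_gen M m Y" "\<forall>q\<in>V. Y q c = (\<lambda>J. f I q * ext_single I J)"
      using mv_gen_single[OF Vc e f[OF I(1)] finite_subset[OF I(1)] I(1)] I(2) by auto
    have "mv_add Y Z q c = (\<lambda>J. \<Sum>I\<in>insert I \<J>. X q c I * ext_single I J)" if "q \<in> V" for q
      using that Y(2) Z(2) insert.hyps V(4)[OF that] by (simp add: mv_add_def f_def)
    then show ?case using mv_gen_add[OF Y(1) Z(1)] by blast
  qed
  from this[OF subset_refl] obtain Z where Z: "mv_gen M m Z"
    "\<forall>q\<in>V. Z q c = (\<lambda>J. \<Sum>I\<in>?\<I>. X q c I * ext_single I J)" by blast
  have "Z q = X q" if q: "q \<in> V" for q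
  proof (rule mvfields_eqI[OF mvfields_degD[OF mv_gen_deg[OF Z(1)]] X'])
    show "c \<in> charts_at M q" using Vc[OF q] by simp
    have "(\<Sum>I\<in>?\<I>. X q c I * ext_single I J) = X q c J" for J
    proof -
      have "(\<Sum>I\<in>?\<I>. X q c I * ext_single I J) = (\<Sum>I\<in>?\<I>. if I = J then X q c J else 0)"
        by (rule sum.cong) (auto simp: ext_single_def)
      also have "\<dots> = (if J \<in> ?\<I> then X q c J else 0)" using fin by simp
      also have "\<dots> = X q c J"
      proof -
        have "J \<subseteq> {..<n}" if "X q c J \<noteq> 0"
          using mvfields_supp[OF X', of q c] that unfolding ext_supp_def n_def by blast
        moreover have "card J = m" if "X q c J \<noteq> 0" using mvfields_deg_cardD[OF X that] by simp
        ultimately show ?thesis by auto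
      qed
      finally show ?thesis .
    qed
    then show "Z q c = X q c" using Z(2) q by auto
  qed
  then show ?thesis using Z(1) V by blast
qed

text \<open>The complement \<open>1 - h\<close> of a bump function. Multiplication by
  \<open>k\<close> fixes every field that vanishes on \<open>U\<close>, while \<open>k\<close>
  itself vanishes at \<open>p\<close>; the locality arguments rest on this pair of
  properties.\<close>

lemma cutoff_function:
  assumes U: "openin (mtop M) U" "p \<in> U"
  shows "\<exists>k. smooth_fun M k \<and> k p = 0 \<and> (\<forall>q. q \<notin> U \<longrightarrow> k q = 1)"
proof -
  have p: "p \<in> topspace (mtop M)" using U openin_subset by blast
  obtain c where c: "c \<in> charts_at M p" using charts_at_nonempty[OF p] by blast
  then have cc: "c \<in> mindex M" by (simp add: charts_at_def)
  obtain h V K where h: "smooth_on n (mimage M c) (\<lambda>x. h (mparam M c x))" "p \<in> V" "\<forall>q\<in>V. h q = 1"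
    and K: "closedin (mtop M) K" "K \<subseteq> mdom M c \<inter> U" and h0: "\<forall>q. q \<notin> K \<longrightarrow> h q = 0"
    using bump_function[OF c U] by blast
  have "smooth_fun M h" by (rule smooth_fun_extension[OF cc K(1) _ h(1)]) (use K h0 in auto)
  then have "smooth_fun M (\<lambda>q. 1 + (-1) * h q)"
    unfolding smooth_fun_def n_def[symmetric]
    by (intro ballI smooth_on_add[OF mimage_open] smooth_on_mult[OF mimage_open] smooth_on_const[OF mimage_open]) auto
  moreover have "1 + (-1) * h p = 0" "\<forall>q. q \<notin> U \<longrightarrow> 1 + (-1) * h q = 1" using h h0 K by auto
  ultimately show ?thesis by blast
qed

text \<open>A coordinate times a bump function: a global function whose differential at
  \<open>p\<close> is that of the coordinate, for testing vector fields.\<close>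

lemma coordinate_function:
  assumes c: "c \<in> charts_at M p"
  shows "\<exists>f V. smooth_fun M f \<and> openin (mtop M) V \<and> p \<in> V \<and> V \<subseteq> mdom M c \<and> (\<forall>q\<in>V. f q = mcoord M c q i)"
proof -
  have cc: "c \<in> mindex M" "p \<in> mdom M c" using c by (auto simp: charts_at_def)
  then have p: "p \<in> topspace (mtop M)" using mdom_topspace by blast
  obtain h V K where h: "smooth_on n (mimage M c) (\<lambda>x. h (mparam M c x))" 
    and V: "openin (mtop M) V" "p \<in> V" "V \<subseteq> mdom M c" "\<forall>q\<in>V. h q = 1"
    and K: "closedin (mtop M) K" "K \<subseteq> mdom M c \<inter> topspace (mtop M)" and h0: "\<forall>q. q \<notin> K \<longrightarrow> h q = 0"
    using bump_function[OF c openin_topspace p] by blast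
  have "smooth_on n (mimage M c) (\<lambda>x. h (mparam M c x) * x i)"
    by (intro smooth_on_mult[OF mimage_open[OF cc(1)]] h smooth_on_coord[OF mimage_open[OF cc(1)]])
  then have "smooth_on n (mimage M c) (\<lambda>x. h (mparam M c x) * mcoord M c (mparam M c x) i)"
    by (rule smooth_on_cong[OF mimage_open[OF cc(1)], rotated]) (simp add: mcoord_mparam)
  then have "smooth_fun M (\<lambda>q. h q * mcoord M c q i)"
    by (rule smooth_fun_extension[OF cc(1) K(1), rotated]) (use K h0 in auto)
  then show ?thesis using V by (intro exI[of _ "\<lambda>q. h q * mcoord M c q i"] exI[of _ V]) auto
qed

end

section \<open>Functions and vector fields on the tangent bundle\<close>

lemma tangent_bundle_simps [simp]:
  "mdim (tangent_bundle M) = 2 * mdim M" "mindex (tangent_bundle M) = mindex M"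
  "mdom (tangent_bundle M) = tb_dom M" "mcoord (tangent_bundle M) = tb_coord M"
  by (simp_all add: tangent_bundle_def)

lemma topspace_tangent_bundle: "topspace (mtop (tangent_bundle M)) \<subseteq> tb_points M"
  by (auto simp: tangent_bundle_def tb_dom_def)

lemma fun_vlift_pair: "fun_vlift f (p, v) = f p"
  by (simp add: fun_vlift_def)

lemma charts_at_tangent_bundle:
  "charts_at (tangent_bundle M) (p, v) = (if (p, v) \<in> tb_points M then charts_at M p else {})"
  by (auto simp: charts_at_def tb_dom_def)

text \<open>The type of pairs also contains pairs whose second component is not tangent at the
  first. They lie in no chart, so \<open>mv_fun\<close> is 0 there.\<close>

lemma mv_fun_tangent_bundle_cong:
  fixes M :: "('a, 'b) manifold"
  assumes "\<And>q. q \<in> tb_points M \<Longrightarrow> f q = g q"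
  shows "mv_fun (tangent_bundle M) f = mv_fun (tangent_bundle M) g"
proof (intro ext)
  fix q :: "'a \<times> ('b \<Rightarrow> nat \<Rightarrow> real)" and c I
  obtain p v where q: "q = (p, v)" by (cases q)
  show "mv_fun (tangent_bundle M) f q c I = mv_fun (tangent_bundle M) g q c I"
    using assms[of q] unfolding q mv_fun_def charts_at_tangent_bundle by auto
qed

lemma sum_lessThan_split:
  fixes g :: "nat \<Rightarrow> real"
  shows "(\<Sum>k<n + m. g k) = (\<Sum>k<n. g k) + (\<Sum>i<m. g (n + i))"
  by (induction m) (simp_all add: algebra_simps)

context smooth_mfd
begin

section \<open>Charts of the tangent bundle\<close>

abbreviation TM :: "('a \<times> ('c \<Rightarrow> nat \<Rightarrow> real), 'c) manifold" where
  "TM \<equiv> tangent_bundle M"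

text \<open>The bundle projection in coordinates; the zeros from \<open>n\<close> on keep the result
  in the model space.\<close>

definition base_coord :: "(nat \<Rightarrow> real) \<Rightarrow> nat \<Rightarrow> real" where
  "base_coord y = (\<lambda>k. if k < n then y k else 0)"

lemma mcoord_zero: "c \<in> mindex M \<Longrightarrow> p \<in> mdom M c \<Longrightarrow> k \<ge> n \<Longrightarrow> mcoord M c p k = 0"
  using openin_Euclidean_space_subset[OF mimage_open] by (auto simp: mimage_def)

text \<open>The chart is the one picked by \<open>SOME\<close> in the definition of the pairing,
  hence common to all \<open>F\<close> and \<open>w\<close>. The two sums separate base and fibre
  directions.\<close>

lemma diff_pairing_TM:
  assumes "(p, v) \<in> tb_points M"
  obtains c where "c \<in> charts_at M p"
    "\<And>F w. diff_pairing TM F (p, v) w =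
     (\<Sum>k<n. mpderiv TM c k F (p, v) * w c k) + (\<Sum>i<n. mpderiv TM c (n + i) F (p, v) * w c (n + i))"
proof -
  have "p \<in> topspace (mtop M)" using assms by (simp add: tb_points_def)
  then obtain d where d: "d \<in> charts_at M p" using charts_at_nonempty by blast
  have eq: "charts_at TM (p, v) = charts_at M p" using assms by (simp add: charts_at_tangent_bundle)
  define c where "c = (SOME c. c \<in> charts_at TM (p, v))"
  have c: "c \<in> charts_at M p" unfolding c_def eq using d by (rule someI)
  have "diff_pairing TM F (p, v) w =
     (\<Sum>k<n. mpderiv TM c k F (p, v) * w c k) + (\<Sum>i<n. mpderiv TM c (n + i) F (p, v) * w c (n + i))" for F w
    by (simp add: diff_pairing_def c_def[symmetric] mult_2 n_def[symmetric] sum_lessThan_split)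
  with c show ?thesis by (rule that)
qed

lemma tb_coord_in_image:
  assumes "(p, v) \<in> tb_points M" "c \<in> charts_at M p"
  shows "tb_coord M c (p, v) \<in> mimage TM c" "base_coord (tb_coord M c (p, v)) = mcoord M c p"
    "i < n \<Longrightarrow> tb_coord M c (p, v) (n + i) = v c i"
proof -
  have c: "c \<in> mindex M" "p \<in> mdom M c" using assms by (auto simp: charts_at_def)
  show "tb_coord M c (p, v) \<in> mimage TM c"
    using assms c by (auto simp: mimage_def tb_dom_def)
  show "base_coord (tb_coord M c (p, v)) = mcoord M c p"
    using mcoord_zero[OF c] by (auto simp: base_coord_def tb_coord_def n_def not_less fun_eq_iff)
  show "i < n \<Longrightarrow> tb_coord M c (p, v) (n + i) = v c i"
    by (simp add: tb_coord_def n_def)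
qed

lemma mparam_TM:
  assumes c: "c \<in> mindex M" and y: "y \<in> mimage TM c"
  obtains v where "mparam TM c y = (mparam M c (base_coord y), v)"
    "(mparam M c (base_coord y), v) \<in> tb_points M" "\<And>i. i < n \<Longrightarrow> v c i = y (n + i)"
    "base_coord y \<in> mimage M c" "\<And>k. k \<ge> 2 * n \<Longrightarrow> y k = 0"
proof -
  obtain p v where q: "mparam TM c y = (p, v)" by (cases "mparam TM c y")
  have dom: "(p, v) \<in> tb_dom M c" using mparam_in_mdom[OF y] q by simp
  have co: "tb_coord M c (p, v) = y" using mcoord_mparam[OF y] q by simp
  have pv: "(p, v) \<in> tb_points M" "p \<in> mdom M c" using dom by (auto simp: tb_dom_def)
  then have cp: "c \<in> charts_at M p" using c by (simp add: charts_at_def)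
  have b: "base_coord y = mcoord M c p" using tb_coord_in_image(2)[OF pv(1) cp] co by simp
  then have p: "mparam M c (base_coord y) = p" using mparam_mcoord[OF c pv(2)] by simp
  show ?thesis
  proof (rule that[of v])
    show "mparam TM c y = (mparam M c (base_coord y), v)" using p q by simp
    show "(mparam M c (base_coord y), v) \<in> tb_points M" using p pv by simp
    show "v c i = y (n + i)" if "i < n" for i using tb_coord_in_image(3)[OF pv(1) cp that] co by simp
    show "base_coord y \<in> mimage M c" using b pv(2) by (auto simp: mimage_def)
    show "y k = 0" if "k \<ge> 2 * n" for k using that unfolding co[symmetric] by (simp add: tb_coord_def n_def)
  qed
qed

text \<open>The image of the induced chart is the image of \<open>c\<close> times the whole fibre;
  every fibre value occurs because tangent vectors with arbitrary components exist.\<close>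

lemma mimage_TM:
  assumes c: "c \<in> mindex M"
  shows "mimage TM c = {y. base_coord y \<in> mimage M c \<and> (\<forall>k\<ge>2 * n. y k = 0)}"
proof (intro equalityI subsetI)
  fix y assume "y \<in> mimage TM c"
  then show "y \<in> {y. base_coord y \<in> mimage M c \<and> (\<forall>k\<ge>2 * n. y k = 0)}"
    by (rule mparam_TM[OF c]) auto
next
  fix y assume y: "y \<in> {y. base_coord y \<in> mimage M c \<and> (\<forall>k\<ge>2 * n. y k = 0)}"
  let ?p = "mparam M c (base_coord y)"
  have p: "?p \<in> mdom M c" "mcoord M c ?p = base_coord y"
    using y by (auto intro: mparam_in_mdom mcoord_mparam)
  then have cp: "c \<in> charts_at M ?p" using c by (simp add: charts_at_def)
  obtain v where v: "v \<in> tangent_space M ?p" "\<forall>i<n. v c i = y (n + i)"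
    using tangent_vector_exists[OF cp, of "\<lambda>i. y (n + i)"] by blast
  have "(?p, v) \<in> tb_dom M c"
    using p v mdom_topspace[OF c] by (auto simp: tb_dom_def tb_points_def)
  moreover have "tb_coord M c (?p, v) = y"
  proof
    fix k
    show "tb_coord M c (?p, v) k = y k"
    proof -
      consider "k < n" | i where "k = n + i" "i < n" | "k \<ge> 2 * n"
        by (metis add_less_cancel_left le_add_diff_inverse mult_2 not_less)
      then show ?thesis
      proof cases
        case 1
        then show ?thesis using p by (simp add: tb_coord_def base_coord_def n_def)
      next
        case 2
        then show ?thesis using v by (simp add: tb_coord_def n_def)
      next
        case 3
        then show ?thesis using y by (simp add: tb_coord_def n_def)
      qed
    qed
  qed
  ultimately have "y \<in> tb_coord M c ` tb_dom M c" by (metis image_eqI)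
  then show "y \<in> mimage TM c" by (simp add: mimage_def)
qed

lemma open_charts_TM: "open_charts TM"
  unfolding open_charts_def
proof
  fix c assume "c \<in> mindex TM"
  then have c: "c \<in> mindex M" by simp
  have "openin (Euclidean_space (2 * n)) (mimage TM c)"
  proof (rule openin_Euclidean_space_boxI)
    show "mimage TM c \<subseteq> topspace (Euclidean_space (2 * n))"
      by (auto simp: mimage_TM[OF c] topspace_Euclidean_space)
    fix y assume y: "y \<in> mimage TM c"
    then have by_base: "base_coord y \<in> mimage M c" by (simp add: mimage_TM[OF c])
    obtain d where d: "d > 0"
      "\<forall>z. in_box n d (base_coord y) z \<longrightarrow> z \<in> mimage M c"
      using openin_Euclidean_space_box[OF mimage_open[OF c] by_base] by (elim exE conjE)
    have "z \<in> mimage TM c" if z: "\<forall>i<2 * n. \<bar>z i - y i\<bar> < d" "\<forall>i\<ge>2 * n. z i = 0" for z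
    proof -
      have "base_coord z \<in> mimage M c"
        by (rule d(2)[rule_format]) (use z in \<open>auto simp: base_coord_def\<close>)
      then show ?thesis using z by (simp add: mimage_TM[OF c])
    qed
    then show "\<exists>d>0. \<forall>z. in_box (2 * n) d y z \<longrightarrow> z \<in> mimage TM c"
      using d(1) by blast
  qed
  then show "openin (Euclidean_space (mdim TM)) (mimage TM c)" by (simp add: n_def)
qed

lemma mimage_TM_open: "c \<in> mindex M \<Longrightarrow> openin (Euclidean_space (2 * n)) (mimage TM c)"
  using open_charts_TM by (simp add: open_charts_def n_def)

lemma base_coord_upd:
  "k < n \<Longrightarrow> base_coord (y(k := t)) = (base_coord y)(k := t)"
  "base_coord (y(n + i := t)) = base_coord y"
  by (auto simp: base_coord_def fun_eq_iff)

section \<open>Lifted functions in coordinates\<close>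

lemma fun_vlift_mparam:
  assumes "c \<in> mindex M" "y \<in> mimage TM c"
  shows "fun_vlift f (mparam TM c y) = f (mparam M c (base_coord y))"
  by (rule mparam_TM[OF assms]) (simp add: fun_vlift_def)

lemma fun_clift_mparam:
  assumes c: "c \<in> mindex M" and y: "y \<in> mimage TM c" and f: "smooth_fun M f"
  shows "fun_clift M f (mparam TM c y) =
    (\<Sum>i<n. pderiv_coord i (\<lambda>x. f (mparam M c x)) (base_coord y) * y (n + i))"
proof (rule mparam_TM[OF c y])
  fix v assume v: "mparam TM c y = (mparam M c (base_coord y), v)"
    "(mparam M c (base_coord y), v) \<in> tb_points M" "\<And>i. i < n \<Longrightarrow> v c i = y (n + i)"
    "base_coord y \<in> mimage M c"
  have "c \<in> charts_at M (mparam M c (base_coord y))"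
    using c mparam_in_mdom[OF v(4)] by (simp add: charts_at_def)
  moreover have "v \<in> tangent_space M (mparam M c (base_coord y))" using v(2) by (simp add: tb_points_def)
  ultimately show ?thesis
    using v(3) by (simp add: v(1) fun_clift_def diff_pairing_chart[OF _ _ f] mpderiv_def mcoord_mparam[OF v(4)])
qed

context
  fixes p :: 'a and v :: "'c \<Rightarrow> nat \<Rightarrow> real" and c :: 'c and f :: "'a \<Rightarrow> real"
  assumes pv: "(p, v) \<in> tb_points M" and cp: "c \<in> charts_at M p" and f: "smooth_fun M f"
begin

lemma chart_index_dom: "c \<in> mindex M" "p \<in> mdom M c"
  using cp by (auto simp: charts_at_def)

lemma mpderiv_fun_vlift:
  "k < n \<Longrightarrow> mpderiv TM c k (fun_vlift f) (p, v) = mpderiv M c k f p"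
  "i < n \<Longrightarrow> mpderiv TM c (n + i) (fun_vlift f) (p, v) = 0"
proof -
  let ?y = "tb_coord M c (p, v)"
  note y = tb_coord_in_image[OF pv cp]
  have *: "mpderiv TM c k (fun_vlift f) (p, v) = pderiv_coord k (\<lambda>y. f (mparam M c (base_coord y))) ?y"
    if "k < 2 * n" for k
    unfolding mpderiv_def tangent_bundle_simps
    by (rule pderiv_coord_cong[OF mimage_TM_open[OF chart_index_dom(1)] y(1) that]) (rule fun_vlift_mparam[OF chart_index_dom(1)])
  show "mpderiv TM c k (fun_vlift f) (p, v) = mpderiv M c k f p" if "k < n"
  proof -
    have "?y k = mcoord M c p k" using that by (simp add: tb_coord_def n_def)
    then show ?thesis
      using *[of k] that by (simp only: pderiv_coord_def mpderiv_def base_coord_upd y(2))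
  qed
  show "mpderiv TM c (n + i) (fun_vlift f) (p, v) = 0" if "i < n"
    using *[of "n + i"] that by (simp only: pderiv_coord_def base_coord_upd) simp
qed

text \<open>In the chart, \<open>fun_clift M f\<close> is the sum of the partial derivatives of
  \<open>f\<close> times the fibre coordinates \<open>n + i\<close>. Base directions differentiate
  the first factors, fibre directions the second.\<close>

lemma mpderiv_fun_clift:
  "k < n \<Longrightarrow> mpderiv TM c k (fun_clift M f) (p, v) =
    (\<Sum>i<n. pderiv_coord k (pderiv_coord i (\<lambda>x. f (mparam M c x))) (mcoord M c p) * v c i)"
  "i < n \<Longrightarrow> mpderiv TM c (n + i) (fun_clift M f) (p, v) = mpderiv M c i f p"
proof -
  let ?y = "tb_coord M c (p, v)" and ?\<phi> = "\<lambda>x. f (mparam M c x)"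
  note y = tb_coord_in_image[OF pv cp]
  have sm: "smooth_on n (mimage M c) ?\<phi>" using f chart_index_dom by (simp add: smooth_fun_def n_def)
  have x: "mcoord M c p \<in> mimage M c" using chart_index_dom by (auto simp: mimage_def)
  have *: "mpderiv TM c k (fun_clift M f) (p, v) =
      pderiv_coord k (\<lambda>y. \<Sum>i<n. pderiv_coord i ?\<phi> (base_coord y) * y (n + i)) ?y"
    if "k < 2 * n" for k
    unfolding mpderiv_def tangent_bundle_simps
    by (rule pderiv_coord_cong[OF mimage_TM_open[OF chart_index_dom(1)] y(1) that]) (rule fun_clift_mparam[OF chart_index_dom(1) _ f])
  show "mpderiv TM c k (fun_clift M f) (p, v) =
    (\<Sum>i<n. pderiv_coord k (pderiv_coord i ?\<phi>) (mcoord M c p) * v c i)" if k: "k < n"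
  proof -
    have yk: "?y k = mcoord M c p k" using k by (simp add: tb_coord_def n_def)
    have "((\<lambda>t. \<Sum>i<n. pderiv_coord i ?\<phi> ((mcoord M c p)(k := t)) * v c i) has_real_derivative
      (\<Sum>i<n. pderiv_coord k (pderiv_coord i ?\<phi>) (mcoord M c p) * v c i)) (at (mcoord M c p k))"
    proof (rule DERIV_sum)
      fix i assume "i \<in> {..<n}"
      then show "((\<lambda>t. pderiv_coord i ?\<phi> ((mcoord M c p)(k := t)) * v c i) has_real_derivative
          pderiv_coord k (pderiv_coord i ?\<phi>) (mcoord M c p) * v c i) (at (mcoord M c p k))"
        using smooth_onD(2)[OF mimage_open[OF chart_index_dom(1)] smooth_onD(3)[OF mimage_open[OF chart_index_dom(1)] sm] k x, of i]
        by (intro DERIV_cmult_right) auto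
    qed
    moreover have "(\<Sum>i<n. pderiv_coord i ?\<phi> (base_coord (?y(k := t))) * (?y(k := t)) (n + i)) =
        (\<Sum>i<n. pderiv_coord i ?\<phi> ((mcoord M c p)(k := t)) * v c i)" for t
      using k y(3) by (intro sum.cong refl) (simp add: base_coord_upd y(2))
    ultimately have "pderiv_coord k (\<lambda>y. \<Sum>i<n. pderiv_coord i ?\<phi> (base_coord y) * y (n + i)) ?y =
        (\<Sum>i<n. pderiv_coord k (pderiv_coord i ?\<phi>) (mcoord M c p) * v c i)"
      by (intro pderiv_coord_eqI) (simp only: yk)
    then show ?thesis using *[of k] k by simp
  qed
  show "mpderiv TM c (n + i) (fun_clift M f) (p, v) = mpderiv M c i f p" if i: "i < n"
  proof -
    have "(\<Sum>j<n. pderiv_coord j ?\<phi> (base_coord (?y(n + i := t))) * (?y(n + i := t)) (n + j)) =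
        (\<Sum>j<n. pderiv_coord j ?\<phi> (mcoord M c p) * (if j = i then t else v c j))" for t
      by (intro sum.cong refl) (simp add: base_coord_upd y(2,3))
    moreover have "((\<lambda>t. \<Sum>j<n. pderiv_coord j ?\<phi> (mcoord M c p) * (if j = i then t else v c j)) has_real_derivative
        (\<Sum>j<n. pderiv_coord j ?\<phi> (mcoord M c p) * (if j = i then 1 else 0))) (at (?y (n + i)))"
    proof (rule DERIV_sum)
      fix j
      show "((\<lambda>t. pderiv_coord j ?\<phi> (mcoord M c p) * (if j = i then t else v c j)) has_real_derivative
        pderiv_coord j ?\<phi> (mcoord M c p) * (if j = i then 1 else 0)) (at (?y (n + i)))"
        by (cases "j = i") (auto intro!: derivative_eq_intros)
    qed
    ultimately have "pderiv_coord (n + i) (\<lambda>y. \<Sum>i<n. pderiv_coord i ?\<phi> (base_coord y) * y (n + i)) ?y =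
        (\<Sum>j<n. pderiv_coord j ?\<phi> (mcoord M c p) * (if j = i then 1 else 0))"
      by (intro pderiv_coord_eqI) (simp only:)
    then show ?thesis
      using *[of "n + i"] i by (simp add: mpderiv_def if_distrib[where f="\<lambda>x. _ * x"] cong: if_cong)
  qed
qed

end

section \<open>Lifted vector fields acting on lifted functions\<close>

lemma vf_apply_mparam:
  assumes Y: "vector_field M Y" and f: "smooth_fun M f" and c: "c \<in> mindex M" and x: "x \<in> mimage M c"
  shows "vf_apply M Y f (mparam M c x) =
    (\<Sum>k<n. pderiv_coord k (\<lambda>x. f (mparam M c x)) x * Y (mparam M c x) c k)"
proof -
  have cp: "c \<in> charts_at M (mparam M c x)" using c mparam_in_mdom[OF x] by (simp add: charts_at_def)
  then have "mparam M c x \<in> topspace (mtop M)" using charts_at_outside by blast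
  then have "Y (mparam M c x) \<in> tangent_space M (mparam M c x)" using Y by (simp add: vector_field_def)
  then show ?thesis
    by (simp add: vf_apply_def diff_pairing_chart[OF cp _ f] mpderiv_def mcoord_mparam[OF x])
qed

lemma smooth_vf_component:
  "vector_field M Y \<Longrightarrow> c \<in> mindex M \<Longrightarrow> k < n \<Longrightarrow> smooth_on n (mimage M c) (\<lambda>x. Y (mparam M c x) c k)"
  by (simp add: vector_field_def n_def)

lemma smooth_fun_chart: "smooth_fun M f \<Longrightarrow> c \<in> mindex M \<Longrightarrow> smooth_on n (mimage M c) (\<lambda>x. f (mparam M c x))"
  by (simp add: smooth_fun_def n_def)

lemma smooth_vf_apply:
  assumes Y: "vector_field M Y" and f: "smooth_fun M f"
  shows "smooth_fun M (vf_apply M Y f)"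
  unfolding smooth_fun_def n_def[symmetric]
proof
  fix c assume c: "c \<in> mindex M"
  note U = mimage_open[OF c]
  have "smooth_on n (mimage M c) (\<lambda>x. \<Sum>k<n. pderiv_coord k (\<lambda>x. f (mparam M c x)) x * Y (mparam M c x) c k)"
    by (intro smooth_on_sum[OF U] smooth_on_mult[OF U] smooth_onD(3)[OF U] smooth_fun_chart[OF f c]
        smooth_vf_component[OF Y c]) auto
  then show "smooth_on n (mimage M c) (\<lambda>x. vf_apply M Y f (mparam M c x))"
    by (rule smooth_on_cong[OF U, rotated]) (simp add: vf_apply_mparam[OF Y f c])
qed

text \<open>The product rule for the coordinate expression of \<open>vf_apply M Y f\<close>. The
  second derivatives are reordered by symmetry into the form in which they occur for
  \<open>fun_clift\<close>.\<close>

lemma mpderiv_vf_apply: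
  assumes Y: "vector_field M Y" and f: "smooth_fun M f" and cp: "c \<in> charts_at M p" and i: "i < n"
  shows "mpderiv M c i (vf_apply M Y f) p =
    (\<Sum>k<n. pderiv_coord k (pderiv_coord i (\<lambda>x. f (mparam M c x))) (mcoord M c p) * Y p c k
          + mpderiv M c k f p * mpderiv M c i (\<lambda>q. Y q c k) p)"
proof -
  have c: "c \<in> mindex M" "p \<in> mdom M c" using cp by (auto simp: charts_at_def)
  let ?\<phi> = "\<lambda>x. f (mparam M c x)" and ?x = "mcoord M c p"
  note U = mimage_open[OF c(1)] and \<phi> = smooth_fun_chart[OF f c(1)]
  have x: "?x \<in> mimage M c" using c by (auto simp: mimage_def)
  have px: "mparam M c ?x = p" using mparam_mcoord[OF c] .
  have "mpderiv M c i (vf_apply M Y f) p =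
      pderiv_coord i (\<lambda>x. \<Sum>k<n. pderiv_coord k ?\<phi> x * Y (mparam M c x) c k) ?x"
    unfolding mpderiv_def
    by (rule pderiv_coord_cong[OF U x i]) (rule vf_apply_mparam[OF Y f c(1)])
  also have "\<dots> = (\<Sum>k<n. pderiv_coord i (pderiv_coord k ?\<phi>) ?x * Y p c k
          + pderiv_coord i (\<lambda>x. Y (mparam M c x) c k) ?x * pderiv_coord k ?\<phi> ?x)"
  proof (rule pderiv_coord_eqI, rule DERIV_sum)
    fix k assume "k \<in> {..<n}"
    then have k: "k < n" by simp
    show "((\<lambda>t. pderiv_coord k ?\<phi> (?x(i := t)) * Y (mparam M c (?x(i := t))) c k) has_real_derivative
      pderiv_coord i (pderiv_coord k ?\<phi>) ?x * Y p c k
          + pderiv_coord i (\<lambda>x. Y (mparam M c x) c k) ?x * pderiv_coord k ?\<phi> ?x) (at (?x i))"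
      using DERIV_mult[OF smooth_onD(2)[OF U smooth_onD(3)[OF U \<phi> k] i x]
          smooth_onD(2)[OF U smooth_vf_component[OF Y c(1) k] i x]]
      by (simp only: fun_upd_triv px)
  qed
  also have "\<dots> = (\<Sum>k<n. pderiv_coord k (pderiv_coord i ?\<phi>) ?x * Y p c k
          + mpderiv M c k f p * mpderiv M c i (\<lambda>q. Y q c k) p)"
    by (rule sum.cong[OF refl]) (use pderiv_coord_commute[OF U \<phi> x i] in \<open>simp add: mpderiv_def mult.commute\<close>)
  finally show ?thesis .
qed

lemma vertical_lift_components:
  assumes "(p, v) \<in> tb_points M" "c \<in> charts_at M p"
  shows "k < n \<Longrightarrow> vertical_lift M Y (p, v) c k = 0" "i < n \<Longrightarrow> vertical_lift M Y (p, v) c (n + i) = Y p c i"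
  using assms by (auto simp: vertical_lift_def charts_at_tangent_bundle n_def)

lemma complete_lift_components:
  assumes "(p, v) \<in> tb_points M" "c \<in> charts_at M p"
  shows "k < n \<Longrightarrow> complete_lift M Y (p, v) c k = Y p c k"
    "i < n \<Longrightarrow> complete_lift M Y (p, v) c (n + i) = (\<Sum>j<n. mpderiv M c j (\<lambda>q. Y q c i) p * v c j)"
  using assms by (auto simp: complete_lift_def charts_at_tangent_bundle n_def)

text \<open>Computed in the chart underlying the pairing on the tangent bundle. Second derivatives
  of \<open>f\<close> enter the first identity only, contracted on both sides with \<open>Y\<close>
  and \<open>v\<close>; the other terms there come from the derivatives of the components of
  \<open>Y\<close>.\<close>

lemma vf_apply_lifts:
  assumes Y: "vector_field M Y" and f: "smooth_fun M f" and q: "q \<in> tb_points M"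
  shows "vf_apply TM (complete_lift M Y) (fun_clift M f) q = fun_clift M (vf_apply M Y f) q"
    and "vf_apply TM (complete_lift M Y) (fun_vlift f) q = fun_vlift (vf_apply M Y f) q"
    and "vf_apply TM (vertical_lift M Y) (fun_clift M f) q = fun_vlift (vf_apply M Y f) q"
    and "vf_apply TM (vertical_lift M Y) (fun_vlift f) q = 0"
proof -
  obtain p v where pq: "q = (p, v)" by (cases q)
  have pv: "(p, v) \<in> tb_points M" using q pq by simp
  then have p: "p \<in> topspace (mtop M)" and v: "v \<in> tangent_space M p" by (auto simp: tb_points_def)
  obtain c where c: "c \<in> charts_at M p" and dp: "\<And>F w. diff_pairing TM F (p, v) w =
     (\<Sum>k<n. mpderiv TM c k F (p, v) * w c k) + (\<Sum>i<n. mpderiv TM c (n + i) F (p, v) * w c (n + i))"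
    using diff_pairing_TM[OF pv] by blast
  have Yp: "Y p \<in> tangent_space M p" using Y p by (simp add: vector_field_def)
  have Yf: "vf_apply M Y f p = (\<Sum>k<n. mpderiv M c k f p * Y p c k)"
    by (simp add: vf_apply_def diff_pairing_chart[OF c Yp f])
  note V = mpderiv_fun_vlift[OF pv c f] and C = mpderiv_fun_clift[OF pv c f]
  note vl = vertical_lift_components[OF pv c] and cl = complete_lift_components[OF pv c]
  show "vf_apply TM (complete_lift M Y) (fun_vlift f) q = fun_vlift (vf_apply M Y f) q"
    by (simp add: pq vf_apply_def[of TM] dp V cl fun_vlift_pair Yf)
  show "vf_apply TM (vertical_lift M Y) (fun_clift M f) q = fun_vlift (vf_apply M Y f) q"
    by (simp add: pq vf_apply_def[of TM] dp C vl fun_vlift_pair Yf)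
  show "vf_apply TM (vertical_lift M Y) (fun_vlift f) q = 0"
    by (simp add: pq vf_apply_def[of TM] dp V vl)
  let ?H = "\<lambda>k i. pderiv_coord k (pderiv_coord i (\<lambda>x. f (mparam M c x))) (mcoord M c p)"
  let ?D = "\<lambda>i k. mpderiv M c i (\<lambda>q. Y q c k) p"
  have "fun_clift M (vf_apply M Y f) q = (\<Sum>i<n. mpderiv M c i (vf_apply M Y f) p * v c i)"
    by (simp add: pq fun_clift_def diff_pairing_chart[OF c v smooth_vf_apply[OF Y f]])
  also have "\<dots> = (\<Sum>i<n. \<Sum>k<n. ?H k i * v c i * Y p c k + mpderiv M c k f p * (?D i k * v c i))"
    by (rule sum.cong[OF refl])
      (simp add: mpderiv_vf_apply[OF Y f c] sum_distrib_left sum_distrib_right algebra_simps)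
  also have "\<dots> = (\<Sum>k<n. \<Sum>i<n. ?H k i * v c i * Y p c k + mpderiv M c k f p * (?D i k * v c i))"
    by (rule sum.swap)
  also have "\<dots> = (\<Sum>k<n. (\<Sum>i<n. ?H k i * v c i) * Y p c k) + (\<Sum>k<n. mpderiv M c k f p * (\<Sum>i<n. ?D i k * v c i))"
    by (simp only: sum.distrib sum_distrib_left sum_distrib_right)
  also have "\<dots> = vf_apply TM (complete_lift M Y) (fun_clift M f) q"
    by (simp add: pq vf_apply_def[of TM] dp C cl)
  finally show "vf_apply TM (complete_lift M Y) (fun_clift M f) q = fun_clift M (vf_apply M Y f) q" ..
qed

text \<open>Functions that agree with the coordinates near a point are inserted. Their vertical
  lifts detect the base components of \<open>W\<close>, and then their complete lifts the fibre
  components. The base components come first because they multiply the second derivatives of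
  \<open>f\<close> in the complete lift.\<close>

lemma vector_field_TM_eq_0:
  assumes W: "vector_field TM W"
    and kill: "\<And>f q. smooth_fun M f \<Longrightarrow> q \<in> tb_points M \<Longrightarrow>
      vf_apply TM W (fun_vlift f) q = 0 \<and> vf_apply TM W (fun_clift M f) q = 0"
  shows "W q d k = 0"
proof (cases "q \<in> topspace (mtop TM)")
  case True
  obtain p v where pq: "q = (p, v)" by (cases q)
  have pv: "(p, v) \<in> tb_points M" using True topspace_tangent_bundle pq by blast
  obtain c where c: "c \<in> charts_at M p" and dp: "\<And>F w. diff_pairing TM F (p, v) w =
     (\<Sum>k<n. mpderiv TM c k F (p, v) * w c k) + (\<Sum>i<n. mpderiv TM c (n + i) F (p, v) * w c (n + i))"
    using diff_pairing_TM[OF pv] by blast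
  have cc: "c \<in> mindex M" using c by (simp add: charts_at_def)
  have W0: "W q c i = 0 \<and> W q c (n + i) = 0" if i: "i < n" for i
    using i
  proof -
    have *: "\<exists>f. smooth_fun M f \<and> (\<forall>k<n. mpderiv M c k f p = (if k = i then 1 else 0))" if i: "i < n" for i
    proof -
      obtain f V where f: "smooth_fun M f" and V: "openin (mtop M) V" "p \<in> V" "V \<subseteq> mdom M c" "\<forall>q\<in>V. f q = mcoord M c q i"
        using coordinate_function[OF c] by blast
      have "mpderiv M c k f p = jacobian M c c p i k" if k: "k < n" for k
        unfolding mpderiv_def jacobian_def
        by (rule pderiv_coord_cong[OF open_mcoord_image[OF cc V(1,3)] _ k])
          (use V mparam_in_mdom_image[OF cc V(3)] in auto)
      then show ?thesis using f jacobian_self[OF c] by auto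
    qed
    have A: "W q c i = 0" if i: "i < n" for i
    proof -
      obtain f where f: "smooth_fun M f" "\<forall>k<n. mpderiv M c k f p = (if k = i then 1 else 0)" using *[OF i] by blast
      have "0 = vf_apply TM W (fun_vlift f) (p, v)" using kill[OF f(1) pv] by simp
      also have "\<dots> = (\<Sum>k<n. (if k = i then 1 else 0) * W (p, v) c k)"
        by (simp add: vf_apply_def dp mpderiv_fun_vlift[OF pv c f(1)] f(2))
      also have "\<dots> = W (p, v) c i" using i by (simp add: if_distrib[where f="\<lambda>x. x * _"] cong: if_cong)
      finally show ?thesis using pq by simp
    qed
    obtain f where f: "smooth_fun M f" "\<forall>k<n. mpderiv M c k f p = (if k = i then 1 else 0)" using *[OF i] by blast
    have "0 = vf_apply TM W (fun_clift M f) (p, v)" using kill[OF f(1) pv] by simp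
    also have "\<dots> = (\<Sum>k<n. (if k = i then 1 else 0) * W (p, v) c (n + k))"
      using A by (simp add: vf_apply_def dp mpderiv_fun_clift[OF pv c f(1)] f(2) pq)
    also have "\<dots> = W (p, v) c (n + i)" using i by (simp add: if_distrib[where f="\<lambda>x. x * _"] cong: if_cong)
    finally show ?thesis using A[OF i] pq by simp
  qed
  have Wc: "W q c j = 0" if "j < 2 * n" for j
  proof (cases "j < n")
    case False
    then have "j = n + (j - n)" "j - n < n" using that by auto
    then show ?thesis using W0[of "j - n"] by metis
  qed (use W0 in blast)
  have tan: "W q \<in> tangent_space TM q" using W True by (simp add: vector_field_def)
  show ?thesis
  proof (cases "d \<in> charts_at TM q \<and> k < mdim TM")
    case dk: True
    have "c \<in> charts_at TM q" using c pv pq by (simp add: charts_at_tangent_bundle)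
    from tangent_spaceD(1)[OF tan this, of d k] dk show ?thesis
      using Wc by (simp add: n_def)
  qed (rule tangent_spaceD(2)[OF tan])
next
  case False
  then have "W q = (\<lambda>c i. 0)" using W unfolding vector_field_def by metis
  then show ?thesis by simp
qed

end

section \<open>Compatibility of the lifts with the brackets\<close>

lemma mv_algebra [simp]:
  "mv_add X mv_zero = X" "mv_add mv_zero X = X" "mv_scale t mv_zero = mv_zero" "mv_scale 1 X = X"
  "mv_scale 0 X = mv_zero" "mv_wedge X mv_zero = mv_zero" "mv_wedge mv_zero X = mv_zero"
  by (simp_all add: mv_add_def mv_zero_def mv_scale_def mv_wedge_def)

lemma mv_linearD:
  assumes "mv_linear M N L"
  shows "X \<in> mvfields M \<Longrightarrow> L X \<in> mvfields N"
    and "X \<in> mvfields M \<Longrightarrow> Y \<in> mvfields M \<Longrightarrow> L (mv_add X Y) = mv_add (L X) (L Y)"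
    and "X \<in> mvfields M \<Longrightarrow> L (mv_scale t X) = mv_scale t (L X)"
  using assms unfolding mv_linear_def by blast+

lemma mv_linear_zero:
  assumes "open_charts M" "mv_linear M N L"
  shows "L mv_zero = mv_zero"
  using mv_linearD(3)[OF assms(2) mvfields_zero[OF assms(1)], of 0] by simp

lemma mvfields_fun_wedge_at:
  assumes "X \<in> mvfields M" "k q = 0"
  shows "mv_wedge (mv_fun M k) X q = (\<lambda>c I. 0)"
  using assms(2) by (simp add: mv_wedge_fun[OF assms(1)])

lemma mvfields_cutoff_eq:
  assumes "X \<in> mvfields M" "\<And>q. X q \<noteq> (\<lambda>c I. 0) \<Longrightarrow> k q = 1"
  shows "X = mv_wedge (mv_fun M k) X"
proof (intro ext)
  fix q c I
  show "X q c I = mv_wedge (mv_fun M k) X q c I"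
    using assms(2)[of q] by (cases "X q = (\<lambda>c I. 0)") (simp_all add: mv_wedge_fun[OF assms(1)])
qed

section \<open>Consequences of the bracket axioms\<close>

locale schouten =
  fixes N :: "('a, 'c) manifold" and B :: "('a, 'c) mvf \<Rightarrow> ('a, 'c) mvf \<Rightarrow> ('a, 'c) mvf"
  assumes open_charts: "open_charts N" and bracket: "is_schouten_bracket N B"
begin

lemmas bracket_rules = bracket[unfolded is_schouten_bracket_def]

lemma linear_right: "X \<in> mvfields N \<Longrightarrow> mv_linear N N (B X)"
  and linear_left: "X \<in> mvfields N \<Longrightarrow> mv_linear N N (\<lambda>Z. B Z X)"
  using bracket_rules[THEN conjunct1] by simp_all

lemma closed: "X \<in> mvfields N \<Longrightarrow> Y \<in> mvfields N \<Longrightarrow> B X Y \<in> mvfields N"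
  using mv_linearD(1)[OF linear_right] .

lemma add_right: "X \<in> mvfields N \<Longrightarrow> Y \<in> mvfields N \<Longrightarrow> Z \<in> mvfields N \<Longrightarrow>
    B X (mv_add Y Z) = mv_add (B X Y) (B X Z)"
  using mv_linearD(2)[OF linear_right] .

lemma add_left: "X \<in> mvfields N \<Longrightarrow> Y \<in> mvfields N \<Longrightarrow> Z \<in> mvfields N \<Longrightarrow>
    B (mv_add Y Z) X = mv_add (B Y X) (B Z X)"
  using mv_linearD(2)[OF linear_left] .

lemma zero_right: "X \<in> mvfields N \<Longrightarrow> B X mv_zero = mv_zero"
  using mv_linear_zero[OF open_charts linear_right] .

lemma zero_left: "X \<in> mvfields N \<Longrightarrow> B mv_zero X = mv_zero"
  using mv_linear_zero[OF open_charts linear_left] .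

lemma bracket_deg: "X \<in> mvfields_deg N r \<Longrightarrow> Y \<in> mvfields_deg N s \<Longrightarrow> B X Y \<in> mvfields_deg N (r + s - 1)"
  by (rule bracket_rules[THEN conjunct2, THEN conjunct1, rule_format])

lemma antisym: "X \<in> mvfields_deg N r \<Longrightarrow> Y \<in> mvfields_deg N s \<Longrightarrow>
        B X Y = mv_scale (- ((-1) powi ((r - 1) * (s - 1)))) (B Y X)"
  by (rule bracket_rules[THEN conjunct2, THEN conjunct2, THEN conjunct1, rule_format])

lemma jacobi: "X \<in> mvfields_deg N r \<Longrightarrow> Y \<in> mvfields_deg N s \<Longrightarrow> Z \<in> mvfields N \<Longrightarrow>
        B X (B Y Z) = mv_add (B (B X Y) Z) (mv_scale ((-1) powi ((r - 1) * (s - 1))) (B Y (B X Z)))"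
  by (rule bracket_rules[THEN conjunct2, THEN conjunct2, THEN conjunct2, THEN conjunct1, rule_format])

lemma bracket_vec: "vector_field N Y \<Longrightarrow> vector_field N Z \<Longrightarrow>
        B (mv_vec Y) (mv_vec Z) = mv_vec (lie_bracket N Y Z)"
  by (rule bracket_rules[THEN conjunct2, THEN conjunct2, THEN conjunct2, THEN conjunct2, THEN conjunct1, rule_format])

lemma bracket_vec_fun: "vector_field N Y \<Longrightarrow> smooth_fun N f \<Longrightarrow>
        B (mv_vec Y) (mv_fun N f) = mv_fun N (vf_apply N Y f)"
  by (rule bracket_rules[THEN conjunct2, THEN conjunct2, THEN conjunct2, THEN conjunct2, THEN conjunct2, THEN conjunct1, rule_format])

lemma leibniz: "X \<in> mvfields_deg N r \<Longrightarrow> Y \<in> mvfields_deg N s \<Longrightarrow> Z \<in> mvfields N \<Longrightarrow>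
        B X (mv_wedge Y Z) =
          mv_add (mv_wedge (B X Y) Z) (mv_scale ((-1) powi (s * (r - 1))) (mv_wedge Y (B X Z)))"
  by (rule bracket_rules[THEN conjunct2, THEN conjunct2, THEN conjunct2, THEN conjunct2, THEN conjunct2, THEN conjunct2, rule_format])

lemma bracket_fun_fun:
  assumes "X \<in> mvfields_deg N 0" "Y \<in> mvfields_deg N 0"
  shows "B X Y = mv_zero"
  using mvfields_deg_negative[OF bracket_deg[OF assms]] by simp

lemma jacobi_vec:
  assumes "X \<in> mvfields_deg N 1" "Y \<in> mvfields_deg N 1" "Z \<in> mvfields N"
  shows "B (B X Y) Z = mv_add (B X (B Y Z)) (mv_scale (-1) (B Y (B X Z)))"
  using jacobi[OF assms] by (simp add: mv_add_def mv_scale_def)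

text \<open>For W = k W the Leibniz rule gives [X, W] = [X, k] \<and> W + k [X, W]. The second
  summand vanishes where \<open>k\<close> does, and so does the first, because \<open>W\<close>
  vanishes there.\<close>

lemma vanish_right:
  assumes X: "X \<in> mvfields N" and W: "W \<in> mvfields N" and k: "mv_fun N k \<in> mvfields N"
    and eq: "W = mv_wedge (mv_fun N k) W" and q: "k q = 0"
  shows "B X W q = (\<lambda>c I. 0)"
  using open_charts X
proof (induction rule: mvfields_hom_induct)
  case (hom r X)
  have X: "X \<in> mvfields N" by (rule mvfields_degD[OF hom])
  have Wq: "W q = (\<lambda>c I. 0)"
    using mvfields_fun_wedge_at[where k = k, OF W q] eq by simp
  have "B X W = mv_add (mv_wedge (B X (mv_fun N k)) W)
      (mv_scale ((-1) powi (0 * (int r - 1))) (mv_wedge (mv_fun N k) (B X W)))"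
    using leibniz[OF hom mv_fun_deg[OF k] W] eq by simp
  moreover have "mv_wedge (B X (mv_fun N k)) W q = (\<lambda>c I. 0)"
    by (simp add: mv_wedge_def Wq)
  moreover have "mv_wedge (mv_fun N k) (B X W) q = (\<lambda>c I. 0)"
    by (rule mvfields_fun_wedge_at[where k = k, OF closed[OF X W] q])
  ultimately show ?case by (metis (no_types, lifting) add_0 mult_zero_right mv_add_def mv_scale_def)
next
  case (add X Y)
  then show ?case using add_left[OF W add(1,2)] by (simp add: mv_add_def)
qed

text \<open>The other slot follows by graded antisymmetry, hence the assumptions on the
  degrees.\<close>

lemma vanish_left:
  assumes X: "X \<in> mvfields_deg N r" and W: "W \<in> mvfields_deg N s" and k: "mv_fun N k \<in> mvfields N"
    and eq: "W = mv_wedge (mv_fun N k) W" and q: "k q = 0"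
  shows "B W X q = (\<lambda>c I. 0)"
  using vanish_right[OF mvfields_degD[OF X] mvfields_degD[OF W] k eq q] antisym[OF W X]
  by (simp add: mv_scale_def)

end

section \<open>The four identities on generated fields\<close>

locale tangent_lifts = smooth_mfd M n for M :: "('a, 'c) manifold" and n +
  fixes B :: "('a, 'c) mvf \<Rightarrow> ('a, 'c) mvf \<Rightarrow> ('a, 'c) mvf"
    and BT :: "('a \<times> ('c \<Rightarrow> nat \<Rightarrow> real), 'c) mvf \<Rightarrow>
               ('a \<times> ('c \<Rightarrow> nat \<Rightarrow> real), 'c) mvf \<Rightarrow> ('a \<times> ('c \<Rightarrow> nat \<Rightarrow> real), 'c) mvf"
    and vT dT :: "('a, 'c) mvf \<Rightarrow> ('a \<times> ('c \<Rightarrow> nat \<Rightarrow> real), 'c) mvf"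
  assumes B: "is_schouten_bracket M B" and BT: "is_schouten_bracket (tangent_bundle M) BT"
    and vT: "is_vT M vT" and dT: "is_dT M vT dT"
begin

sublocale S: schouten M B
  by unfold_locales (rule open_charts, rule B)

sublocale T: schouten TM BT
  by unfold_locales (rule open_charts_TM, rule BT)

lemma vT_linear: "mv_linear M TM vT" and dT_linear: "mv_linear M TM dT"
  using vT dT by (auto simp: is_vT_def is_dT_def)

lemmas vT_closed = mv_linearD(1)[OF vT_linear] and vT_add = mv_linearD(2)[OF vT_linear]
  and vT_scale = mv_linearD(3)[OF vT_linear] and vT_zero = mv_linear_zero[OF open_charts vT_linear]
lemmas dT_closed = mv_linearD(1)[OF dT_linear] and dT_add = mv_linearD(2)[OF dT_linear]
  and dT_scale = mv_linearD(3)[OF dT_linear] and dT_zero = mv_linear_zero[OF open_charts dT_linear]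

lemma vT_deg: "X \<in> mvfields_deg M r \<Longrightarrow> vT X \<in> mvfields_deg TM r"
  and vT_wedge: "X \<in> mvfields M \<Longrightarrow> Z \<in> mvfields M \<Longrightarrow> vT (mv_wedge X Z) = mv_wedge (vT X) (vT Z)"
  and vT_fun: "smooth_fun M f \<Longrightarrow> vT (mv_fun M f) = mv_fun TM (fun_vlift f)"
  and vT_vec: "vector_field M Y \<Longrightarrow> vT (mv_vec Y) = mv_vec (vertical_lift M Y)"
  using vT unfolding is_vT_def by blast+

lemma dT_fun: "smooth_fun M f \<Longrightarrow> dT (mv_fun M f) = mv_fun TM (fun_clift M f)"
  and dT_vec: "vector_field M Y \<Longrightarrow> dT (mv_vec Y) = mv_vec (complete_lift M Y)"
  and dT_wedge: "X \<in> mvfields M \<Longrightarrow> Z \<in> mvfields M \<Longrightarrow>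
        dT (mv_wedge X Z) = mv_add (mv_wedge (dT X) (vT Z)) (mv_wedge (vT X) (dT Z))"
  using dT unfolding is_dT_def by blast+

lemma mv_vec_mvfields: "vector_field M Y \<Longrightarrow> mv_vec Y \<in> mvfields M"
  using vector_field_iff_mvfields[OF open_charts] by blast

lemma lifted_functions_smooth:
  assumes "smooth_fun M f"
  shows "smooth_fun TM (fun_vlift f)" "smooth_fun TM (fun_clift M f)"
  using smooth_fun_if_mvfields[OF open_charts_TM] vT_closed[OF mv_fun_mvfields[OF assms]]
    dT_closed[OF mv_fun_mvfields[OF assms]] by (simp_all add: vT_fun dT_fun assms)

lemma lifted_vector_fields:
  assumes "vector_field M Y"
  shows "vector_field TM (vertical_lift M Y)" "vector_field TM (complete_lift M Y)"
  using vector_field_iff_mvfields[OF open_charts_TM] vT_closed[OF mv_vec_mvfields[OF assms]]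
    dT_closed[OF mv_vec_mvfields[OF assms]] by (simp_all add: vT_vec dT_vec assms)

text \<open>The bracket rules on the tangent bundle need the degree of \<open>dT X\<close>, which
  \<open>is_dT\<close> leaves implicit; it is carried along with \<open>X\<close> until
  \<open>dT_deg\<close> provides it in general.\<close>

definition homog :: "int \<Rightarrow> ('a, 'c) mvf \<Rightarrow> bool" where
  "homog r X \<longleftrightarrow> X \<in> mvfields_deg M r \<and> dT X \<in> mvfields_deg TM r"

definition compat :: "('a, 'c) mvf \<Rightarrow> ('a, 'c) mvf \<Rightarrow> bool" where
  "compat X Y \<longleftrightarrow> BT (dT X) (dT Y) = dT (B X Y) \<and> BT (dT X) (vT Y) = vT (B X Y) \<and>
     BT (vT X) (dT Y) = vT (B X Y) \<and> BT (vT X) (vT Y) = mv_zero"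

lemma compatD:
  assumes "compat X Y"
  shows "BT (dT X) (dT Y) = dT (B X Y)" "BT (dT X) (vT Y) = vT (B X Y)"
    "BT (vT X) (dT Y) = vT (B X Y)" "BT (vT X) (vT Y) = mv_zero"
  using assms by (simp_all add: compat_def)

lemma homog_mvfields: "homog r X \<Longrightarrow> X \<in> mvfields M"
  unfolding homog_def using mvfields_degD by blast

lemma homog_fun: "smooth_fun M f \<Longrightarrow> homog 0 (mv_fun M f)"
  using mv_fun_deg[OF mv_fun_mvfields, of f] mv_fun_deg[of TM "fun_clift M f"]
    dT_closed[OF mv_fun_mvfields, of f] by (simp add: homog_def dT_fun)

lemma homog_vec: "vector_field M Y \<Longrightarrow> homog 1 (mv_vec Y)"
  using mv_vec_deg[OF open_charts, of Y] mv_vec_deg[OF open_charts_TM lifted_vector_fields(2)]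
  by (simp add: homog_def dT_vec)

lemma homog_wedge:
  assumes X: "homog r X" and Y: "homog s Y"
  shows "homog (r + s) (mv_wedge X Y)"
proof -
  note X' = X[unfolded homog_def] and Y' = Y[unfolded homog_def]
  have "mv_add (mv_wedge (dT X) (vT Y)) (mv_wedge (vT X) (dT Y)) \<in> mvfields_deg TM (r + s)"
    using X' Y' vT_deg by (intro mvfields_deg_add[OF open_charts_TM] mvfields_deg_wedge[OF open_charts_TM]) auto
  then show ?thesis
    using mvfields_deg_wedge[OF open_charts] X' Y'
    by (simp add: homog_def dT_wedge[OF homog_mvfields[OF X] homog_mvfields[OF Y]])
qed

lemma homog_gen: "mv_gen M r X \<Longrightarrow> homog (int r) X"
proof (induction rule: mv_gen.induct)
  case (mv_gen_zero r)
  then show ?case by (simp add: homog_def dT_zero mvfields_deg_zero open_charts open_charts_TM)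
next
  case (mv_gen_fun f)
  then show ?case using homog_fun by simp
next
  case (mv_gen_vec Y r X)
  then show ?case using homog_wedge[OF homog_vec] by fastforce
next
  case (mv_gen_add r X Y)
  note X = mv_gen_add(3) and Y = mv_gen_add(4)
  show ?case
    using X Y mvfields_deg_add[OF open_charts] mvfields_deg_add[OF open_charts_TM]
    by (simp add: homog_def dT_add[OF homog_mvfields[OF X] homog_mvfields[OF Y]])
qed

text \<open>Both lifts keep the degrees of \<open>X\<close> and \<open>Y\<close>, so exchanging the
  arguments produces the same sign in all four identities; the two mixed ones change places.\<close>

lemma compat_sym:
  assumes X: "homog r X" and Y: "homog s Y" and XY: "compat X Y"
  shows "compat Y X"
proof -
  let ?t = "- ((-1) powi ((s - 1) * (r - 1))) :: real"
  note X' = X[unfolded homog_def] and Y' = Y[unfolded homog_def]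
  have BXY: "B X Y \<in> mvfields M" using S.closed homog_mvfields X Y by blast
  note anti = T.antisym[of _ s _ r]
  have "B Y X = mv_scale ?t (B X Y)" using S.antisym X' Y' by blast
  moreover have "BT (dT Y) (dT X) = mv_scale ?t (BT (dT X) (dT Y))"
    "BT (dT Y) (vT X) = mv_scale ?t (BT (vT X) (dT Y))"
    "BT (vT Y) (dT X) = mv_scale ?t (BT (dT X) (vT Y))"
    "BT (vT Y) (vT X) = mv_scale ?t (BT (vT X) (vT Y))"
    using anti X' Y' vT_deg by blast+
  ultimately show ?thesis
    unfolding compat_def by (simp add: compatD[OF XY] dT_scale[OF BXY] vT_scale[OF BXY])
qed

lemma compat_zero: "X \<in> mvfields M \<Longrightarrow> compat X mv_zero"
  by (simp add: compat_def dT_zero vT_zero S.zero_right T.zero_right dT_closed vT_closed)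

lemma compat_add:
  assumes "X \<in> mvfields M" "Y \<in> mvfields M" "Z \<in> mvfields M" "compat X Y" "compat X Z"
  shows "compat X (mv_add Y Z)"
  using assms(1-3) unfolding compat_def
  by (simp add: S.add_right T.add_right S.closed dT_add vT_add dT_closed vT_closed
      compatD[OF assms(4)] compatD[OF assms(5)])

text \<open>Expanding the lifts of the product and applying the Leibniz rule leaves brackets of a
  lift of \<open>X\<close> with a lift of \<open>Y\<close> or of \<open>Z\<close>, and each is
  evaluated by one of the four identities. As degrees are preserved, the sign \<open>?t\<close> is
  the same on both manifolds.\<close>

lemma compat_wedge:
  assumes X: "homog r X" and Y: "homog s Y" and Z: "Z \<in> mvfields M" and XY: "compat X Y" and XZ: "compat X Z"
  shows "compat X (mv_wedge Y Z)"
proof -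
  let ?t = "(-1) powi (s * (r - 1)) :: real"
  note deg = X[unfolded homog_def] Y[unfolded homog_def]
  have Xm: "X \<in> mvfields M" and Ym: "Y \<in> mvfields M" using X Y homog_mvfields by auto
  note wd = mvfields_wedge[OF open_charts] and wT = mvfields_wedge[OF open_charts_TM]
  have cl: "B X Y \<in> mvfields M" "B X Z \<in> mvfields M" using S.closed Xm Ym Z by auto
  note lc = dT_closed vT_closed
  have BX: "B X (mv_wedge Y Z) = mv_add (mv_wedge (B X Y) Z) (mv_scale ?t (mv_wedge Y (B X Z)))"
    using S.leibniz deg Z by blast
  have vB: "vT (B X (mv_wedge Y Z)) = mv_add (mv_wedge (vT (B X Y)) (vT Z)) (mv_scale ?t (mv_wedge (vT Y) (vT (B X Z))))"
    unfolding BX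
    by (simp add: vT_add vT_scale vT_wedge wd mvfields_scale[OF open_charts] cl Ym Z)
  have dB: "dT (B X (mv_wedge Y Z)) =
      mv_add (mv_add (mv_wedge (dT (B X Y)) (vT Z)) (mv_wedge (vT (B X Y)) (dT Z)))
        (mv_scale ?t (mv_add (mv_wedge (dT Y) (vT (B X Z))) (mv_wedge (vT Y) (dT (B X Z)))))"
    unfolding BX
    by (simp add: dT_add dT_scale dT_wedge wd mvfields_scale[OF open_charts] cl Ym Z)
  have L: "BT P (mv_wedge Q R) = mv_add (mv_wedge (BT P Q) R) (mv_scale ?t (mv_wedge Q (BT P R)))"
    if "P \<in> {dT X, vT X}" "Q \<in> {dT Y, vT Y}" "R \<in> mvfields TM" for P Q R
    using that T.leibniz[of P r Q s R] deg vT_deg by blast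
  have A: "BT P (mv_add (mv_wedge (dT Y) (vT Z)) (mv_wedge (vT Y) (dT Z))) =
      mv_add (BT P (mv_wedge (dT Y) (vT Z))) (BT P (mv_wedge (vT Y) (dT Z)))" if "P \<in> {dT X, vT X}" for P
    using that by (intro T.add_right wT) (auto simp: lc Xm Ym Z)
  show ?thesis
    unfolding compat_def dB vB
    by (simp add: dT_wedge[OF Ym Z] vT_wedge[OF Ym Z] A L lc Z compatD[OF XY] compatD[OF XZ])
      (simp add: mv_add_def mv_scale_def algebra_simps)
qed

lemma compat_fun_fun:
  assumes "smooth_fun M f" "smooth_fun M g"
  shows "compat (mv_fun M f) (mv_fun M g)"
proof -
  note f = homog_fun[OF assms(1), unfolded homog_def] and g = homog_fun[OF assms(2), unfolded homog_def]
  show ?thesis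
    unfolding compat_def using f g S.bracket_fun_fun T.bracket_fun_fun vT_deg
    by (simp add: dT_zero vT_zero)
qed

lemma compat_vec_fun:
  assumes Y: "vector_field M Y" and f: "smooth_fun M f"
  shows "compat (mv_vec Y) (mv_fun M f)"
proof -
  note cong = mv_fun_tangent_bundle_cong
  have zero: "mv_fun TM (\<lambda>q. 0) = mv_zero" by (auto simp: mv_fun_def mv_zero_def fun_eq_iff)
  have "mv_fun TM (vf_apply TM (complete_lift M Y) (fun_clift M f)) = mv_fun TM (fun_clift M (vf_apply M Y f))"
    "mv_fun TM (vf_apply TM (complete_lift M Y) (fun_vlift f)) = mv_fun TM (fun_vlift (vf_apply M Y f))"
    "mv_fun TM (vf_apply TM (vertical_lift M Y) (fun_clift M f)) = mv_fun TM (fun_vlift (vf_apply M Y f))"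
    "mv_fun TM (vf_apply TM (vertical_lift M Y) (fun_vlift f)) = mv_fun TM (\<lambda>q. 0)"
    by (rule cong, erule vf_apply_lifts[OF Y f])+
  then show ?thesis
    unfolding compat_def zero
    by (simp add: dT_vec[OF Y] vT_vec[OF Y] dT_fun[OF f] vT_fun[OF f] S.bracket_vec_fun[OF Y f]
        dT_fun[OF smooth_vf_apply[OF Y f]] vT_fun[OF smooth_vf_apply[OF Y f]]
        T.bracket_vec_fun lifted_vector_fields[OF Y] lifted_functions_smooth[OF f])
qed

text \<open>The bracket of a vector field with a function is the derivative of the function, so the
  difference of the two fields annihilates all lifted functions.\<close>

lemma mv_vec_TM_eqI:
  assumes W: "vector_field TM W1" "vector_field TM W2"
    and eq: "\<And>f. smooth_fun M f \<Longrightarrow>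
      BT (mv_vec W1) (vT (mv_fun M f)) = BT (mv_vec W2) (vT (mv_fun M f)) \<and>
      BT (mv_vec W1) (dT (mv_fun M f)) = BT (mv_vec W2) (dT (mv_fun M f))"
  shows "mv_vec W1 = mv_vec W2"
proof -
  have Wm: "mv_vec W1 \<in> mvfields TM" "mv_vec W2 \<in> mvfields TM"
    using W vector_field_iff_mvfields[OF open_charts_TM] by auto
  define W where "W q c k = W1 q c k + (-1) * W2 q c k" for q c k
  have "mv_vec W = mv_add (mv_vec W1) (mv_scale (-1) (mv_vec W2))"
    by (auto simp: mv_vec_def mv_add_def mv_scale_def ext_vec_def W_def fun_eq_iff)
  then have WT: "vector_field TM W"
    using vector_field_iff_mvfields[OF open_charts_TM, of W] Wm
    by (simp add: mvfields_add[OF open_charts_TM] mvfields_scale[OF open_charts_TM])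
  have apply_eq: "vf_apply TM W F q = 0"
    if F: "smooth_fun TM F" and q: "q \<in> tb_points M" and e: "BT (mv_vec W1) (mv_fun TM F) = BT (mv_vec W2) (mv_fun TM F)" for F q
  proof -
    obtain p v where pq: "q = (p, v)" by (cases q)
    \<comment> \<open>A chart around \<open>q\<close> is required to read off values from
      \<open>mv_fun\<close>, which is 0 where there is none.\<close>
    then obtain c where "c \<in> charts_at M p" using q diff_pairing_TM[of p v] by blast
    then have c: "c \<in> charts_at TM q" using q pq by (simp add: charts_at_tangent_bundle)
    have "mv_fun TM (vf_apply TM W1 F) = mv_fun TM (vf_apply TM W2 F)"
      using e by (simp add: T.bracket_vec_fun W F)
    then have "mv_fun TM (vf_apply TM W1 F) q c {} = mv_fun TM (vf_apply TM W2 F) q c {}" by simp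
    then have "vf_apply TM W1 F q = vf_apply TM W2 F q" using c by (simp add: mv_fun_def)
    then show ?thesis
      by (simp add: vf_apply_def diff_pairing_def Let_def W_def algebra_simps sum.distrib sum_negf sum_subtractf)
  qed
  have "W q d k = 0" for q d k
  proof (rule vector_field_TM_eq_0[OF WT], intro conjI)
    fix f q assume f: "smooth_fun M f" and q: "q \<in> tb_points M"
    show "vf_apply TM W (fun_vlift f) q = 0" "vf_apply TM W (fun_clift M f) q = 0"
      using apply_eq[OF _ q] eq[OF f] lifted_functions_smooth[OF f] by (simp_all add: vT_fun[OF f] dT_fun[OF f])
  qed
  then have "W1 = W2" by (simp add: W_def fun_eq_iff)
  then show ?thesis by simp
qed

text \<open>Vector fields on the tangent bundle are compared through their action on lifted
  functions. The Jacobi identity expresses the action of a bracket by iterated brackets with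
  functions, \<open>compat_vec_fun\<close> evaluates these as lifts, and the Jacobi identity on the
  manifold reassembles them.\<close>

lemma compat_vec_vec:
  assumes Y: "vector_field M Y" and Z: "vector_field M Z"
  shows "compat (mv_vec Y) (mv_vec Z)"
proof -
  let ?Y = "mv_vec Y" and ?Z = "mv_vec Z"
  define L where "L = lie_bracket M Y Z"
  have BYZ: "B ?Y ?Z = mv_vec L" unfolding L_def by (rule S.bracket_vec[OF Y Z])
  have Ld: "mv_vec L \<in> mvfields M" using S.closed[OF mv_vec_mvfields[OF Y] mv_vec_mvfields[OF Z]] BYZ by simp
  then have L: "vector_field M L" using vector_field_iff_mvfields[OF open_charts] by blast
  note dY = homog_vec[OF Y, unfolded homog_def] and dZ = homog_vec[OF Z, unfolded homog_def]
  have lie_vf: "vector_field TM (lie_bracket TM V W)" if "vector_field TM V" "vector_field TM W" for V W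
    using T.bracket_vec[OF that] T.closed that vector_field_iff_mvfields[OF open_charts_TM] by metis
  \<comment> \<open>Criterion shared by the four brackets: \<open>BT P Q\<close> is a given field
    \<open>R\<close> once the commutator of the actions of \<open>P\<close> and \<open>Q\<close>
    agrees with \<open>R\<close> on both kinds of lifted functions.\<close>
  have step: "BT P Q = mv_vec R"
    if P: "P \<in> {dT ?Y, vT ?Y}" and Q: "Q \<in> {dT ?Z, vT ?Z}" and R: "vector_field TM R"
      and v: "\<And>f. smooth_fun M f \<Longrightarrow> mv_add (BT P (BT Q (vT (mv_fun M f)))) (mv_scale (-1) (BT Q (BT P (vT (mv_fun M f)))))
         = BT (mv_vec R) (vT (mv_fun M f))"
      and d: "\<And>f. smooth_fun M f \<Longrightarrow> mv_add (BT P (BT Q (dT (mv_fun M f)))) (mv_scale (-1) (BT Q (BT P (dT (mv_fun M f)))))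
         = BT (mv_vec R) (dT (mv_fun M f))" for P Q R
  proof -
    obtain V W where V: "vector_field TM V" "P = mv_vec V" and W: "vector_field TM W" "Q = mv_vec W"
      using P Q lifted_vector_fields[OF Y] lifted_vector_fields[OF Z]
      by (auto simp: dT_vec[OF Y] vT_vec[OF Y] dT_vec[OF Z] vT_vec[OF Z])
    have deg: "P \<in> mvfields_deg TM 1" "Q \<in> mvfields_deg TM 1"
      using V W mv_vec_deg[OF open_charts_TM] by auto
    have PQ: "BT P Q = mv_vec (lie_bracket TM V W)" using V W T.bracket_vec by simp
    show ?thesis
      unfolding PQ
    proof (rule mv_vec_TM_eqI[OF lie_vf[OF V(1) W(1)] R])
      fix f assume f: "smooth_fun M f"
      note F = mv_fun_mvfields[OF f]
      show "BT (mv_vec (lie_bracket TM V W)) (vT (mv_fun M f)) = BT (mv_vec R) (vT (mv_fun M f)) \<and>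
        BT (mv_vec (lie_bracket TM V W)) (dT (mv_fun M f)) = BT (mv_vec R) (dT (mv_fun M f))"
        unfolding PQ[symmetric] T.jacobi_vec[OF deg vT_closed[OF F]] T.jacobi_vec[OF deg dT_closed[OF F]]
        using v[OF f] d[OF f] by simp
    qed
  qed
  have jac: "mv_add (B ?Y (B ?Z (mv_fun M f))) (mv_scale (-1) (B ?Z (B ?Y (mv_fun M f)))) = B (mv_vec L) (mv_fun M f)"
    if "smooth_fun M f" for f
    using S.jacobi_vec[OF conjunct1[OF dY] conjunct1[OF dZ] mv_fun_mvfields[OF that]] BYZ by simp
  have BY: "B ?Y (mv_fun M f) = mv_fun M (vf_apply M Y f)" and BZ: "B ?Z (mv_fun M f) = mv_fun M (vf_apply M Z f)"
    if "smooth_fun M f" for f using S.bracket_vec_fun Y Z that by auto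
  note sm = smooth_vf_apply[OF Y] smooth_vf_apply[OF Z]
  note cY = compatD[OF compat_vec_fun[OF Y]] and cZ = compatD[OF compat_vec_fun[OF Z]] and cL = compatD[OF compat_vec_fun[OF L]]
  have lin: "dT (B (mv_vec L) (mv_fun M f)) = mv_add (dT (B ?Y (B ?Z (mv_fun M f)))) (mv_scale (-1) (dT (B ?Z (B ?Y (mv_fun M f)))))"
     "vT (B (mv_vec L) (mv_fun M f)) = mv_add (vT (B ?Y (B ?Z (mv_fun M f)))) (mv_scale (-1) (vT (B ?Z (B ?Y (mv_fun M f)))))"
    if "smooth_fun M f" for f
    unfolding jac[OF that, symmetric]
    using mv_fun_mvfields[OF that] mv_vec_mvfields[OF Y] mv_vec_mvfields[OF Z]
    by (simp_all add: dT_add vT_add dT_scale vT_scale S.closed mvfields_scale[OF open_charts])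
  have mem: "dT ?Y \<in> mvfields TM" "vT ?Y \<in> mvfields TM" "dT ?Z \<in> mvfields TM" "vT ?Z \<in> mvfields TM"
    using mv_vec_mvfields Y Z dT_closed vT_closed by auto
  have "BT (dT ?Y) (dT ?Z) = mv_vec (complete_lift M L)"
    by (rule step[OF _ _ lifted_vector_fields(2)[OF L]])
      (simp_all add: dT_vec[OF L, symmetric] cL lin cY cZ BY BZ sm)
  moreover have "BT (dT ?Y) (vT ?Z) = mv_vec (vertical_lift M L)"
    by (rule step[OF _ _ lifted_vector_fields(1)[OF L]])
      (simp_all add: vT_vec[OF L, symmetric] cL lin cY cZ BY BZ sm T.zero_right mem)
  moreover have "BT (vT ?Y) (dT ?Z) = mv_vec (vertical_lift M L)"
    by (rule step[OF _ _ lifted_vector_fields(1)[OF L]])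
      (simp_all add: vT_vec[OF L, symmetric] cL lin cY cZ BY BZ sm T.zero_right mem)
  moreover have "BT (vT ?Y) (vT ?Z) = mv_zero"
  proof -
    \<comment> \<open>The vanishing bracket fits the same criterion with the zero vector field as
      \<open>R\<close>.\<close>
    have z: "mv_zero = mv_vec (\<lambda>q c k. 0)" by (auto simp: mv_zero_def mv_vec_def ext_vec_def fun_eq_iff)
    have vz: "vector_field TM (\<lambda>q c k. 0)"
      using vector_field_iff_mvfields[OF open_charts_TM] mvfields_zero[OF open_charts_TM] unfolding z by blast
    have "BT (vT ?Y) (vT ?Z) = mv_vec (\<lambda>q c k. 0)"
      by (rule step[OF _ _ vz])
        (simp_all add: z[symmetric] cY cZ BY BZ sm T.zero_right T.zero_left mem vT_closed dT_closed mv_fun_mvfields)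
    then show ?thesis by (simp only: z)
  qed
  ultimately show ?thesis
    unfolding compat_def BYZ by (simp add: dT_vec[OF L] vT_vec[OF L])
qed

text \<open>Stability under sums and products reduces the second argument to functions and vector
  fields.\<close>

lemma compat_gen_right:
  assumes X: "homog r X" and funs: "\<And>f. smooth_fun M f \<Longrightarrow> compat X (mv_fun M f)"
    and vecs: "\<And>Y. vector_field M Y \<Longrightarrow> compat X (mv_vec Y)"
  shows "mv_gen M s Z \<Longrightarrow> compat X Z"
proof (induction rule: mv_gen.induct)
  case (mv_gen_zero r)
  then show ?case by (rule compat_zero[OF homog_mvfields[OF X]])
next
  case (mv_gen_fun f)
  then show ?case by (rule funs)
next
  case (mv_gen_vec Y r Z)
  then show ?case
    using compat_wedge[OF X homog_vec] vecs homog_mvfields[OF homog_gen] by blast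
next
  case (mv_gen_add r Y Z)
  then show ?case using compat_add[OF homog_mvfields[OF X]] homog_mvfields[OF homog_gen] by blast
qed

text \<open>The reduction of the second argument is used twice: with a function or a vector field on
  the left and, after exchanging the arguments, with \<open>X\<close> on the left.\<close>

lemma compat_gen:
  assumes X: "mv_gen M r X" and Y: "mv_gen M s Y"
  shows "compat X Y"
proof (rule compat_gen_right[OF homog_gen[OF X] _ _ Y])
  fix f assume f: "smooth_fun M f"
  have "compat (mv_fun M f) X"
    by (rule compat_gen_right[OF homog_fun[OF f] _ _ X])
      (use f compat_fun_fun compat_sym[OF homog_vec homog_fun compat_vec_fun] in blast)+
  then show "compat X (mv_fun M f)" by (rule compat_sym[OF homog_fun[OF f] homog_gen[OF X]])
next
  fix Z assume Z: "vector_field M Z"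
  have "compat (mv_vec Z) X"
    by (rule compat_gen_right[OF homog_vec[OF Z] _ _ X]) (use Z compat_vec_fun compat_vec_vec in blast)+
  then show "compat X (mv_vec Z)" by (rule compat_sym[OF homog_vec[OF Z] homog_gen[OF X]])
qed

section \<open>Locality of the lifts and arbitrary multivector fields\<close>

lemma lifts_vanish:
  assumes W: "W \<in> mvfields M" and U: "openin (mtop M) U" "\<And>q. q \<in> U \<Longrightarrow> W q = (\<lambda>c I. 0)" and p: "p \<in> U"
  shows "vT W (p, v) = (\<lambda>c I. 0)" "dT W (p, v) = (\<lambda>c I. 0)"
proof -
  obtain k where k: "smooth_fun M k" "k p = 0" "\<forall>q. q \<notin> U \<longrightarrow> k q = 1"
    using cutoff_function[OF U(1) p] by blast
  \<comment> \<open>\<open>W\<close> is 0 on \<open>U\<close> and \<open>k\<close> is 1 outside of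
    it, so multiplication by \<open>k\<close> fixes \<open>W\<close>.\<close>
  have eq: "W = mv_wedge (mv_fun M k) W"
    by (rule mvfields_cutoff_eq[OF W]) (use k U in blast)
  note km = mv_fun_mvfields[OF k(1)]
  have k0: "fun_vlift k (p, v) = 0" using k by (simp add: fun_vlift_pair)
  have "vT W = mv_wedge (mv_fun TM (fun_vlift k)) (vT W)"
    using vT_wedge[OF km W] eq by (simp add: vT_fun[OF k(1)])
  then show v0: "vT W (p, v) = (\<lambda>c I. 0)"
    using mvfields_fun_wedge_at[where k = "fun_vlift k", OF vT_closed[OF W] k0] by simp
  \<comment> \<open>The summand that contains the complete lift of \<open>k\<close> is harmless,
    since \<open>vT W\<close> is already known to vanish at the point.\<close>
  have "dT W = mv_add (mv_wedge (dT (mv_fun M k)) (vT W)) (mv_wedge (mv_fun TM (fun_vlift k)) (dT W))"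
    using dT_wedge[OF km W] eq by (simp add: vT_fun[OF k(1)])
  moreover have "mv_wedge (dT (mv_fun M k)) (vT W) (p, v) = (\<lambda>c I. 0)"
    by (simp add: mv_wedge_def v0)
  moreover have "mv_wedge (mv_fun TM (fun_vlift k)) (dT W) (p, v) = (\<lambda>c I. 0)"
    by (rule mvfields_fun_wedge_at[where k = "fun_vlift k", OF dT_closed[OF W] k0])
  ultimately show "dT W (p, v) = (\<lambda>c I. 0)" by (metis (no_types, lifting) add_0 mv_add_def)
qed

text \<open>The complete lift of \<open>W\<close> vanishes on whole fibres over \<open>U\<close>, so
  a cutoff function pulled back from the manifold does the job.\<close>

lemma dT_cutoff:
  assumes W: "W \<in> mvfields M" and U: "openin (mtop M) U" "\<And>q. q \<in> U \<Longrightarrow> W q = (\<lambda>c I. 0)" and p: "p \<in> U"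
  shows "\<exists>k. mv_fun TM k \<in> mvfields TM \<and> dT W = mv_wedge (mv_fun TM k) (dT W) \<and> k (p, v) = 0"
proof -
  obtain k where k: "smooth_fun M k" "k p = 0" "\<forall>q. q \<notin> U \<longrightarrow> k q = 1"
    using cutoff_function[OF U(1) p] by blast
  have "dT W = mv_wedge (mv_fun TM (fun_vlift k)) (dT W)"
  proof (rule mvfields_cutoff_eq[OF dT_closed[OF W]])
    fix q assume q: "dT W q \<noteq> (\<lambda>c I. 0)"
    obtain p' v' where pq: "q = (p', v')" by (cases q)
    then have "p' \<notin> U" using lifts_vanish(2)[OF W U] q by blast
    then show "fun_vlift k q = 1" using k pq by (simp add: fun_vlift_pair)
  qed
  moreover have "mv_fun TM (fun_vlift k) \<in> mvfields TM"
    using vT_closed[OF mv_fun_mvfields[OF k(1)]] by (simp add: vT_fun[OF k(1)])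
  ultimately show ?thesis using k(2) by (intro exI[of _ "fun_vlift k"]) (simp add: fun_vlift_pair)
qed

text \<open>\<open>X'\<close> is subject to the identities for generated fields, and the remainder
  \<open>X''\<close> to the locality of the operations.\<close>

lemma local_decomposition:
  assumes X: "X \<in> mvfields_deg M (int r)" and p: "p \<in> topspace (mtop M)"
  obtains X' X'' U where "mv_gen M r X'" "X'' \<in> mvfields_deg M (int r)" "X = mv_add X' X''"
    "openin (mtop M) U" "p \<in> U" "\<And>q. q \<in> U \<Longrightarrow> X'' q = (\<lambda>c I. 0)"
proof -
  obtain Z V where Z: "mv_gen M r Z" and V: "openin (mtop M) V" "p \<in> V" "\<forall>q\<in>V. Z q = X q"
    using mvfields_deg_locally_gen[OF X p] by blast
  define X'' where "X'' = mv_add X (mv_scale (-1) Z)"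
  show ?thesis
  proof (rule that[OF Z _ _ V(1,2)])
    show "X'' \<in> mvfields_deg M (int r)"
      unfolding X''_def using X mv_gen_deg[OF Z] mvfields_deg_add mvfields_deg_scale open_charts by blast
    show "X = mv_add Z X''" by (simp add: X''_def mv_add_def mv_scale_def)
    show "X'' q = (\<lambda>c I. 0)" if "q \<in> V" for q
      using V(3) that by (simp add: X''_def mv_add_def mv_scale_def)
  qed
qed

lemma mvfields_TM_outside: "P \<in> mvfields TM \<Longrightarrow> q \<notin> tb_points M \<Longrightarrow> P q = (\<lambda>c I. 0)"
  using mvfieldsD(2)[of P TM q] topspace_tangent_bundle[of M] by blast

text \<open>Over \<open>p\<close>, the lift of \<open>X\<close> equals the lift of a generated field
  that agrees with \<open>X\<close> near \<open>p\<close>, and for generated fields the degree is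
  known.\<close>

lemma dT_deg:
  assumes X: "X \<in> mvfields_deg M (int r)"
  shows "dT X \<in> mvfields_deg TM (int r)"
proof (rule mvfields_degI[OF dT_closed[OF mvfields_degD[OF X]]])
  fix q c I assume nz: "dT X q c I \<noteq> 0"
  then have q: "q \<in> tb_points M" using mvfields_TM_outside[OF dT_closed[OF mvfields_degD[OF X]]] by fastforce
  obtain p v where pq: "q = (p, v)" by (cases q)
  have p: "p \<in> topspace (mtop M)" using q pq by (simp add: tb_points_def)
  obtain X' X'' U where X': "mv_gen M r X'" and X'': "X'' \<in> mvfields_deg M (int r)" "X = mv_add X' X''"
    and U: "openin (mtop M) U" "p \<in> U" "\<And>q. q \<in> U \<Longrightarrow> X'' q = (\<lambda>c I. 0)"
    using local_decomposition[OF X p] by metis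
  have "dT X = mv_add (dT X') (dT X'')"
    using dT_add[OF mvfields_degD[OF mv_gen_deg[OF X']] mvfields_degD[OF X''(1)]] X''(2) by simp
  then have "dT X q = dT X' q"
    using lifts_vanish(2)[OF mvfields_degD[OF X''(1)] U(1,3,2), of v] by (simp add: mv_add_def pq)
  then have "dT X' q c I \<noteq> 0" using nz by simp
  moreover have "dT X' \<in> mvfields_deg TM (int r)" using homog_gen[OF X'] by (simp add: homog_def)
  ultimately show "int (card I) = int r" by (rule mvfields_deg_cardD[rotated])
qed

text \<open>At a given point over \<open>p\<close> the generated parts of \<open>X\<close> and
  \<open>Y\<close> satisfy the identity, and every bracket that involves a remainder vanishes
  there.\<close>

lemma dT_bracket_homogeneous:
  assumes X: "X \<in> mvfields_deg M (int r)" and Y: "Y \<in> mvfields_deg M (int s)"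
  shows "BT (dT X) (dT Y) = dT (B X Y)"
proof
  fix q
  have Xm: "X \<in> mvfields M" and Ym: "Y \<in> mvfields M" using X Y mvfields_degD by auto
  show "BT (dT X) (dT Y) q = dT (B X Y) q"
  proof (cases "q \<in> tb_points M")
    case True
    obtain p v where pq: "q = (p, v)" by (cases q)
    have p: "p \<in> topspace (mtop M)" using True pq by (simp add: tb_points_def)
    obtain X' X'' U where X': "mv_gen M r X'" and X'': "X'' \<in> mvfields_deg M (int r)" "X = mv_add X' X''"
      and U: "openin (mtop M) U" "p \<in> U" "\<And>q. q \<in> U \<Longrightarrow> X'' q = (\<lambda>c I. 0)"
      using local_decomposition[OF X p] by metis
    obtain Y' Y'' V where Y': "mv_gen M s Y'" and Y'': "Y'' \<in> mvfields_deg M (int s)" "Y = mv_add Y' Y''"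
      and V: "openin (mtop M) V" "p \<in> V" "\<And>q. q \<in> V \<Longrightarrow> Y'' q = (\<lambda>c I. 0)"
      using local_decomposition[OF Y p] by metis
    note mem = mvfields_degD[OF mv_gen_deg[OF X']] mvfields_degD[OF mv_gen_deg[OF Y']]
      mvfields_degD[OF X''(1)] mvfields_degD[OF Y''(1)] Xm Ym
    \<comment> \<open>The splitting of \<open>Y\<close> is used only against the generated part of
      \<open>X\<close>; the remainder of \<open>X\<close> is paired with all of
      \<open>Y\<close>.\<close>
    have S1: "B X Y = mv_add (B X' Y) (B X'' Y)"
      using S.add_left[OF mem(6,1,3)] X''(2) by simp
    have S2: "B X' Y = mv_add (B X' Y') (B X' Y'')"
      using S.add_right[OF mem(1,2,4)] Y''(2) by simp
    have T1: "BT (dT X) (dT Y) = mv_add (BT (dT X') (dT Y)) (BT (dT X'') (dT Y))"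
      using T.add_left[OF dT_closed[OF mem(6)] dT_closed[OF mem(1)] dT_closed[OF mem(3)]]
        dT_add[OF mem(1,3)] X''(2) by simp
    have T2: "BT (dT X') (dT Y) = mv_add (BT (dT X') (dT Y')) (BT (dT X') (dT Y''))"
      using T.add_right[OF dT_closed[OF mem(1)] dT_closed[OF mem(2)] dT_closed[OF mem(4)]]
        dT_add[OF mem(2,4)] Y''(2) by simp
    have "BT (dT X') (dT Y'') q = (\<lambda>c I. 0)"
    proof -
      obtain k where "mv_fun TM k \<in> mvfields TM" "dT Y'' = mv_wedge (mv_fun TM k) (dT Y'')" "k q = 0"
        using dT_cutoff[OF mem(4) V(1,3,2), of v] pq by blast
      then show ?thesis using T.vanish_right[OF dT_closed[OF mem(1)] dT_closed[OF mem(4)]] by blast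
    qed
    \<comment> \<open>A remainder in the left slot is treated by antisymmetry, which takes the
      degrees of both lifts from \<open>dT_deg\<close>.\<close>
    moreover have "BT (dT X'') (dT Y) q = (\<lambda>c I. 0)"
    proof -
      obtain k where "mv_fun TM k \<in> mvfields TM" "dT X'' = mv_wedge (mv_fun TM k) (dT X'')" "k q = 0"
        using dT_cutoff[OF mem(3) U(1,3,2), of v] pq by blast
      then show ?thesis using T.vanish_left[OF dT_deg[OF Y] dT_deg[OF X''(1)]] by blast
    qed
    \<comment> \<open>Locality of \<open>dT\<close> asks for a bracket that vanishes on a whole
      neighbourhood of \<open>p\<close>, so a cutoff function is chosen at every point
      \<open>x\<close> of \<open>V\<close>.\<close>
    moreover have "dT (B X' Y'') q = (\<lambda>c I. 0)"
      unfolding pq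
    proof (rule lifts_vanish(2)[OF S.closed[OF mem(1,4)] V(1) _ V(2)])
      fix x assume x: "x \<in> V"
      obtain k where k: "smooth_fun M k" "k x = 0" "\<forall>q. q \<notin> V \<longrightarrow> k q = 1"
        using cutoff_function[OF V(1) x] by blast
      show "B X' Y'' x = (\<lambda>c I. 0)"
        by (rule S.vanish_right[OF mem(1,4) mv_fun_mvfields[OF k(1)] _ k(2)])
          (rule mvfields_cutoff_eq[OF mem(4)], use k V in blast)
    qed
    moreover have "dT (B X'' Y) q = (\<lambda>c I. 0)"
      unfolding pq
    proof (rule lifts_vanish(2)[OF S.closed[OF mem(3,6)] U(1) _ U(2)])
      fix x assume x: "x \<in> U"
      obtain k where k: "smooth_fun M k" "k x = 0" "\<forall>q. q \<notin> U \<longrightarrow> k q = 1"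
        using cutoff_function[OF U(1) x] by blast
      show "B X'' Y x = (\<lambda>c I. 0)"
        by (rule S.vanish_left[OF Y X''(1) mv_fun_mvfields[OF k(1)] _ k(2)])
          (rule mvfields_cutoff_eq[OF mem(3)], use k U in blast)
    qed
    moreover have "BT (dT X') (dT Y') = dT (B X' Y')"
      by (rule compatD(1)[OF compat_gen[OF X' Y']])
    moreover have "dT (B X Y) = mv_add (mv_add (dT (B X' Y')) (dT (B X' Y''))) (dT (B X'' Y))"
      unfolding S1 S2 using mem(1-4,6) by (simp add: dT_add S.closed mvfields_add[OF open_charts])
    ultimately show ?thesis unfolding T1 T2 by (simp add: mv_add_def)
  next
    case False
    \<comment> \<open>For pairs that are not points of the tangent bundle both sides have the
      default value 0.\<close>
    then show ?thesis
      using mvfields_TM_outside[OF T.closed[OF dT_closed[OF Xm] dT_closed[OF Ym]] False]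
        mvfields_TM_outside[OF dT_closed[OF S.closed[OF Xm Ym]] False] by simp
  qed
qed

text \<open>Both sides are additive in each argument, which reduces the claim to homogeneous
  fields.\<close>

lemma dT_bracket:
  assumes X: "X \<in> mvfields M" and Y: "Y \<in> mvfields M"
  shows "BT (dT X) (dT Y) = dT (B X Y)"
  using open_charts X
proof (induction rule: mvfields_hom_induct)
  case X: (hom r X)
  have Xm: "X \<in> mvfields M" by (rule mvfields_degD[OF X])
  show ?case
    using open_charts Y
  proof (induction rule: mvfields_hom_induct)
    case (hom s Y)
    show ?case by (rule dT_bracket_homogeneous[OF X hom])
  next
    case (add Y Z)
    then show ?case by (simp add: dT_add S.add_right T.add_right S.closed dT_closed Xm)
  qed
next
  case (add X Z)
  then show ?case by (simp add: dT_add S.add_left T.add_left S.closed dT_closed Y)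
qed

end

theorem theorem2p5:
  fixes M :: "('a, 'c) manifold"
    and B :: "('a, 'c) mvf \<Rightarrow> ('a, 'c) mvf \<Rightarrow> ('a, 'c) mvf"
    and BT :: "('a \<times> ('c \<Rightarrow> nat \<Rightarrow> real), 'c) mvf \<Rightarrow>
               ('a \<times> ('c \<Rightarrow> nat \<Rightarrow> real), 'c) mvf \<Rightarrow> ('a \<times> ('c \<Rightarrow> nat \<Rightarrow> real), 'c) mvf"
    and vT dT :: "('a, 'c) mvf \<Rightarrow> ('a \<times> ('c \<Rightarrow> nat \<Rightarrow> real), 'c) mvf"
    and X Y :: "('a, 'c) mvf"
  assumes "smooth_manifold M"
    and "is_schouten_bracket M B"
    and "is_schouten_bracket (tangent_bundle M) BT"
    and "is_vT M vT"
    and "is_dT M vT dT"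
    and "X \<in> mvfields M"
    and "Y \<in> mvfields M"
  shows "BT (dT X) (dT Y) = dT (B X Y)"
proof -
  interpret tangent_lifts M "mdim M" B BT vT dT
    using assms by unfold_locales auto
  show ?thesis by (rule dT_bracket[OF assms(6,7)])
qed

end
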